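(* Let $n=2m$, $G=SL(n,\mathbb{C})$, and let $Z=G/P$ be the flag manifold of a symmetric dimension sequence $(d_1,\dots,d_s,d_s,\dots,d_1)$ or $(d_1,\dots,d_s,e',d_s,\dots,d_1)$. Let $D\subset Z$ be the open $SL(m,\mathbb{H})$-orbit with base cycle $C_0$, and let $w=B_1B_2\dots B_sB_{e'}\tilde B_s\dots\tilde B_2\tilde B_1$ be a minimal representative ($B_{e'}$ omitted for the first type of sequence). Then $w$ satisfies the generalized strictly pairing condition if and only if $w$ parametrizes an Iwasawa–Schubert variety $S_w\in\mathcal{S}_{C_0}$; and the lifting map $f:\mathcal{S}_{C_0}\to\mathcal{S}_{\hat C_0}$ defined by $S_w\mapsto S_{\hat w}$, where $\hat w$ is the canonical rearrangement of $w$, is injective.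
   Context: Let $\mathbf{j}(v)=J\bar v$ on $\mathbb{C}^{2m}$ with $J=\begin{pmatrix}0&I_m\\-I_m&0\end{pmatrix}$, so $\mathbf{j}(e_i)=-e_{m+i}$ for $1\le i\le m$. $G_0=SL(m,\mathbb{H})=\{X\in G:\mathbf{j}X=X\mathbf{j}\}$, $K_0=SU(2m)\cap G_0=Sp(m)$. The flag manifold of a dimension sequence $(c_1,\dots,c_r)$ consists of the flags $0\subset V_1\subset\dots\subset V_r=\mathbb{C}^n$ with $\dim V_i/V_{i-1}=c_i$. In every flag manifold $G_0$ has exactly one open orbit; its base cycle is its unique $K_0$-orbit that is a complex submanifold. $\hat Z$ is the manifold of complete flags, $\pi:\hat Z\to Z$ the projection, $\hat D\subset\hat Z$ the open $G_0$-orbit and $\hat C_0$ its base cycle. Let $(u_1,\dots,u_n)=(e_1,\mathbf{j}(e_1),e_2,\mathbf{j}(e_2),\dots,e_m,\mathbf{j}(e_m))$ and let $B_I\subset G$ be the (Iwasawa–)Borel subgroup stabilizing the complete flag of this ordered basis. For $w\in\Sigma_n$ in one-line notation, $V_w$ is the complete flag with $k$-th subspace $\langle u_{w(1)},\dots,u_{w(k)}\rangle$. In $\hat Z$, $S_w$ is the closure of $B_I.V_w$. In $Z$, Iwasawa–Schubert varieties are indexed by minimal representatives $w$ (increasing inside each consecutive block of the dimension sequence), $S_w$ being the closure of $B_I.\pi(V_w)$. $\mathcal{S}_{C_0}$ is the set of $S_w\subset Z$ with $\dim S_w+\dim C_0=\dim Z$ and $S_w\cap C_0\ne\emptyset$;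 $\mathcal{S}_{\hat C_0}$ is defined likewise in $\hat Z$. $w$ is divided into blocks $B_1,\dots,B_s,(B_{e'}),\tilde B_s,\dots,\tilde B_1$, with $B_j,\tilde B_j$ of length $d_j$ and $B_{e'}$ of length $e'$. Generalized strictly pairing condition: for each $1\le j\le s$, writing $B_j=k_1^j\dots k_{d_j}^j$ and $\tilde B_j=l_1^j\dots l_{d_j}^j$ from left to right, $k_i^j$ is odd and $l_i^j=k_i^j+1$ for all $1\le i\le d_j$. Canonical rearrangement $\hat w$ of $w$: keep each $B_j$, replace each $\tilde B_j=l_1^j\dots l_{d_j}^j$ by $l_{d_j}^j\dots l_1^j$, and, if present, replace $B_{e'}=k'_1\dots k'_{e'}$ by $k'_1k'_3\dots k'_{e'-1}k'_{e'}\dots k'_4k'_2$. *)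

theory Defs
  imports "HOL-Analysis.Analysis" "HOL-Combinatorics.Multiset_Permutations"
begin

section \<open>Complex submanifolds of coordinate space\<close>

definition holo_map_on :: "(complex^'k \<Rightarrow> complex^'l) \<Rightarrow> (complex^'k) set \<Rightarrow> bool" where
  "holo_map_on f U \<longleftrightarrow> open U \<and>
     (\<forall>x\<in>U. \<exists>f'. (f has_derivative f') (at x) \<and> (\<forall>c v. f' (c *s v) = c *s f' v))"

text \<open>Embedded (not necessarily closed) submanifolds, by local biholomorphic straightening
  onto a complex linear subspace.\<close>

definition complex_submanifold :: "nat \<Rightarrow> (complex^'k) set \<Rightarrow> bool" where
  "complex_submanifold d A \<longleftrightarrow>
     (\<forall>a\<in>A. \<exists>U \<phi> \<psi> L. a \<in> U \<and> holo_map_on \<phi> U \<and>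
        holo_map_on (\<psi> :: complex^'k \<Rightarrow> complex^'k) (\<phi> ` U) \<and> (\<forall>x\<in>U. \<psi> (\<phi> x) = x) \<and>
        vec.subspace L \<and> vec.dim L = d \<and> \<phi> ` (A \<inter> U) = \<phi> ` U \<inter> L)"

section \<open>Flag manifolds\<close>

type_synonym 'n flag = "(complex^'n) set list"

definition flag_manifold :: "nat list \<Rightarrow> 'n::finite flag set" where
  "flag_manifold c = {V. length V = length c \<and> V \<noteq> [] \<and> last V = UNIV \<and>
     (\<forall>i<length c. vec.subspace (V ! i) \<and> vec.dim (V ! i) = sum_list (take (Suc i) c)) \<and>
     (\<forall>i. Suc i < length c \<longrightarrow> V ! i \<subseteq> V ! Suc i)}"

definition act :: "complex^'n^'n \<Rightarrow> 'n::finite flag \<Rightarrow> 'n flag" where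
  "act X V = map (\<lambda>U. (\<lambda>v. X *v v) ` U) V"

definition orbit :: "(complex^'n^'n) set \<Rightarrow> 'n::finite flag \<Rightarrow> 'n flag set" where
  "orbit H V = {act X V | X. X \<in> H}"

definition to_matrix :: "complex^('n \<times> 'n) \<Rightarrow> complex^'n^'n" where
  "to_matrix x = (\<chi> i k. x $ (i, k))"

text \<open>The flag manifold carries the topology and complex structure of the quotient of the
  general linear group by a parabolic subgroup, which is the same as that of the quotient of the
  special linear group. We use the general linear group because it is open in the space of
  matrices. The preimage below is taken under the orbit map of \<^term>\<open>V\<close>, which is a surjective
  holomorphic submersion; its fibre over \<^term>\<open>V\<close> is the stabilizer of \<^term>\<open>V\<close>.\<close>

definition orbit_preimage :: "'n::finite flag \<Rightarrow> 'n flag set \<Rightarrow> (complex^('n \<times> 'n)) set" where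
  "orbit_preimage V M = {x. invertible (to_matrix x) \<and> act (to_matrix x) V \<in> M}"

definition flag_topology :: "nat list \<Rightarrow> 'n::finite flag topology" where
  "flag_topology c = topology (\<lambda>U. U \<subseteq> flag_manifold c \<and>
     (\<forall>V\<in>flag_manifold c. open (orbit_preimage V U)))"

lemma openin_flag_topology:
  fixes U :: "'n::finite flag set"
  shows "openin (flag_topology c) U \<longleftrightarrow>
     U \<subseteq> flag_manifold c \<and> (\<forall>V\<in>flag_manifold c. open (orbit_preimage V U))"
proof -
  have "orbit_preimage V (S \<inter> T) = orbit_preimage V S \<inter> orbit_preimage V T"
    for V and S T :: "'n flag set"
    by (auto simp: orbit_preimage_def)
  moreover have "orbit_preimage V (\<Union>\<K>) = (\<Union>S\<in>\<K>. orbit_preimage V S)"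
    for V and \<K> :: "'n flag set set"
    by (auto simp: orbit_preimage_def)
  ultimately have "istopology (\<lambda>U :: 'n flag set. U \<subseteq> flag_manifold c \<and>
     (\<forall>V\<in>flag_manifold c. open (orbit_preimage V U)))"
    unfolding istopology_def by (auto intro!: open_Int open_UN)
  then show ?thesis
    by (simp add: flag_topology_def)
qed

definition flag_submanifold :: "nat list \<Rightarrow> nat \<Rightarrow> 'n::finite flag set \<Rightarrow> bool" where
  "flag_submanifold c d M \<longleftrightarrow> M \<subseteq> flag_manifold c \<and>
     (\<forall>V\<in>flag_manifold c. \<exists>p. complex_submanifold p (orbit_preimage V {V}) \<and>
        complex_submanifold (d + p) (orbit_preimage V M))"

text \<open>Complex dimension of an analytic subset: the largest dimension of its manifold of regular
  points.\<close>

definition cdim :: "nat list \<Rightarrow> 'n::finite flag set \<Rightarrow> nat" where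
  "cdim c A = Max {d. \<exists>M. M \<noteq> {} \<and> flag_submanifold c d M \<and>
     openin (subtopology (flag_topology c) A) M}"

section \<open>The groups\<close>

text \<open>The coordinates of the space of dimension $2m$ are indexed by \<^typ>\<open>'m + 'm\<close>, where the
  \<^term>\<open>CARD('m)\<close> = $m$ elements of the linearly ordered type \<^typ>\<open>'m\<close> stand for $1,\dots,m$ in
  increasing order; \<^term>\<open>Inl i\<close> is the index $i$ and \<^term>\<open>Inr i\<close> the index $m+i$.\<close>

definition J_mat :: "complex^('m::finite + 'm)^('m + 'm)" where
  "J_mat = (\<chi> r s. case (r, s) of
      (Inl i, Inr k) \<Rightarrow> if i = k then 1 else 0
    | (Inr i, Inl k) \<Rightarrow> if i = k then -1 else 0
    | _ \<Rightarrow> 0)"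

definition jmap :: "complex^('m::finite + 'm) \<Rightarrow> complex^('m + 'm)" where
  "jmap v = J_mat *v (\<chi> i. cnj (v $ i))"

definition SL :: "(complex^'n^'n::finite) set" where
  "SL = {X. det X = 1}"

definition SU :: "(complex^'n^'n::finite) set" where
  "SU = {X. (\<chi> i k. cnj (X $ k $ i)) ** X = mat 1 \<and> det X = 1}"

definition G0 :: "(complex^('m::finite + 'm)^('m + 'm)) set" where
  "G0 = {X \<in> SL. \<forall>v. jmap (X *v v) = X *v jmap v}"

definition K0 :: "(complex^('m::finite + 'm)^('m + 'm)) set" where
  "K0 = SU \<inter> G0"

definition is_open_orbit :: "nat list \<Rightarrow> ('m::finite + 'm) flag set \<Rightarrow> bool" where
  "is_open_orbit c D \<longleftrightarrow> openin (flag_topology c) D \<and> (\<exists>V\<in>flag_manifold c. D = orbit G0 V)"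

definition is_base_cycle ::
    "nat list \<Rightarrow> ('m::finite + 'm) flag set \<Rightarrow> ('m + 'm) flag set \<Rightarrow> bool" where
  "is_base_cycle c D C \<longleftrightarrow> (\<exists>V\<in>D. C = orbit K0 V) \<and> (\<exists>d. flag_submanifold c d C)"

section \<open>Iwasawa--Schubert varieties\<close>

definition u_basis :: "(complex^('m::{finite,linorder} + 'm)) list" where
  "u_basis = concat (map (\<lambda>i. [axis (Inl i) 1, jmap (axis (Inl i) 1)])
     (sorted_list_of_set (UNIV :: 'm set)))"

text \<open>Permutations are one-line words in the letters $1,\dots,n$, so the basis is indexed from 1.\<close>

definition u_vec :: "nat \<Rightarrow> complex^('m::{finite,linorder} + 'm)" where
  "u_vec k = u_basis ! (k - 1)"

definition perm_flag :: "nat list \<Rightarrow> ('m::{finite,linorder} + 'm) flag" where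
  "perm_flag w = map (\<lambda>k. vec.span (u_vec ` set (take k w))) [1..<Suc (length w)]"

definition B_I :: "(complex^('m::{finite,linorder} + 'm)^('m + 'm)) set" where
  "B_I = {X \<in> SL. act X (perm_flag [1..<Suc (2 * CARD('m))])
                     = perm_flag [1..<Suc (2 * CARD('m))]}"

definition proj_flag :: "nat list \<Rightarrow> 'n::finite flag \<Rightarrow> 'n flag" where
  "proj_flag c V = map (\<lambda>i. V ! (sum_list (take (Suc i) c) - 1)) [0..<length c]"

definition complete_dims :: "nat \<Rightarrow> nat list" where
  "complete_dims n = replicate n 1"

fun blocks :: "nat list \<Rightarrow> nat list \<Rightarrow> nat list list" where
  "blocks [] w = []"
| "blocks (d # ds) w = take d w # blocks ds (drop d w)"

definition minimal_reps :: "nat list \<Rightarrow> nat list set" where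
  "minimal_reps c = {w \<in> permutations_of_set {1..sum_list c}.
     \<forall>b\<in>set (blocks c w). sorted_wrt (<) b}"

text \<open>For \<^term>\<open>complete_dims n\<close> the projection is the identity on complete flags and every
  permutation is a minimal representative, so the following also covers complete flags.\<close>

definition schubert :: "nat list \<Rightarrow> nat list \<Rightarrow> ('m::{finite,linorder} + 'm) flag set" where
  "schubert c w = flag_topology c closure_of orbit B_I (proj_flag c (perm_flag w))"

definition schubert_set ::
    "nat list \<Rightarrow> ('m::{finite,linorder} + 'm) flag set \<Rightarrow> ('m + 'm) flag set set" where
  "schubert_set c C = {S. (\<exists>w\<in>minimal_reps c. S = schubert c w) \<and>
     cdim c S + cdim c C = cdim c (flag_manifold c :: ('m + 'm) flag set) \<and> S \<inter> C \<noteq> {}}"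

section \<open>Symmetric dimension sequences\<close>

text \<open>\<^term>\<open>e = 0\<close> encodes the sequences without a middle entry.\<close>

definition sym_dims :: "nat list \<Rightarrow> nat \<Rightarrow> nat list" where
  "sym_dims ds e = ds @ (if e = 0 then [] else [e]) @ rev ds"

text \<open>With indices from 0, $B_j$ is \<^term>\<open>blocks c w ! j\<close> and its partner is
  \<^term>\<open>rev (blocks c w) ! j\<close>.\<close>

definition generalized_strictly_pairing :: "nat list \<Rightarrow> nat \<Rightarrow> nat list \<Rightarrow> bool" where
  "generalized_strictly_pairing ds e w \<longleftrightarrow>
     (let bs = blocks (sym_dims ds e) w in
      \<forall>j<length ds. \<forall>i<ds ! j. odd (bs ! j ! i) \<and> rev bs ! j ! i = bs ! j ! i + 1)"

text \<open>The letters $k'_1,k'_3,\dots$ are those at the even positions when counting from 0.\<close>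

definition rearrange_middle :: "nat list \<Rightarrow> nat list" where
  "rearrange_middle b = nths b {i. even i} @ rev (nths b {i. odd i})"

definition canonical_rearrangement :: "nat list \<Rightarrow> nat \<Rightarrow> nat list \<Rightarrow> nat list" where
  "canonical_rearrangement ds e w =
     (let bs = blocks (sym_dims ds e) w; s = length ds in
      concat (take s bs) @
      (if e = 0 then [] else rearrange_middle (bs ! s)) @
      concat (map rev (drop (length bs - s) bs)))"

end

theory Submission
  imports Defs
begin

text \<open>Each variety is the closure of the Borel orbit of a coordinate flag. In block unipotent
  coordinates around that flag the orbit is linear, so its dimension is the number of inversions
  of the word; it is open in its closure, so the variety determines the word.

  The base cycle is an orbit of the compact group that is complex. Stationarity of the angle
  between \<open>V\<^sub>i\<close> and \<open>j(V\<^sub>k)\<close> in the complexified directions shows that it consists of the flags with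
  \<open>V\<^sub>i\<close> orthogonal to \<open>j(V\<^sub>k)\<close> whenever the dimensions of \<open>V\<^sub>i\<close> and \<open>V\<^sub>k\<close> add up to at most \<open>n\<close>.
  Hence its codimension is the number of pairs of letters lying in blocks whose positions have a
  sum smaller than that of two opposite blocks.

  On the open orbit \<open>V\<^sub>i\<close> and \<open>j(V\<^sub>k)\<close> are complementary when their dimensions add up to \<open>n\<close>.
  The first \<open>2k\<close> vectors of the Iwasawa basis span a subspace stable under \<open>j\<close>, so if a
  cell meets the open orbit, at least as many of the letters up to \<open>2k\<close> lie in the last \<open>i\<close> blocks
  as in the first \<open>i\<close>. Adding the letters \<open>2k-1, 2k\<close> pair by pair, this forces the number of
  inversions to be at least the codimension of the base cycle, with equality only if the two
  letters of every pair lie in opposite blocks in increasing order. This is the pairing condition,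
  and then the coordinate flag itself lies on the base cycle. The canonical rearrangement of such
  a word is \<open>x\<^sub>1 \<dots> x\<^sub>m (x\<^sub>m + 1) \<dots> (x\<^sub>1 + 1)\<close> with all \<open>x\<^sub>i\<close> odd.\<close>

section \<open>Complex submanifolds and their tangent spaces\<close>

text \<open>The hypotheses say of \<open>D\<close> only that it is an open orbit, and of the base
  cycle only that it is a \<open>K0\<close>-orbit in \<open>D\<close> which is a submanifold of some
  dimension; both have to be identified from these properties alone. For \<open>D\<close> a density
  argument suffices: some member is transversal, and \<open>G0\<close> carries this to all of
  \<open>D\<close>. For the cycle, real one-parameter subgroups of \<open>K0\<close> supply
  velocities, and since the submanifold condition makes the tangent space complex, these may be
  multiplied by the imaginary unit. The resulting Hermitian directions leave \<open>K0\<close>, and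
  this is what makes stationarity restrictive. Dimensions are computed in the space of matrices,
  where the stabilizer adds the same summand \<open>stab_dim b\<close> to every orbit through the
  base flag, so that it drops out. The codimension of the cycle is read off at a balanced coordinate
  flag, the dimension of a cell at the flag of the word; the two can be compared because
  \<open>pair_count\<close> depends only on the block sizes. Complete flags are the case
  \<open>sym_dims (replicate m 1) 0\<close>, so one criterion serves both ends of the lifting
  map.\<close>

definition submanifold_at :: "nat \<Rightarrow> (complex^'k) set \<Rightarrow> complex^'k \<Rightarrow> bool" where
  "submanifold_at d A a \<longleftrightarrow> (\<exists>U \<phi> (\<psi> :: complex^'k \<Rightarrow> complex^'k) L.
     a \<in> U \<and> holo_map_on \<phi> U \<and> holo_map_on \<psi> (\<phi> ` U) \<and> (\<forall>x\<in>U. \<psi> (\<phi> x) = x) \<and>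
     vec.subspace L \<and> vec.dim L = d \<and> \<phi> ` (A \<inter> U) = \<phi> ` U \<inter> L)"

lemma complex_submanifold_iff: "complex_submanifold d A \<longleftrightarrow> (\<forall>a\<in>A. submanifold_at d A a)"
  unfolding complex_submanifold_def submanifold_at_def by blast

text \<open>The parameter of the curves is real because the curves at hand inside a
  \<open>K0\<close>-orbit come from real one-parameter subgroups. That the velocities form a complex
  subspace is a consequence of the submanifold condition and not built in.\<close>

definition tangent_space :: "(complex^'k) set \<Rightarrow> complex^'k \<Rightarrow> (complex^'k) set" where
  "tangent_space A a = {v. \<exists>\<gamma>::real \<Rightarrow> complex^'k. \<gamma> 0 = a \<and>
     (\<gamma> has_vector_derivative v) (at 0) \<and> (\<forall>\<^sub>F t in at 0. \<gamma> t \<in> A)}"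

lemma vec_linearI:
  fixes g :: "complex^'k \<Rightarrow> complex^'l"
  assumes "\<And>x y. g (x + y) = g x + g y" "\<And>c v. g (c *s v) = c *s g v"
  shows "Vector_Spaces.linear (*s) (*s) g"
  using assms by (simp add: Vector_Spaces.linear_iff vec.vector_space_axioms)

lemma scaleR_eq_vector_scalar: "r *\<^sub>R (v :: complex^'k) = of_real r *s v"
  by (simp add: vec_eq_iff) (simp add: scaleR_conv_of_real)

lemma has_vector_derivative_quotient:
  fixes f :: "real \<Rightarrow> 'a::real_normed_vector"
  assumes "(f has_vector_derivative v) (at 0)"
  shows "((\<lambda>t. (1/t) *\<^sub>R (f t - f 0)) \<longlongrightarrow> v) (at 0)"
proof -
  have "((\<lambda>t. norm (f t - f 0 - t *\<^sub>R v) / norm t) \<longlongrightarrow> 0) (at 0)"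
    using assms unfolding has_vector_derivative_def has_derivative_iff_norm by simp
  moreover have "\<forall>\<^sub>F t in at 0. norm (f t - f 0 - t *\<^sub>R v) / norm t = norm ((1/t) *\<^sub>R (f t - f 0) - v)"
  proof (rule eventually_at_filter[THEN iffD2], rule always_eventually, intro allI impI)
    fix t :: real assume "t \<noteq> 0"
    then have "(1/t) *\<^sub>R (f t - f 0) - v = (1/t) *\<^sub>R (f t - f 0 - t *\<^sub>R v)"
      by (simp add: scaleR_right_diff_distrib)
    then show "norm (f t - f 0 - t *\<^sub>R v) / norm t = norm ((1/t) *\<^sub>R (f t - f 0) - v)"
      by simp
  qed
  ultimately have "((\<lambda>t. norm ((1/t) *\<^sub>R (f t - f 0) - v)) \<longlongrightarrow> 0) (at 0)"
    by (rule Lim_transform_eventually)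
  then show ?thesis by (rule LIM_zero_cancel[OF tendsto_norm_zero_cancel])
qed

lemma vec_subspace_imp_subspace:
  assumes "vec.subspace (L :: (complex^'k) set)" shows "subspace L"
  using assms vec.subspace_scale[OF assms, of _ "of_real _"]
  by (auto intro!: subspaceI simp only: vec.subspace_0 vec.subspace_add scaleR_eq_vector_scalar)

lemma vec_subspace_closed: "vec.subspace (L :: (complex^'k) set) \<Longrightarrow> closed L"
  by (simp add: closed_subspace vec_subspace_imp_subspace)

lemma holo_map_on_subset:
  "holo_map_on f U \<Longrightarrow> open V \<Longrightarrow> V \<subseteq> U \<Longrightarrow> holo_map_on f V"
  unfolding holo_map_on_def by blast

lemma holo_map_on_continuous: "holo_map_on f U \<Longrightarrow> continuous_on U f"
  unfolding holo_map_on_def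
  by (intro continuous_at_imp_continuous_on) (auto dest: has_derivative_continuous)

lemma holo_map_on_linear:
  assumes "Vector_Spaces.linear (*s) (*s) (f :: complex^'k \<Rightarrow> complex^'l)" "open U"
  shows "holo_map_on f U"
proof -
  interpret f: Vector_Spaces.linear "(*s)" "(*s)" f by fact
  have "linear f"
    by (rule linearI) (simp_all only: f.add scaleR_eq_vector_scalar f.scale)
  then have "bounded_linear f" by (simp add: linear_conv_bounded_linear)
  then have "(f has_derivative f) (at x)" for x by (rule bounded_linear_imp_has_derivative)
  then show ?thesis unfolding holo_map_on_def using assms(2) by (intro conjI ballI exI[of _ f]) (simp_all add: f.scale)
qed

lemma holo_map_on_compose:
  assumes f: "holo_map_on f U" and g: "holo_map_on g V" and "f ` U \<subseteq> V"
  shows "holo_map_on (g \<circ> f) U"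
  unfolding holo_map_on_def
proof (intro conjI ballI)
  show "open U" using f by (simp add: holo_map_on_def)
  fix x assume x: "x \<in> U"
  obtain f' where f': "(f has_derivative f') (at x)" "\<forall>c v. f' (c *s v) = c *s f' v"
    using f x unfolding holo_map_on_def by blast
  obtain g' where g': "(g has_derivative g') (at (f x))" "\<forall>c v. g' (c *s v) = c *s g' v"
    using g x assms(3) unfolding holo_map_on_def by blast
  show "\<exists>h. (g \<circ> f has_derivative h) (at x) \<and> (\<forall>c v. h (c *s v) = c *s h v)"
    using diff_chain_at[OF f'(1) g'(1)] f'(2) g'(2) by (intro exI[of _ "g' \<circ> f'"]) auto
qed

lemma vec_dim_inj_image:
  fixes f :: "complex^'k \<Rightarrow> complex^'l"
  assumes "Vector_Spaces.linear (*s) (*s) f" "inj f"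
  shows "vec.dim (f ` S) = vec.dim S"
  using vec.dim_image_eq[OF assms(1), of S] inj_on_subset[OF assms(2) subset_UNIV] .

lemma tangent_space_submanifold:
  fixes A :: "(complex^'k) set"
  assumes "submanifold_at d A a" "a \<in> A"
  shows "vec.subspace (tangent_space A a)" "vec.dim (tangent_space A a) = d"
proof -
  obtain U L and \<phi> \<psi> :: "complex^'k \<Rightarrow> complex^'k" where
    U: "a \<in> U" "holo_map_on \<phi> U" "holo_map_on \<psi> (\<phi> ` U)" "\<And>x. x \<in> U \<Longrightarrow> \<psi> (\<phi> x) = x"
    "vec.subspace L" "vec.dim L = d" "\<phi> ` (A \<inter> U) = \<phi> ` U \<inter> L"
    using assms(1) unfolding submanifold_at_def by metis
  have opU: "open U" "open (\<phi> ` U)" using U unfolding holo_map_on_def by auto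
  obtain p where p: "(\<phi> has_derivative p) (at a)" "\<And>c v. p (c *s v) = c *s p v"
    using U unfolding holo_map_on_def by blast
  obtain q where q: "(\<psi> has_derivative q) (at (\<phi> a))" "\<And>c v. q (c *s v) = c *s q v"
    using U unfolding holo_map_on_def by blast
  have blp: "bounded_linear p" and blq: "bounded_linear q"
    using p(1) q(1) has_derivative_bounded_linear by blast+
  then have linp: "Vector_Spaces.linear (*s) (*s) p" and linq: "Vector_Spaces.linear (*s) (*s) q"
    using p(2) q(2) by (auto intro!: vec_linearI simp: linear_simps)
  have "(\<psi> \<circ> \<phi> has_derivative q \<circ> p) (at a)" using diff_chain_at p(1) q(1) by blast
  then have "(id has_derivative q \<circ> p) (at a)"
    by (rule has_derivative_transform_within_open[OF _ opU(1) U(1)]) (simp add: U(4))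
  then have qp: "q \<circ> p = id" using has_derivative_id has_derivative_unique by blast
  have "linear p" "linear q" using blp blq by (auto simp: bounded_linear.linear)
  then have pq: "p \<circ> q = id"
    using qp linear_inverse_left by blast
  have injq: "inj q" using pq by (metis inj_on_inverseI comp_apply id_apply)
  have T: "tangent_space A a = q ` L"
  proof (intro set_eqI iffI)
    fix v assume "v \<in> tangent_space A a"
    then obtain \<gamma> :: "real \<Rightarrow> complex^'k" where g: "\<gamma> 0 = a" "(\<gamma> has_vector_derivative v) (at 0)"
      "\<forall>\<^sub>F t in at 0. \<gamma> t \<in> A" unfolding tangent_space_def by blast
    have cont: "isCont \<gamma> 0" using g(2) has_vector_derivative_continuous by blast
    then have "\<forall>\<^sub>F t in at 0. \<gamma> t \<in> U"
      using topological_tendstoD[OF cont[unfolded isCont_def] opU(1)] U(1) g(1) by simp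
    then have ev: "\<forall>\<^sub>F t in at 0. \<phi> (\<gamma> t) \<in> L"
      using g(3)
    proof eventually_elim
      case (elim t)
      then have "\<phi> (\<gamma> t) \<in> \<phi> ` (A \<inter> U)" by simp
      then show ?case unfolding U(7) by simp
    qed
    have "\<phi> a \<in> \<phi> ` (A \<inter> U)" using U(1) assms(2) by simp
    then have "\<phi> a \<in> L" unfolding U(7) by simp
    have der: "(\<phi> \<circ> \<gamma> has_vector_derivative p v) (at 0)"
      using has_derivative_compose[OF g(2)[unfolded has_vector_derivative_def], of \<phi> p] p(1) g(1) blp
      by (simp add: has_vector_derivative_def o_def linear_simps)
    then have lim: "((\<lambda>t. (1/t) *\<^sub>R (\<phi> (\<gamma> t) - \<phi> a)) \<longlongrightarrow> p v) (at 0)"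
      using has_vector_derivative_quotient[of "\<phi> \<circ> \<gamma>"] g(1) by simp
    \<comment> \<open>The difference quotients lie in \<open>L\<close>, which is closed, so their
      limit does too.\<close>
    have "p v \<in> L"
    proof (rule Lim_in_closed_set[OF vec_subspace_closed[OF U(5)] _ _ lim])
      show "\<forall>\<^sub>F t in at 0. (1 / t) *\<^sub>R (\<phi> (\<gamma> t) - \<phi> a) \<in> L"
        using ev by eventually_elim
          (use \<open>\<phi> a \<in> L\<close> vec_subspace_imp_subspace[OF U(5)] in \<open>simp add: subspace_diff subspace_scale\<close>)
    qed auto
    then show "v \<in> q ` L" using qp by (metis comp_apply id_apply image_eqI)
  next
    fix v assume "v \<in> q ` L"
    then obtain l where l: "l \<in> L" "v = q l" by blast
    \<comment> \<open>The straight line through \<open>\<phi> a\<close> in the direction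
      \<open>l\<close> stays in \<open>L\<close>; near \<open>0\<close> it stays in the image of the
      chart as well.\<close>
    define \<gamma> where "\<gamma> t = \<psi> (\<phi> a + t *\<^sub>R l)" for t :: real
    have d1: "((\<lambda>t. \<phi> a + t *\<^sub>R l) has_vector_derivative l) (at 0)"
      by (auto intro!: derivative_eq_intros)
    have "(\<gamma> has_vector_derivative q l) (at 0)"
      unfolding has_vector_derivative_def
    proof -
      have "((\<lambda>t. \<psi> (\<phi> a + t *\<^sub>R l)) has_derivative (\<lambda>t. q (t *\<^sub>R l))) (at 0)"
        using has_derivative_compose[OF d1[unfolded has_vector_derivative_def], of \<psi> q] q(1) by simp
      then show "(\<gamma> has_derivative (\<lambda>x. x *\<^sub>R q l)) (at 0)"
        unfolding \<gamma>_def using blq by (simp add: linear_simps)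
    qed
    moreover have "\<gamma> 0 = a" using U by (simp add: \<gamma>_def)
    moreover have "\<forall>\<^sub>F t in at 0. \<gamma> t \<in> A"
    proof -
      have "((\<lambda>t. \<phi> a + t *\<^sub>R l) \<longlongrightarrow> \<phi> a) (at 0)"
        by (auto intro!: tendsto_eq_intros)
      then have "\<forall>\<^sub>F t in at 0. \<phi> a + t *\<^sub>R l \<in> \<phi> ` U"
        by (rule topological_tendstoD[OF _ opU(2)]) (use U(1) in blast)
      then show ?thesis
      proof eventually_elim
        case (elim t)
        have "\<phi> a \<in> \<phi> ` (A \<inter> U)" using U(1) assms(2) by simp
        then have "\<phi> a \<in> L" unfolding U(7) by simp
        then have "\<phi> a + t *\<^sub>R l \<in> L"
          using l(1) vec_subspace_imp_subspace[OF U(5)] by (simp add: subspace_add subspace_scale)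
        then have "\<phi> a + t *\<^sub>R l \<in> \<phi> ` (A \<inter> U)" using elim unfolding U(7) by simp
        then obtain x where "x \<in> A \<inter> U" "\<phi> x = \<phi> a + t *\<^sub>R l" by (metis imageE)
        then show ?case unfolding \<gamma>_def using U(4)[of x] by auto
      qed
    qed
    ultimately show "v \<in> tangent_space A a" unfolding tangent_space_def l(2)
      by (intro CollectI exI[of _ \<gamma>] conjI)
  qed
  show "vec.subspace (tangent_space A a)"
    unfolding T using linq U(5) by (rule vec.linear_subspace_image)
  show "vec.dim (tangent_space A a) = d"
    unfolding T using vec_dim_inj_image[OF linq injq] U(6) by simp
qed

lemma tangent_space_cong:
  assumes "open W" "a \<in> W" "A \<inter> W = B \<inter> W"
  shows "tangent_space A a = tangent_space B a"
proof -
  have *: "tangent_space A a \<subseteq> tangent_space B a" if "A \<inter> W = B \<inter> W" for A B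
  proof
    fix v assume "v \<in> tangent_space A a"
    then obtain \<gamma> :: "real \<Rightarrow> complex^'a" where g: "\<gamma> 0 = a" "(\<gamma> has_vector_derivative v) (at 0)"
      "\<forall>\<^sub>F t in at 0. \<gamma> t \<in> A" unfolding tangent_space_def by blast
    have cont: "isCont \<gamma> 0" using g(2) has_vector_derivative_continuous by blast
    have "\<forall>\<^sub>F t in at 0. \<gamma> t \<in> W"
      using topological_tendstoD[OF cont[unfolded isCont_def] assms(1)] assms(2) g(1) by simp
    then have "\<forall>\<^sub>F t in at 0. \<gamma> t \<in> B" using g(3) by eventually_elim (use that in blast)
    with g show "v \<in> tangent_space B a" unfolding tangent_space_def by blast
  qed
  show ?thesis using *[of A B] *[of B A] assms(3) by auto
qed

text \<open>Both dimensions are that of one tangent space, which depends only on the set near the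
  point.\<close>

lemma submanifold_at_dim_unique:
  fixes A B :: "(complex^'k) set"
  assumes "submanifold_at d A a" "submanifold_at d' B a" "a \<in> A"
    "open W" "a \<in> W" "A \<inter> W = B \<inter> W"
  shows "d = d'"
proof -
  have "a \<in> B" using assms(3,5,6) by blast
  then show ?thesis
    using tangent_space_submanifold(2)[OF assms(1,3)] tangent_space_submanifold(2)[OF assms(2)]
      tangent_space_cong[OF assms(4-6)] by simp
qed

lemma submanifold_at_image:
  fixes T S :: "complex^'k \<Rightarrow> complex^'k"
  assumes "submanifold_at d A a"
    and T: "Vector_Spaces.linear (*s) (*s) T" and S: "Vector_Spaces.linear (*s) (*s) S"
    and ST: "\<And>x. S (T x) = x" "\<And>x. T (S x) = x"
  shows "submanifold_at d (T ` A) (T a)"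
proof -
  obtain U L and \<phi> \<psi> :: "complex^'k \<Rightarrow> complex^'k" where
    U: "a \<in> U" "holo_map_on \<phi> U" "holo_map_on \<psi> (\<phi> ` U)" "\<And>x. x \<in> U \<Longrightarrow> \<psi> (\<phi> x) = x"
    "vec.subspace L" "vec.dim L = d" "\<phi> ` (A \<inter> U) = \<phi> ` U \<inter> L"
    using assms(1) unfolding submanifold_at_def by metis
  have opU: "open U" "open (\<phi> ` U)" using U unfolding holo_map_on_def by auto
  have TU: "T ` U = S -` U" using ST by (auto simp: image_iff) (metis)
  have "continuous_on UNIV S" by (rule holo_map_on_continuous[OF holo_map_on_linear[OF S open_UNIV]])
  then have opTU: "open (T ` U)" unfolding TU using opU(1) by (rule open_vimage[rotated])
  have im: "(\<phi> \<circ> S) ` (T ` X) = \<phi> ` X" for X using ST by (auto simp: image_iff)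
  have 1: "holo_map_on (\<phi> \<circ> S) (T ` U)"
    by (rule holo_map_on_compose[OF holo_map_on_linear[OF S opTU] U(2)]) (auto simp: ST)
  have 2: "holo_map_on (T \<circ> \<psi>) ((\<phi> \<circ> S) ` (T ` U))"
    unfolding im by (rule holo_map_on_compose[OF U(3) holo_map_on_linear[OF T open_UNIV]]) auto
  have 3: "T ` A \<inter> T ` U = T ` (A \<inter> U)" using image_Int[of T A U] inj_on_inverseI[of UNIV S T] ST(1) by simp
  show ?thesis
    unfolding submanifold_at_def
  proof (intro exI conjI)
    show "(\<phi> \<circ> S) ` (T ` A \<inter> T ` U) = (\<phi> \<circ> S) ` (T ` U) \<inter> L"
      unfolding 3 im U(7) ..
  qed (use 1 2 U ST in auto)
qed

lemma submanifold_at_open_subspace: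
  assumes "vec.subspace L" "open W" "a \<in> W"
  shows "submanifold_at (vec.dim L) (L \<inter> W) a"
  unfolding submanifold_at_def
proof (intro exI conjI)
  have lin: "Vector_Spaces.linear (*s) (*s) (\<lambda>x :: complex^'a. x)" by (rule vec_linearI) auto
  show "holo_map_on (\<lambda>x. x) W" "holo_map_on (\<lambda>x. x) ((\<lambda>x. x) ` W)"
    using holo_map_on_linear[OF lin] assms(2) by auto
qed (use assms in auto)

section \<open>Flag manifolds as homogeneous spaces\<close>

definition of_matrix :: "complex^'n^'n \<Rightarrow> complex^('n \<times> 'n)" where
  "of_matrix X = (\<chi> p. X $ fst p $ snd p)"

lemma to_matrix_of_matrix [simp]: "to_matrix (of_matrix X) = X"
  by (simp add: to_matrix_def of_matrix_def vec_eq_iff)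

lemma of_matrix_to_matrix [simp]: "of_matrix (to_matrix x) = x"
  by (simp add: to_matrix_def of_matrix_def vec_eq_iff)

lemma to_matrix_nth [simp]: "to_matrix x $ a $ b = x $ (a, b)"
  by (simp add: to_matrix_def)

lemma of_matrix_nth [simp]: "of_matrix X $ (a, b) = X $ a $ b"
  by (simp add: of_matrix_def)

text \<open>Left factors move flags along an orbit; right factors change the base flag of the orbit
  map, or run through its stabilizer. The homogeneity arguments below use both at once.\<close>

definition sandwich :: "complex^'n^'n \<Rightarrow> complex^'n^'n \<Rightarrow> complex^('n \<times> 'n) \<Rightarrow> complex^('n::finite \<times> 'n)" where
  "sandwich P Q x = of_matrix (P ** to_matrix x ** Q)"

lemma sandwich_linear: "Vector_Spaces.linear (*s) (*s) (sandwich P Q)"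
proof (rule vec_linearI)
  have nth: "sandwich P Q x $ p = (\<Sum>k\<in>UNIV. (\<Sum>l\<in>UNIV. P $ fst p $ l * x $ (l, k)) * Q $ k $ snd p)"
    for x p by (cases p) (simp add: sandwich_def matrix_matrix_mult_def)
  show "sandwich P Q (x + y) = sandwich P Q x + sandwich P Q y" for x y
    by (simp add: vec_eq_iff nth algebra_simps sum.distrib)
  show "sandwich P Q (c *s x) = c *s sandwich P Q x" for c x
    by (simp add: vec_eq_iff nth algebra_simps sum_distrib_left)
qed

lemma sandwich_sandwich: "sandwich P Q (sandwich P' Q' x) = sandwich (P ** P') (Q' ** Q) x"
  by (simp add: sandwich_def matrix_mul_assoc)

lemma sandwich_one [simp]: "sandwich (mat 1) (mat 1) x = x"
  by (simp add: sandwich_def)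

lemma invertibleE:
  fixes g :: "complex^'n^'n"
  assumes "invertible g"
  obtains h where "invertible h" "g ** h = mat 1" "h ** g = mat 1"
  using assms unfolding invertible_def by blast

lemma length_act [simp]: "length (act X V) = length V"
  by (simp add: act_def)

lemma act_nth: "i < length V \<Longrightarrow> act X V ! i = (\<lambda>v. X *v v) ` (V ! i)"
  by (simp add: act_def)

lemma act_mult: "act (A ** B) V = act A (act B V)"
  by (simp add: act_def image_image matrix_vector_mul_assoc)

lemma act_one [simp]: "act (mat 1) V = V"
  by (simp add: act_def)

lemma act_cancel: "h ** g = mat 1 \<Longrightarrow> act h (act g V) = V"
  by (metis act_mult act_one)

lemma inj_matrix_vector_mult:
  fixes X :: "complex^'n^'n" assumes "invertible X" shows "inj ((*v) X)"
proof -
  obtain h where "h ** X = mat 1" using assms by (rule invertibleE)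
  then show ?thesis by (intro inj_on_inverseI[of _ "(*v) h"]) (simp add: matrix_vector_mul_assoc)
qed

lemma surj_matrix_vector_mult:
  fixes X :: "complex^'n^'n" assumes "invertible X" shows "surj ((*v) X)"
proof -
  obtain h where "X ** h = mat 1" using assms by (rule invertibleE)
  then show ?thesis by (intro surjI[of _ "(*v) h"]) (simp add: matrix_vector_mul_assoc)
qed

lemma act_flag_manifold:
  fixes X :: "complex^'n^'n"
  assumes "invertible X" "V \<in> flag_manifold c"
  shows "act X V \<in> flag_manifold c"
proof -
  have "V \<noteq> []" "last V = UNIV" "length V = length c" using assms(2) unfolding flag_manifold_def by auto
  moreover have "surj ((*v) X)"
    by (rule surj_matrix_vector_mult[OF assms(1)])
  ultimately have "last (act X V) = UNIV" by (simp add: act_def last_map)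
  moreover have "vec.dim ((*v) X ` S) = vec.dim S" for S
    by (rule vec_dim_inj_image[OF matrix_vector_mul_linear_gen inj_matrix_vector_mult[OF assms(1)]])
  moreover have "vec.subspace ((*v) X ` S)" if "vec.subspace S" for S
    by (rule vec.linear_subspace_image[OF matrix_vector_mul_linear_gen that])
  ultimately show ?thesis
    using assms(2) unfolding flag_manifold_def by (auto simp: act_nth act_def image_mono)
qed

lemma open_invertible: "open {x. invertible (to_matrix x :: complex^'n^'n)}"
proof -
  have "continuous_on UNIV (\<lambda>x. det (to_matrix x :: complex^'n^'n))"
    unfolding det_def to_matrix_nth by (intro continuous_intros)
  then have "open ((\<lambda>x. det (to_matrix x :: complex^'n^'n)) -` (- {0}))"
    by (intro open_vimage) auto
  then show ?thesis by (simp add: invertible_det_nz vimage_def)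
qed

lemma orbit_preimage_manifold:
  "V \<in> flag_manifold c \<Longrightarrow> orbit_preimage V (flag_manifold c) = {x. invertible (to_matrix x)}"
  by (auto simp: orbit_preimage_def act_flag_manifold)

lemma topspace_flag_topology: "topspace (flag_topology c) = (flag_manifold c :: 'n::finite flag set)"
proof -
  have "openin (flag_topology c) (flag_manifold c :: 'n flag set)"
    by (simp add: openin_flag_topology orbit_preimage_manifold open_invertible)
  then show ?thesis
    by (metis openin_flag_topology openin_subset openin_topspace subset_antisym)
qed

definition one_mat :: "complex^('n::finite \<times> 'n)" where "one_mat = of_matrix (mat 1)"

lemma to_matrix_one_mat [simp]: "to_matrix one_mat = mat 1"
  by (simp add: one_mat_def)

lemma invertible_mat_1 [simp]: "invertible (mat 1 :: complex^'n^'n)"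
  unfolding invertible_def by (rule exI[of _ "mat 1"]) simp

lemma one_mat_in_preimage [simp]: "one_mat \<in> orbit_preimage V M \<longleftrightarrow> V \<in> M"
  by (simp add: orbit_preimage_def)

lemma orbit_preimage_act:
  fixes g h :: "complex^'n^'n"
  assumes "g ** h = mat 1" "h ** g = mat 1"
  shows "orbit_preimage (act g V) M = sandwich (mat 1) h ` orbit_preimage V M"
proof (intro set_eqI iffI)
  have ig: "invertible g" "invertible h" using assms unfolding invertible_def by blast+
  fix x
  show "x \<in> sandwich (mat 1) h ` orbit_preimage V M" if "x \<in> orbit_preimage (act g V) M"
  proof
    show "x = sandwich (mat 1) h (sandwich (mat 1) g x)" by (simp add: sandwich_sandwich assms)
    show "sandwich (mat 1) g x \<in> orbit_preimage V M"
      using that ig by (auto simp: orbit_preimage_def sandwich_def act_mult invertible_mult)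
  qed
  show "x \<in> orbit_preimage (act g V) M" if "x \<in> sandwich (mat 1) h ` orbit_preimage V M"
    using that ig assms
    by (auto simp: orbit_preimage_def sandwich_def act_mult invertible_mult act_cancel)
qed

text \<open>Compared at the identity matrix: the fibre over \<open>V\<close> first fixes the summand
  \<open>p\<close>, then the preimages of \<open>M\<close> and \<open>M'\<close>, equal near the
  identity, fix \<open>d + p\<close>.\<close>

lemma flag_submanifold_dim_unique:
  fixes M M' :: "'n::finite flag set"
  assumes "flag_submanifold c d M" "flag_submanifold c d' M'" "V \<in> M"
    "openin (flag_topology c) U" "V \<in> U" "M \<inter> U = M' \<inter> U"
  shows "d = d'"
proof -
  have V: "V \<in> flag_manifold c" using assms(1,3) unfolding flag_submanifold_def by auto
  obtain p where p: "complex_submanifold p (orbit_preimage V {V})"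
      "complex_submanifold (d + p) (orbit_preimage V M)"
    using assms(1) V unfolding flag_submanifold_def by auto
  obtain p' where p': "complex_submanifold p' (orbit_preimage V {V})"
      "complex_submanifold (d' + p') (orbit_preimage V M')"
    using assms(2) V unfolding flag_submanifold_def by auto
  have "V \<in> M'" using assms by blast
  have "p = p'"
    by (rule submanifold_at_dim_unique[of _ "orbit_preimage V {V}" one_mat _ "orbit_preimage V {V}" UNIV])
      (use p p' in \<open>auto simp: complex_submanifold_iff\<close>)
  moreover have "d + p = d' + p'"
  proof (rule submanifold_at_dim_unique[of _ "orbit_preimage V M" one_mat _ "orbit_preimage V M'" "orbit_preimage V U"])
    show "open (orbit_preimage V U)" using assms(4) V openin_flag_topology by blast
    show "orbit_preimage V M \<inter> orbit_preimage V U = orbit_preimage V M' \<inter> orbit_preimage V U"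
      using assms(6) unfolding orbit_preimage_def by blast
  qed (use p p' assms \<open>V \<in> M'\<close> in \<open>auto simp: complex_submanifold_iff\<close>)
  ultimately show ?thesis by simp
qed

text \<open>A nonempty relatively open submanifold \<open>M\<close> of \<open>A\<close> meets the
  dense set \<open>O'\<close>, and near a common point the two coincide. Hence the set under
  \<open>Max\<close> is the singleton of \<open>d\<close>.\<close>

lemma cdim_eqI:
  fixes A O' :: "'n::finite flag set"
  assumes "O' \<noteq> {}" "flag_submanifold c d O'" "openin (subtopology (flag_topology c) A) O'"
    "A \<subseteq> flag_topology c closure_of O'"
  shows "cdim c A = d"
proof -
  obtain U where U: "openin (flag_topology c) U" "O' = U \<inter> A"
    using assms(3) unfolding openin_subtopology by blast
  have "d' = d" if M: "M \<noteq> {}" "flag_submanifold c d' M" "openin (subtopology (flag_topology c) A) M" for d' M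
  proof -
    obtain U' where U': "openin (flag_topology c) U'" "M = U' \<inter> A"
      using M(3) unfolding openin_subtopology by blast
    obtain V where "V \<in> M" using M(1) by blast
    then have "V \<in> flag_topology c closure_of O'" "V \<in> U'" using U' assms(4) by auto
    then obtain V' where V': "V' \<in> O'" "V' \<in> U'" using U'(1) unfolding in_closure_of by blast
    show ?thesis
      by (rule flag_submanifold_dim_unique[OF M(2) assms(2), of V' "U \<inter> U'"])
        (use U U' V' in \<open>auto intro: openin_Int\<close>)
  qed
  then have "{d. \<exists>M. M \<noteq> {} \<and> flag_submanifold c d M \<and> openin (subtopology (flag_topology c) A) M} = {d}"
    using assms by blast
  then show ?thesis unfolding cdim_def by simp
qed

lemma cdim_submanifold:
  assumes "M \<noteq> {}" "flag_submanifold c d M"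
  shows "cdim c M = d"
proof (rule cdim_eqI[OF assms])
  have "M \<subseteq> topspace (flag_topology c)"
    using assms(2) unfolding topspace_flag_topology flag_submanifold_def by blast
  then show "openin (subtopology (flag_topology c) M) M" "M \<subseteq> flag_topology c closure_of M"
    by (auto simp: openin_subtopology_refl closure_of_subset)
qed

section \<open>Orbits of matrix groups as submanifolds\<close>

definition matrix_group :: "(complex^'n^'n::finite) set \<Rightarrow> bool" where
  "matrix_group H \<longleftrightarrow> mat 1 \<in> H \<and> (\<forall>A\<in>H. \<forall>B\<in>H. A ** B \<in> H) \<and>
     (\<forall>A\<in>H. \<exists>B\<in>H. A ** B = mat 1 \<and> B ** A = mat 1)"

lemma matrix_group_invertible: "matrix_group H \<Longrightarrow> A \<in> H \<Longrightarrow> invertible A"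
  unfolding matrix_group_def invertible_def by blast

lemma matrix_group_singleton: "matrix_group {mat 1}"
  by (simp add: matrix_group_def)

lemma matrix_group_invertibles: "matrix_group {A. invertible A}"
  unfolding matrix_group_def by (auto simp: invertible_mult elim: invertibleE)

lemma orbit_act:
  assumes "matrix_group H" "A \<in> H" shows "act A V \<in> orbit H W \<longleftrightarrow> V \<in> orbit H W"
proof -
  obtain B where B: "B \<in> H" "A ** B = mat 1" "B ** A = mat 1" using assms unfolding matrix_group_def by blast
  have *: "act A V \<in> orbit H W" if "A \<in> H" "V \<in> orbit H W" for A V
    using that assms(1) unfolding orbit_def matrix_group_def by (auto simp: act_mult[symmetric])
  show ?thesis using *[OF assms(2)] *[OF B(1), of "act A V"] act_cancel[OF B(3)] by metis
qed

lemma orbit_refl: "matrix_group H \<Longrightarrow> V \<in> orbit H V"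
  unfolding orbit_def matrix_group_def by (auto intro: exI[of _ "mat 1"])

lemma orbit_eq:
  assumes "matrix_group H" "V \<in> orbit H W" shows "orbit H V = orbit H W"
proof -
  obtain A where A: "A \<in> H" "V = act A W" using assms(2) unfolding orbit_def by blast
  then obtain B where B: "B \<in> H" "A ** B = mat 1" "B ** A = mat 1" using assms(1) unfolding matrix_group_def by blast
  have W: "W = act B V" using A B by (simp add: act_cancel)
  have *: "orbit H V \<subseteq> orbit H W" if "A \<in> H" "V = act A W" for A V W
    using that assms(1) unfolding orbit_def matrix_group_def by (auto simp: act_mult[symmetric])
  show ?thesis using *[OF A] *[OF B(1) W] by blast
qed

text \<open>A point of the preimage is a product \<open>b ** q\<close> with \<open>b\<close> in
  \<open>H\<close> and \<open>q\<close> in the stabilizer of \<open>E\<close>. Multiplying by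
  \<open>b\<close> on the left and by \<open>q\<close> on the right maps the preimage onto itself
  and the identity to that point, so a chart at the identity can be transported.\<close>

lemma complex_submanifold_orbit_preimage:
  fixes H :: "(complex^'n^'n::finite) set"
  assumes H: "matrix_group H" and sub: "submanifold_at d (orbit_preimage E (orbit H E)) one_mat"
  shows "complex_submanifold d (orbit_preimage E (orbit H E))"
  unfolding complex_submanifold_iff
proof
  let ?A = "orbit_preimage E (orbit H E)"
  fix x assume x: "x \<in> ?A"
  then obtain b where b: "b \<in> H" "act (to_matrix x) E = act b E" and ix: "invertible (to_matrix x)"
    unfolding orbit_preimage_def orbit_def by blast
  obtain b' where b': "b' \<in> H" "b ** b' = mat 1" "b' ** b = mat 1" using H b(1) unfolding matrix_group_def by blast
  have ib: "invertible b" "invertible b'" using matrix_group_invertible H b b' by blast+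
  define q where "q = b' ** to_matrix x"
  have qE: "act q E = E" using b b' by (simp add: q_def act_mult act_cancel)
  have iq: "invertible q" using ib ix by (simp add: q_def invertible_mult)
  then obtain q' where q': "q ** q' = mat 1" "q' ** q = mat 1" "invertible q'" by (auto elim: invertibleE)
  have qE': "act q' E = E" using act_cancel[OF q'(2), of E] qE by simp
  have *: "sandwich b q z \<in> ?A" if "z \<in> ?A" "b \<in> H" "invertible q" "act q E = E" for z b q
    using that H matrix_group_invertible[OF H]
    by (auto simp: orbit_preimage_def sandwich_def act_mult invertible_mult orbit_act)
  have "sandwich b q ` ?A = ?A"
  proof
    show "?A \<subseteq> sandwich b q ` ?A"
    proof
      fix z assume "z \<in> ?A"
      then have "sandwich b' q' z \<in> ?A" using *[OF _ b'(1) q'(3) qE'] by blast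
      moreover have "z = sandwich b q (sandwich b' q' z)" using b' q' by (simp add: sandwich_sandwich)
      ultimately show "z \<in> sandwich b q ` ?A" by blast
    qed
  qed (use *[OF _ b(1) iq qE] in blast)
  moreover have "sandwich b q one_mat = x"
    using b' by (simp add: sandwich_def q_def matrix_mul_assoc)
  moreover have "submanifold_at d (sandwich b q ` ?A) (sandwich b q one_mat)"
    by (rule submanifold_at_image[OF sub sandwich_linear[of b q] sandwich_linear[of b' q']])
      (use b' q' in \<open>simp_all add: sandwich_sandwich\<close>)
  ultimately show "submanifold_at d ?A x" by simp
qed

lemma orbit_singleton [simp]: "orbit {mat 1} E = {E}"
  by (auto simp: orbit_def)

lemma complex_submanifold_sandwich:
  assumes "complex_submanifold d A" "P ** P' = mat 1" "P' ** P = mat 1" "Q ** Q' = mat 1" "Q' ** Q = mat 1"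
  shows "complex_submanifold d (sandwich P Q ` A)"
  unfolding complex_submanifold_iff
proof
  fix y assume "y \<in> sandwich P Q ` A"
  then obtain x where x: "x \<in> A" "y = sandwich P Q x" by blast
  show "submanifold_at d (sandwich P Q ` A) y" unfolding x(2)
    by (rule submanifold_at_image[OF _ sandwich_linear[of P Q] sandwich_linear[of P' Q']])
      (use assms x in \<open>simp_all add: sandwich_sandwich complex_submanifold_iff\<close>)
qed

text \<open>Reduces both conditions of \<open>flag_submanifold\<close>, which range over all base
  flags and all points, to two checks at the identity matrix for the single base flag
  \<open>E\<close>. Passing to another base flag conjugates the stabilizer and translates the
  preimage of the orbit.\<close>

lemma flag_submanifold_orbit:
  fixes H :: "(complex^'n^'n::finite) set"
  assumes E: "E \<in> flag_manifold c" and trans: "\<And>V. V \<in> flag_manifold c \<Longrightarrow> \<exists>g. invertible g \<and> V = act g E"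
    and H: "matrix_group H"
    and p: "submanifold_at p (orbit_preimage E {E}) one_mat"
    and d: "submanifold_at (d + p) (orbit_preimage E (orbit H E)) one_mat"
  shows "flag_submanifold c d (orbit H E)"
  unfolding flag_submanifold_def
proof (intro conjI ballI)
  show "orbit H E \<subseteq> flag_manifold c"
    using E matrix_group_invertible[OF H] by (auto simp: orbit_def act_flag_manifold)
  fix V :: "'n flag" assume "V \<in> flag_manifold c"
  then obtain g where g: "invertible g" "V = act g E" using trans by blast
  then obtain h where h: "g ** h = mat 1" "h ** g = mat 1" by (auto elim: invertibleE)
  have "complex_submanifold p (orbit_preimage E {E})"
    using complex_submanifold_orbit_preimage[OF matrix_group_singleton, of p E] p by simp
  moreover have "orbit_preimage V {V} = sandwich g h ` orbit_preimage E {E}"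
  proof -
    have "orbit_preimage E {V} = sandwich g (mat 1) ` orbit_preimage E {E}"
    proof (intro set_eqI iffI)
      have ig: "invertible h" using h unfolding invertible_def by blast
      fix x
      show "x \<in> sandwich g (mat 1) ` orbit_preimage E {E}" if "x \<in> orbit_preimage E {V}"
      proof
        show "x = sandwich g (mat 1) (sandwich h (mat 1) x)" by (simp add: sandwich_sandwich h)
        show "sandwich h (mat 1) x \<in> orbit_preimage E {E}"
          using that ig g h by (auto simp: orbit_preimage_def sandwich_def act_mult invertible_mult act_cancel)
      qed
      show "x \<in> orbit_preimage E {V}" if "x \<in> sandwich g (mat 1) ` orbit_preimage E {E}"
        using that g by (auto simp: orbit_preimage_def sandwich_def act_mult invertible_mult)
    qed
    then show ?thesis
      unfolding orbit_preimage_act[OF h, of E "{V}", folded g(2)]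
      by (simp add: image_image sandwich_sandwich)
  qed
  ultimately have "complex_submanifold p (orbit_preimage V {V})"
    using complex_submanifold_sandwich[of p _ g h h g] h by simp
  moreover have "complex_submanifold (d + p) (orbit_preimage V (orbit H E))"
    unfolding g(2) orbit_preimage_act[OF h]
    using complex_submanifold_sandwich[OF complex_submanifold_orbit_preimage[OF H d], of "mat 1" "mat 1" h g] h by simp
  ultimately show "\<exists>p. complex_submanifold p (orbit_preimage V {V}) \<and>
      complex_submanifold (d + p) (orbit_preimage V (orbit H E))" by blast
qed

section \<open>Coordinate flags and Borel orbits\<close>

definition coord_space :: "'n set \<Rightarrow> (complex^'n::finite) set" where
  "coord_space S = {v. \<forall>a. a \<notin> S \<longrightarrow> v $ a = 0}"

text \<open>\<open>b a\<close> is the index, counted from 0, of the step at which the basis vector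
  of the coordinate \<open>a\<close> enters the flag. A word will appear only through such a
  function, which forgets the order within blocks.\<close>

definition coord_flag :: "nat \<Rightarrow> ('n \<Rightarrow> nat) \<Rightarrow> 'n::finite flag" where
  "coord_flag r b = map (\<lambda>i. coord_space {a. b a \<le> i}) [0..<r]"

definition fits :: "nat list \<Rightarrow> ('n::finite \<Rightarrow> nat) \<Rightarrow> bool" where
  "fits c b \<longleftrightarrow> c \<noteq> [] \<and> (\<forall>a. b a < length c) \<and>
     (\<forall>i<length c. card {a. b a \<le> i} = sum_list (take (Suc i) c))"

lemma coord_space_subspace: "vec.subspace (coord_space S)"
  unfolding vec.subspace_def coord_space_def by auto

lemma coord_space_dim: "vec.dim (coord_space S) = card S"
  unfolding coord_space_def by (rule dim_substandard_cart)

lemma coord_space_Int: "coord_space S \<inter> coord_space T = coord_space (S \<inter> T)"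
  unfolding coord_space_def by auto

lemma axis_in_coord_space: "axis a 1 \<in> coord_space S \<longleftrightarrow> a \<in> S"
  unfolding coord_space_def axis_def by auto

lemma length_coord_flag [simp]: "length (coord_flag r b) = r"
  by (simp add: coord_flag_def)

lemma coord_flag_nth: "i < r \<Longrightarrow> coord_flag r b ! i = coord_space {a. b a \<le> i}"
  by (simp add: coord_flag_def)

lemma coord_flag_in_manifold:
  fixes b :: "'n::finite \<Rightarrow> nat"
  assumes "fits c b" shows "coord_flag (length c) b \<in> flag_manifold c"
proof -
  have c: "c \<noteq> []" "\<And>a. b a < length c" using assms unfolding fits_def by auto
  have "last (coord_flag (length c) b) = coord_space {a. b a \<le> length c - 1}"
    using c by (simp add: coord_flag_def last_map)
  moreover have "b a \<le> length c - 1" for a using c(2)[of a] by simp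
  then have "{a. b a \<le> length c - 1} = UNIV" by blast
  ultimately have "last (coord_flag (length c) b) = UNIV" by (simp only: coord_space_def) simp
  then show ?thesis
    using assms c unfolding flag_manifold_def fits_def
    by (auto simp: coord_flag_nth coord_space_subspace coord_space_dim)
      (auto simp: coord_flag_def coord_space_def)
qed

lemma flag_subspace: "V \<in> flag_manifold c \<Longrightarrow> i < length c \<Longrightarrow> vec.subspace (V ! i)"
  unfolding flag_manifold_def by auto

lemma flag_dim: "V \<in> flag_manifold c \<Longrightarrow> i < length c \<Longrightarrow> vec.dim (V ! i) = sum_list (take (Suc i) c)"
  unfolding flag_manifold_def by auto

lemma flag_length: "V \<in> flag_manifold c \<Longrightarrow> length V = length c"
  unfolding flag_manifold_def by auto

lemma flag_mono:
  assumes "V \<in> flag_manifold c" "i \<le> k" "k < length c" shows "V ! i \<subseteq> V ! k"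
  using assms(2,3)
proof (induction k rule: dec_induct)
  case (step n)
  then have "V ! n \<subseteq> V ! Suc n" using assms(1) unfolding flag_manifold_def by simp
  then show ?case using step by auto
qed simp

lemma flag_eqI:
  assumes "V \<in> flag_manifold c" "W \<in> flag_manifold c" "\<And>i. i < length c \<Longrightarrow> V ! i \<subseteq> W ! i"
  shows "V = W"
proof (rule nth_equalityI)
  show "length V = length W" using assms flag_length by metis
  fix i assume "i < length V"
  then have i: "i < length c" using assms flag_length by metis
  show "V ! i = W ! i"
    by (rule vec.subspace_dim_equal)
      (use assms i in \<open>simp_all add: flag_dim flag_subspace\<close>)
qed

definition column_matrix :: "('n \<Rightarrow> complex^'n) \<Rightarrow> complex^'n^'n" where
  "column_matrix v = (\<chi> i j. v j $ i)"

lemma column_matrix_mult: "column_matrix v *v x = (\<Sum>a\<in>UNIV. x $ a *s v a)"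
  by (simp add: vec_eq_iff column_matrix_def matrix_vector_mult_def mult.commute)

lemma column_matrix_axis [simp]: "column_matrix v *v axis a 1 = v a"
  by (simp add: vec_eq_iff column_matrix_def matrix_vector_mult_def axis_def if_distrib sum.delta cong: if_cong)

lemma matrix_mult_axis_nth [simp]: "((X :: complex^'n^'n) *v axis a 1) $ b = X $ b $ a"
  by (simp add: matrix_vector_mult_def axis_def if_distrib sum.delta cong: if_cong)

lemma invertible_iff_ker: "invertible (X :: complex^'n^'n) \<longleftrightarrow> (\<forall>x. X *v x = 0 \<longrightarrow> x = 0)"
  using invertible_left_inverse matrix_left_invertible_ker by metis

lemma column_matrix_act:
  fixes v :: "'n::finite \<Rightarrow> complex^'n"
  assumes V: "V \<in> flag_manifold c" and b: "fits c b" and v: "\<And>a. v a \<in> V ! b a"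
    and inv: "invertible (column_matrix v)"
  shows "act (column_matrix v) (coord_flag (length c) b) = V"
proof (rule flag_eqI[OF act_flag_manifold[OF inv coord_flag_in_manifold[OF b]] V])
  fix i assume i: "i < length c"
  show "act (column_matrix v) (coord_flag (length c) b) ! i \<subseteq> V ! i"
  proof
    fix y assume "y \<in> act (column_matrix v) (coord_flag (length c) b) ! i"
    then obtain x where x: "x \<in> coord_space {a. b a \<le> i}" "y = column_matrix v *v x"
      using i by (auto simp: act_nth coord_flag_nth)
    have "x $ a *s v a \<in> V ! i" for a
    proof (cases "b a \<le> i")
      case True
      then have "v a \<in> V ! i" using flag_mono[OF V True i] v by blast
      then show ?thesis using flag_subspace[OF V i] by (rule vec.subspace_scale[rotated])
    next
      case False
      then show ?thesis using x(1) flag_subspace[OF V i] by (simp add: coord_space_def vec.subspace_0)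
    qed
    then show "y \<in> V ! i" unfolding x(2) column_matrix_mult
      using flag_subspace[OF V i] by (simp add: vec.subspace_sum)
  qed
qed

lemma invertible_column_matrix:
  fixes v :: "'n::finite \<Rightarrow> complex^'n"
  assumes "inj v" "vec.independent (range v)"
  shows "invertible (column_matrix v)"
  unfolding invertible_iff_ker
proof (intro allI impI)
  fix x assume "column_matrix v *v x = 0"
  then have "(\<Sum>a\<in>UNIV. x $ a *s v a) = 0" by (simp add: column_matrix_mult)
  then have "(\<Sum>y\<in>range v. x $ inv v y *s y) = 0"
    using assms(1) by (simp add: sum.reindex)
  then have "\<forall>y\<in>range v. x $ inv v y = 0"
    using assms(2) vec.independentD[of "range v" "range v" "\<lambda>y. x $ inv v y"] by auto
  then show "x = 0" using assms(1) by (simp add: vec_eq_iff)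
qed

text \<open>A basis adapted to \<open>V\<close> is chosen coordinate by coordinate, in increasing
  order of \<open>b\<close>. When \<open>a\<close> is treated, fewer vectors than the dimension of
  \<open>V ! b a\<close> have been used, so that space contains a vector outside their span.\<close>

lemma flag_manifold_transitive:
  fixes b :: "'n::finite \<Rightarrow> nat"
  assumes V: "V \<in> flag_manifold c" and b: "fits c b"
  shows "\<exists>g. invertible g \<and> V = act g (coord_flag (length c) b)"
proof -
  have "\<exists>v. (\<forall>a\<in>S. v a \<in> V ! b a) \<and> inj_on v S \<and> vec.independent (v ` S)" for S :: "'n set"
    using finite[of S]
  proof (induction S rule: finite_ranking_induct[where f = b])
    case (insert a S)
    show ?case
    proof (cases "a \<in> S")
      case True
      then show ?thesis using insert by (simp add: insert_absorb)
    next
      case False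
      obtain v where v: "\<And>a. a \<in> S \<Longrightarrow> v a \<in> V ! b a" "inj_on v S" "vec.independent (v ` S)"
        using insert by blast
      have ba: "b a < length c" using b unfolding fits_def by blast
      have "card S < card {a'. b a' \<le> b a}"
        by (rule psubset_card_mono) (use False insert in auto)
      also have "\<dots> = vec.dim (V ! b a)" using b ba flag_dim[OF V ba] unfolding fits_def by simp
      finally have lt: "card S < vec.dim (V ! b a)" .
      have "\<not> V ! b a \<subseteq> vec.span (v ` S)"
      proof
        assume "V ! b a \<subseteq> vec.span (v ` S)"
        then have "vec.dim (V ! b a) \<le> card (v ` S)" by (rule vec.dim_le_card) simp
        also have "\<dots> = card S" using v(2) by (rule card_image)
        finally show False using lt by simp
      qed
      then obtain y where y: "y \<in> V ! b a" "y \<notin> vec.span (v ` S)" by blast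
      let ?v = "v(a := y)"
      have im: "?v ` S = v ` S" using False by auto
      show ?thesis
      proof (intro exI[of _ ?v] conjI)
        show "\<forall>a\<in>insert a S. ?v a \<in> V ! b a" using v(1) y(1) by auto
        show "inj_on ?v (insert a S)"
          using v(2) y(2) False vec.span_base[of y "v ` S"] im
          by (auto simp: inj_on_insert inj_on_fun_updI intro: inj_on_fun_updI)
        show "vec.independent (?v ` insert a S)"
          unfolding image_insert im using vec.independent_insertI[OF y(2) v(3)] by simp
      qed
    qed
  qed (simp_all add: vec.independent_empty)
  from this[of UNIV] obtain v where v: "\<And>a. v a \<in> V ! b a" "inj v" "vec.independent (range v)" by auto
  have "invertible (column_matrix v)" using v by (simp add: invertible_column_matrix)
  then show ?thesis using column_matrix_act[OF V b, of v] v(1) by metis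
qed

lemma act_coord_flag_fixed_iff:
  fixes X :: "complex^'n::finite^'n"
  assumes X: "invertible X" and b: "fits c b"
  shows "act X (coord_flag (length c) b) = coord_flag (length c) b \<longleftrightarrow>
    (\<forall>a a'. b a' < b a \<longrightarrow> X $ a $ a' = 0)"
proof
  assume L: "act X (coord_flag (length c) b) = coord_flag (length c) b"
  show "\<forall>a a'. b a' < b a \<longrightarrow> X $ a $ a' = 0"
  proof (intro allI impI)
    fix a a' assume ba: "b a' < b a"
    have i: "b a' < length c" using b unfolding fits_def by blast
    have "X *v axis a' 1 \<in> act X (coord_flag (length c) b) ! b a'"
      using i by (auto simp: act_nth coord_flag_nth axis_in_coord_space)
    then have "(X *v axis a' 1) $ a = 0"
      unfolding L using i ba by (auto simp: coord_flag_nth coord_space_def)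
    then show "X $ a $ a' = 0" by simp
  qed
next
  assume R: "\<forall>a a'. b a' < b a \<longrightarrow> X $ a $ a' = 0"
  have X_eq: "column_matrix (\<lambda>a. X *v axis a 1) = X"
    by (simp add: column_matrix_def vec_eq_iff)
  have "X *v axis a 1 \<in> coord_flag (length c) b ! b a" for a
    using R b unfolding fits_def by (auto simp: coord_flag_nth coord_space_def)
  then show "act X (coord_flag (length c) b) = coord_flag (length c) b"
    using column_matrix_act[OF coord_flag_in_manifold[OF b] b, of "\<lambda>a. X *v axis a 1"] X
    unfolding X_eq by blast
qed

section \<open>Borel groups of an ordering of the coordinates\<close>

definition numbering :: "('n::finite \<Rightarrow> nat) \<Rightarrow> bool" where
  "numbering q \<longleftrightarrow> bij_betw q UNIV {..<CARD('n)}"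

lemma numbering_fits:
  assumes "numbering (q :: 'n::finite \<Rightarrow> nat)" shows "fits (replicate CARD('n) 1) q"
proof -
  have inj: "inj q" and ran: "range q = {..<CARD('n)}"
    using assms unfolding numbering_def bij_betw_def by auto
  have "card {a. q a \<le> i} = Suc i" if "i < CARD('n)" for i
  proof -
    have "q ` {a. q a \<le> i} = {..i}"
    proof (intro equalityI subsetI)
      fix k assume "k \<in> {..i}"
      then have "k \<in> range q" unfolding ran using that by auto
      then show "k \<in> q ` {a. q a \<le> i}" using \<open>k \<in> {..i}\<close> by auto
    qed auto
    then show ?thesis using card_image[of q "{a. q a \<le> i}"] inj by (metis card_atMost inj_on_subset subset_UNIV)
  qed
  moreover have "q a < CARD('n)" for a using ran by (metis lessThan_iff rangeI)
  moreover have "sum_list (replicate k 1 :: nat list) = k" for k by (simp add: sum_list_replicate)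
  ultimately show ?thesis unfolding fits_def by (simp add: min_def sum_list_replicate)
qed

definition borel_group :: "('n::finite \<Rightarrow> nat) \<Rightarrow> (complex^'n^'n) set" where
  "borel_group q = {X \<in> SL. act X (coord_flag CARD('n) q) = coord_flag CARD('n) q}"

lemma matrix_group_stabilizer: "matrix_group {X \<in> SL. act X F = F}"
  unfolding matrix_group_def
proof (intro conjI ballI)
  show "mat 1 \<in> {X \<in> SL. act X F = F}" by (simp add: SL_def)
  show "A ** B \<in> {X \<in> SL. act X F = F}" if "A \<in> {X \<in> SL. act X F = F}" "B \<in> {X \<in> SL. act X F = F}" for A B
    using that by (simp add: SL_def det_mul act_mult)
  fix A assume A: "A \<in> {X \<in> SL. act X F = F}"
  then have "invertible A" by (simp add: SL_def invertible_det_nz)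
  then obtain B where B: "A ** B = mat 1" "B ** A = mat 1" by (rule invertibleE)
  have "det A * det B = 1" using B(1) by (metis det_I det_mul)
  then have "det B = 1" using A by (simp add: SL_def)
  moreover have "act B F = F" using act_cancel[OF B(2), of F] A by simp
  ultimately show "\<exists>B\<in>{X \<in> SL. act X F = F}. A ** B = mat 1 \<and> B ** A = mat 1"
    using B by (auto simp: SL_def)
qed

lemma matrix_group_borel: "matrix_group (borel_group q)"
  unfolding borel_group_def by (rule matrix_group_stabilizer)

lemma borel_iff:
  assumes "numbering (q :: 'n::finite \<Rightarrow> nat)"
  shows "X \<in> borel_group q \<longleftrightarrow> det X = 1 \<and> (\<forall>a a'. q a' < q a \<longrightarrow> X $ a $ a' = 0)"
  using act_coord_flag_fixed_iff[OF _ numbering_fits[OF assms], of X]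
  unfolding borel_group_def SL_def by (auto simp: invertible_det_nz)

lemma borel_mult_coord_space:
  assumes q: "numbering (q :: 'n::finite \<Rightarrow> nat)" and X: "X \<in> borel_group q" and v: "v \<in> coord_space {a. q a < k}"
  shows "X *v v \<in> coord_space {a. q a < k}"
  unfolding coord_space_def
proof (intro CollectI allI impI)
  fix a assume "a \<notin> {a. q a < k}"
  then have "\<not> q a < k" by simp
  have "X $ a $ a' * v $ a' = 0" for a'
  proof (cases "q a' < q a")
    case True then show ?thesis using X unfolding borel_iff[OF q] by simp
  next
    case False
    then show ?thesis using v \<open>\<not> q a < k\<close> unfolding coord_space_def by auto
  qed
  then show "(X *v v) $ a = 0" unfolding matrix_vector_mult_def vec_lambda_beta by (intro sum.neutral ballI)
qed

lemma borel_image_coord_space: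
  assumes q: "numbering (q :: 'n::finite \<Rightarrow> nat)" and X: "X \<in> borel_group q"
  shows "(*v) X ` coord_space {a. q a < k} = coord_space {a. q a < k}"
proof
  obtain Y where Y: "Y \<in> borel_group q" "X ** Y = mat 1" "Y ** X = mat 1"
    using matrix_group_borel[of q] X unfolding matrix_group_def by blast
  show "coord_space {a. q a < k} \<subseteq> (*v) X ` coord_space {a. q a < k}"
  proof
    fix v assume "v \<in> coord_space {a. q a < k}"
    then have "Y *v v \<in> coord_space {a. q a < k}" by (rule borel_mult_coord_space[OF q Y(1)])
    moreover have "X *v (Y *v v) = v" by (simp add: matrix_vector_mul_assoc Y)
    ultimately show "v \<in> (*v) X ` coord_space {a. q a < k}" by (metis imageI)
  qed
qed (use borel_mult_coord_space[OF q X] in blast)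

text \<open>Rescaling one column makes the determinant 1 without moving coordinate flags.\<close>

lemma upper_triangular_act:
  fixes Y :: "complex^'n::finite^'n"
  assumes q: "numbering q" and b: "fits c b" and Y: "invertible Y" "\<And>a a'. q a' < q a \<Longrightarrow> Y $ a $ a' = 0"
  shows "act Y (coord_flag (length c) b) \<in> orbit (borel_group q) (coord_flag (length c) b)"
proof -
  obtain a0 :: 'n where True by simp
  define D :: "complex^'n^'n" where "D = (\<chi> a a'. if a = a' then if a = a0 then 1 / det Y else 1 else 0)"
  have nz: "det Y \<noteq> 0" using Y by (simp add: invertible_det_nz)
  have "det D = (\<Prod>a\<in>UNIV. D $ a $ a)" by (rule det_diagonal) (simp add: D_def)
  also have "\<dots> = 1 / det Y" by (simp add: D_def prod.delta)
  finally have D: "det D = 1 / det Y" .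
  have "invertible D" using D nz by (simp add: invertible_det_nz)
  then have "act D (coord_flag (length c) b) = coord_flag (length c) b"
    unfolding act_coord_flag_fixed_iff[OF \<open>invertible D\<close> b] by (auto simp: D_def)
  then have "act Y (coord_flag (length c) b) = act (Y ** D) (coord_flag (length c) b)"
    by (simp add: act_mult)
  moreover have "Y ** D \<in> borel_group q"
  proof -
    have "(Y ** D) $ a $ a' = 0" if "q a' < q a" for a a'
    proof -
      have "Y $ a $ k * D $ k $ a' = 0" for k using Y(2)[OF that] by (auto simp: D_def)
      then show ?thesis unfolding matrix_matrix_mult_def vec_lambda_beta by (intro sum.neutral ballI)
    qed
    then show ?thesis unfolding borel_iff[OF q] using D nz by (simp add: det_mul)
  qed
  ultimately show ?thesis unfolding orbit_def by blast
qed

lemma leading_coordinate: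
  fixes v :: "complex^'n::finite" and q :: "'n \<Rightarrow> nat"
  assumes "v $ a \<noteq> 0"
  shows "\<exists>k. v $ k \<noteq> 0 \<and> (\<forall>l. v $ l \<noteq> 0 \<longrightarrow> q l \<le> q k)"
proof -
  let ?S = "q ` {k. v $ k \<noteq> 0}"
  have "Max ?S \<in> ?S" by (rule Max_in) (use assms in auto)
  then obtain k where "v $ k \<noteq> 0" "q k = Max ?S" by auto
  then show ?thesis by (intro exI[of _ k]) auto
qed

lemma invertible_triangular:
  fixes Y :: "complex^'n::finite^'n"
  assumes q: "numbering q" and Y: "\<And>a. Y $ a $ a \<noteq> 0" "\<And>a a'. q a' < q a \<Longrightarrow> Y $ a $ a' = 0"
  shows "invertible Y"
  unfolding invertible_iff_ker
proof (intro allI impI, rule ccontr)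
  fix x assume x: "Y *v x = 0" "x \<noteq> 0"
  then obtain a0 where ne: "x $ a0 \<noteq> 0" by (auto simp: vec_eq_iff)
  obtain a where a: "x $ a \<noteq> 0" "\<And>a'. x $ a' \<noteq> 0 \<Longrightarrow> q a' \<le> q a"
    using leading_coordinate[OF ne] by blast
  have summand: "Y $ a $ k * x $ k = (if k = a then Y $ a $ a * x $ a else 0)" for k
  proof (cases "k = a")
    case False
    have "inj q" using q unfolding numbering_def bij_betw_def by simp
    then have "q k \<noteq> q a" using False by (auto dest: injD)
    then show ?thesis using Y(2)[of k a] a(2)[of k] False by (cases "x $ k = 0") auto
  qed simp
  have "(Y *v x) $ a = (\<Sum>k\<in>UNIV. if k = a then Y $ a $ a * x $ a else 0)"
    unfolding matrix_vector_mult_def vec_lambda_beta by (intro sum.cong refl summand)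
  then have "(Y *v x) $ a = Y $ a $ a * x $ a" by simp
  then show False using x(1) a(1) Y(1)[of a] by simp
qed

text \<open>The rank table of a Bruhat cell: the dimension in which step \<open>i\<close> of the
  coordinate flag meets the span of the first \<open>k\<close> basis vectors of the Borel
  group.\<close>

definition cell_dim :: "('n::finite \<Rightarrow> nat) \<Rightarrow> ('n \<Rightarrow> nat) \<Rightarrow> nat \<Rightarrow> nat \<Rightarrow> nat" where
  "cell_dim q b i k = card {a. b a \<le> i \<and> q a < k}"

text \<open>The Borel group preserves the spans of initial basis vectors, so the table is constant
  on its orbits. Conversely a jump of the table at \<open>q a\<close> gives a vector in
  \<open>V ! b a\<close> with leading coordinate \<open>a\<close>; these vectors are the columns of
  a triangular matrix that carries the coordinate flag to \<open>V\<close>.\<close>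

lemma borel_orbit_iff:
  fixes b q :: "'n::finite \<Rightarrow> nat"
  assumes q: "numbering q" and b: "fits c b" and V: "V \<in> flag_manifold c"
  shows "V \<in> orbit (borel_group q) (coord_flag (length c) b) \<longleftrightarrow>
    (\<forall>i<length c. \<forall>k. vec.dim (V ! i \<inter> coord_space {a. q a < k}) = cell_dim q b i k)"
proof
  assume "V \<in> orbit (borel_group q) (coord_flag (length c) b)"
  then obtain X where X: "X \<in> borel_group q" "V = act X (coord_flag (length c) b)" unfolding orbit_def by blast
  have iX: "invertible X" using matrix_group_invertible[OF matrix_group_borel X(1)] .
  show "\<forall>i<length c. \<forall>k. vec.dim (V ! i \<inter> coord_space {a. q a < k}) = cell_dim q b i k"
  proof (intro allI impI)
    fix i k assume i: "i < length c"
    have "V ! i \<inter> coord_space {a. q a < k} =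
        (*v) X ` coord_space {a. b a \<le> i} \<inter> (*v) X ` coord_space {a. q a < k}"
      using i X by (simp add: act_nth coord_flag_nth borel_image_coord_space[OF q])
    also have "\<dots> = (*v) X ` coord_space ({a. b a \<le> i} \<inter> {a. q a < k})"
      by (simp add: image_Int[OF inj_matrix_vector_mult[OF iX], symmetric] coord_space_Int)
    finally show "vec.dim (V ! i \<inter> coord_space {a. q a < k}) = cell_dim q b i k"
      using vec_dim_inj_image[OF matrix_vector_mul_linear_gen inj_matrix_vector_mult[OF iX]]
      by (simp add: coord_space_dim cell_dim_def Collect_conj_eq)
  qed
next
  assume R: "\<forall>i<length c. \<forall>k. vec.dim (V ! i \<inter> coord_space {a. q a < k}) = cell_dim q b i k"
  have inj: "inj q" using q unfolding numbering_def bij_betw_def by simp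
  \<comment> \<open>Without such a vector, step \<open>b a\<close> would meet the first
    \<open>q a + 1\<close> and the first \<open>q a\<close> coordinates in the same space, although
    the table grows there because \<open>a\<close> itself is counted.\<close>
  have "\<exists>v. v \<in> V ! b a \<and> v \<in> coord_space {a'. q a' < Suc (q a)} \<and> v $ a \<noteq> 0" for a
  proof (rule ccontr)
    assume *: "\<not> ?thesis"
    have i: "b a < length c" using b unfolding fits_def by blast
    have "V ! b a \<inter> coord_space {a'. q a' < Suc (q a)} \<subseteq> V ! b a \<inter> coord_space {a'. q a' < q a}"
    proof (intro subsetI IntI)
      fix v assume v: "v \<in> V ! b a \<inter> coord_space {a'. q a' < Suc (q a)}"
      then have "v $ a = 0" using * by blast
      then show "v \<in> coord_space {a'. q a' < q a}"
        using v inj unfolding coord_space_def by (auto simp: less_Suc_eq dest: injD)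
    qed auto
    then have "cell_dim q b (b a) (Suc (q a)) \<le> cell_dim q b (b a) (q a)"
      using R i vec.dim_subset by metis
    moreover have "cell_dim q b (b a) (q a) < cell_dim q b (b a) (Suc (q a))"
      unfolding cell_dim_def by (rule psubset_card_mono) auto
    ultimately show False by simp
  qed
  then obtain v where v: "\<And>a. v a \<in> V ! b a" "\<And>a. v a \<in> coord_space {a'. q a' < Suc (q a)}"
    "\<And>a. v a $ a \<noteq> 0" by metis
  have tri: "column_matrix v $ a $ a' = 0" if "q a' < q a" for a a'
    using v(2)[of a'] that unfolding column_matrix_def coord_space_def by auto
  have "invertible (column_matrix v)"
    by (rule invertible_triangular[OF q _ tri]) (auto simp: column_matrix_def v(3))
  then show "V \<in> orbit (borel_group q) (coord_flag (length c) b)"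
    using upper_triangular_act[OF q b _ tri] column_matrix_act[OF V b v(1)] by metis
qed

text \<open>Column \<open>a'\<close> of \<open>N\<close> is the image of some \<open>x\<close> under
  a Borel element, which keeps the leading coordinate \<open>k\<close>. As \<open>x\<close> lies in
  step \<open>b a'\<close>, so does \<open>k\<close>; there \<open>N\<close> agrees with the
  identity, hence \<open>k = a'\<close> and nothing lies beyond \<open>a'\<close> in the order
  \<open>q\<close>.\<close>

lemma unipotent_in_borel_orbit:
  fixes N :: "complex^'n::finite^'n"
  assumes q: "numbering q" and b: "fits c b"
    and N: "\<And>a a'. b a \<le> b a' \<Longrightarrow> N $ a $ a' = (if a = a' then 1 else 0)" and inv: "invertible N"
    and orb: "act N (coord_flag (length c) b) \<in> orbit (borel_group q) (coord_flag (length c) b)"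
    and lt: "q a' < q a"
  shows "N $ a $ a' = 0"
proof -
  have inj: "inj q" using q unfolding numbering_def bij_betw_def by simp
  obtain X where X: "X \<in> borel_group q" "act N (coord_flag (length c) b) = act X (coord_flag (length c) b)"
    using orb unfolding orbit_def by blast
  have i: "b a' < length c" using b unfolding fits_def by blast
  define v where "v = N *v axis a' 1"
  have "v \<in> act N (coord_flag (length c) b) ! b a'"
    using i by (auto simp: act_nth coord_flag_nth v_def axis_in_coord_space)
  then obtain x where x: "x \<in> coord_space {a. b a \<le> b a'}" "v = X *v x"
    unfolding X(2) using i by (auto simp: act_nth coord_flag_nth)
  obtain Y where Y: "Y \<in> borel_group q" "Y ** X = mat 1"
    using matrix_group_borel[of q] X(1) unfolding matrix_group_def by blast
  have xv: "x = Y *v v" by (simp add: x(2) matrix_vector_mul_assoc Y)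
  have vn: "v $ k = N $ k $ a'" for k by (simp add: v_def)
  have "v $ a' = 1" by (simp add: vn N)
  then have ne: "v $ a' \<noteq> 0" by simp
  obtain k where k: "v $ k \<noteq> 0" "\<And>l. v $ l \<noteq> 0 \<Longrightarrow> q l \<le> q k"
    using leading_coordinate[OF ne] by blast
  have "v \<in> coord_space {a. q a < Suc (q k)}"
    unfolding coord_space_def using k(2) by (auto simp: less_Suc_eq_le)
  then have xk: "x \<in> coord_space {a. q a < Suc (q k)}"
    unfolding xv by (rule borel_mult_coord_space[OF q Y(1)])
  \<comment> \<open>Otherwise \<open>x\<close>, and with it \<open>v\<close>, would lie in the span
    of the coordinates strictly before \<open>k\<close>.\<close>
  have "x $ k \<noteq> 0"
  proof
    assume "x $ k = 0"
    then have "x \<in> coord_space {a. q a < q k}"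
      using xk inj unfolding coord_space_def by (auto simp: less_Suc_eq dest: injD)
    then have "v \<in> coord_space {a. q a < q k}"
      unfolding x(2) by (rule borel_mult_coord_space[OF q X(1)])
    then show False using k(1) unfolding coord_space_def by auto
  qed
  then have "b k \<le> b a'" using x(1) unfolding coord_space_def by auto
  then have "k = a'" using k(1) N[of k a'] by (auto simp: vn split: if_splits)
  then have "v $ a = 0" using k(2)[of a] lt by auto
  then show ?thesis by (simp add: vn)
qed

section \<open>Schubert cells\<close>

lemma matrix_add_rdistrib: "((A :: complex^'n^'m) + B) ** C = A ** C + B ** C"
  by (simp add: matrix_matrix_mult_def vec_eq_iff distrib_right sum.distrib)

text \<open>Made for the product \<open>(1 + L)(1 + U) = 1 + (L + U) + L U\<close>, an identity map
  with a quadratic correction. The derivative at \<open>0\<close> is the identity because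
  \<open>B\<close> is bilinear, so the inverse function theorem applies.\<close>

lemma quadratic_chart:
  fixes B :: "complex^'k \<Rightarrow> complex^'k \<Rightarrow> complex^'k" and e :: "complex^'k"
  assumes lin1: "\<And>y. Vector_Spaces.linear (*s) (*s) (\<lambda>x. B x y)"
    and lin2: "\<And>x. Vector_Spaces.linear (*s) (*s) (B x)"
  defines "\<Phi> \<equiv> \<lambda>x. e + x + B x x"
  obtains U V g where "open U" "0 \<in> U" "open V" "e \<in> V" "\<And>y. y \<in> V \<Longrightarrow> g y \<in> U \<and> \<Phi> (g y) = y"
    "\<And>x. x \<in> U \<Longrightarrow> \<Phi> x \<in> V \<and> g (\<Phi> x) = x" "holo_map_on \<Phi> U" "holo_map_on g V"
proof -
  interpret l1: Vector_Spaces.linear "(*s)" "(*s)" "\<lambda>x. B x y" for y by (rule lin1)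
  interpret l2: Vector_Spaces.linear "(*s)" "(*s)" "B x" for x by (rule lin2)
  have rl: "linear f" if "Vector_Spaces.linear (*s) (*s) f" for f :: "complex^'k \<Rightarrow> complex^'k"
  proof -
    interpret f: Vector_Spaces.linear "(*s)" "(*s)" f by (rule that)
    show ?thesis by (rule linearI) (simp_all only: f.add scaleR_eq_vector_scalar f.scale)
  qed
  have "bilinear B" unfolding bilinear_def using rl[OF lin1] rl[OF lin2] by auto
  then interpret B: bounded_bilinear B by (simp add: bilinear_conv_bounded_bilinear)
  define D where "D x h = h + (B x h + B h x)" for x h
  have blD: "bounded_linear (D x)" for x
    unfolding D_def by (intro bounded_linear_add bounded_linear_ident B.bounded_linear_left B.bounded_linear_right)
  have derD: "(\<Phi> has_derivative D x) (at x)" for x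
    unfolding \<Phi>_def D_def by (auto intro!: derivative_eq_intros B.FDERIV)
  have cD: "D x (c *s h) = c *s D x h" for x c h
    by (simp add: D_def l1.scale l2.scale vec.scale_right_distrib)
  have cont: "continuous_on UNIV (\<lambda>x. Blinfun (D x))"
  proof (rule continuous_on_blinfun_componentwise)
    fix i :: "complex^'k"
    have "continuous_on UNIV (\<lambda>x. D x i)" unfolding D_def
      by (intro continuous_intros B.continuous_on)
    then show "continuous_on UNIV (\<lambda>x. blinfun_apply (Blinfun (D x)) i)"
      by (simp add: bounded_linear_Blinfun_apply[OF blD])
  qed
  have D0: "D 0 = id" by (auto simp: D_def B.zero_left B.zero_right)
  have "Blinfun (D 0) = id_blinfun"
    by (rule blinfun_eqI) (simp add: D0 bounded_linear_Blinfun_apply id_def bounded_linear_ident)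
  then have inv: "id_blinfun o\<^sub>L Blinfun (D 0) = id_blinfun" by (auto intro: blinfun_eqI)
  obtain U V g g' where UV: "open U" "0 \<in> U" "open V" "\<Phi> 0 \<in> V" and hom: "homeomorphism U V \<Phi> g"
    and g: "\<And>y. y \<in> V \<Longrightarrow> (g has_derivative g' y) (at y)"
      "\<And>y. y \<in> V \<Longrightarrow> g' y = Hilbert_Choice.inv (blinfun_apply (Blinfun (D (g y))))"
      "\<And>y. y \<in> V \<Longrightarrow> bij (blinfun_apply (Blinfun (D (g y))))"
    by (rule inverse_function_theorem[OF open_UNIV _ cont _ inv, of \<Phi>])
      (use derD in \<open>auto simp: bounded_linear_Blinfun_apply[OF blD]\<close>)
  have "holo_map_on \<Phi> U"
    unfolding holo_map_on_def using UV(1) derD cD by blast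
  moreover have "holo_map_on g V"
    unfolding holo_map_on_def
  proof (intro conjI ballI exI)
    fix y assume y: "y \<in> V"
    show "(g has_derivative g' y) (at y)" by (rule g(1)[OF y])
    have bij: "bij (D (g y))" and g': "g' y = Hilbert_Choice.inv (D (g y))"
      using g(2,3)[OF y] by (simp_all add: bounded_linear_Blinfun_apply[OF blD])
    \<comment> \<open>The theorem gives a real derivative of \<open>g\<close>. It is complex linear
      as the inverse of the complex linear map \<open>D (g y)\<close>.\<close>
    show "\<forall>c v. g' y (c *s v) = c *s g' y v"
    proof (intro allI)
      fix c v
      have "D (g y) (c *s g' y v) = c *s v"
        unfolding cD g' using bij by (simp add: bij_is_surj surj_f_inv_f)
      then show "g' y (c *s v) = c *s g' y v"
        using inv_f_f[OF bij_is_inj[OF bij], of "c *s g' y v"] unfolding g' by simp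
    qed
  qed (rule UV(3))
  moreover have "\<Phi> 0 = e" by (simp add: \<Phi>_def B.zero_left)
  ultimately show ?thesis
    using UV hom by (intro that[of U V g]) (auto simp: homeomorphism_def)
qed

text \<open>The matrix positions strictly below the block diagonal of \<open>b\<close> in which a
  matrix of the Borel group may be nonzero. For a word these are the inversions between letters of
  different blocks.\<close>

definition inversions :: "('n::finite \<Rightarrow> nat) \<Rightarrow> ('n \<Rightarrow> nat) \<Rightarrow> nat" where
  "inversions q b = card {(a, a'). q a < q a' \<and> b a' < b a}"

definition stab_dim :: "('n::finite \<Rightarrow> nat) \<Rightarrow> nat" where
  "stab_dim b = card {(a, a'). b a \<le> b a'}"

lemma orbit_preimage_stabilizer:
  fixes b :: "'n::finite \<Rightarrow> nat"
  assumes "fits c b"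
  shows "orbit_preimage (coord_flag (length c) b) {coord_flag (length c) b} =
    coord_space {(a, a'). b a \<le> b a'} \<inter> {x. invertible (to_matrix x)}"
  using act_coord_flag_fixed_iff[OF _ assms]
  by (auto simp: orbit_preimage_def coord_space_def not_le)

lemma submanifold_at_stabilizer:
  fixes b :: "'n::finite \<Rightarrow> nat"
  assumes "fits c b"
  shows "submanifold_at (stab_dim b) (orbit_preimage (coord_flag (length c) b) {coord_flag (length c) b}) one_mat"
  unfolding orbit_preimage_stabilizer[OF assms] stab_dim_def coord_space_dim[symmetric]
  by (rule submanifold_at_open_subspace) (simp_all add: coord_space_subspace open_invertible)

text \<open>Near the identity a matrix factors uniquely as a block unipotent matrix times an element of
  the stabilizer of the coordinate flag; in these coordinates the preimage of the cell is linear.\<close>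

lemma submanifold_at_cell:
  fixes b q :: "'n::finite \<Rightarrow> nat"
  assumes q: "numbering q" and b: "fits c b"
  defines "E \<equiv> coord_flag (length c) b"
  shows "submanifold_at (inversions q b + stab_dim b) (orbit_preimage E (orbit (borel_group q) E)) one_mat"
proof -
  define low :: "complex^('n \<times> 'n) \<Rightarrow> complex^'n^'n" where
    "low x = (\<chi> a a'. if b a' < b a then x $ (a, a') else 0)" for x
  define upp :: "complex^('n \<times> 'n) \<Rightarrow> complex^'n^'n" where
    "upp x = (\<chi> a a'. if b a \<le> b a' then x $ (a, a') else 0)" for x
  define B where "B x y = of_matrix (low x ** upp y)" for x y
  have Bn: "B x y $ p = (\<Sum>k\<in>UNIV. low x $ fst p $ k * upp y $ k $ snd p)" for x y p
    by (cases p) (simp add: B_def matrix_matrix_mult_def)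
  have lu: "low (x + y) $ a $ k = low x $ a $ k + low y $ a $ k" "upp (x + y) $ a $ k = upp x $ a $ k + upp y $ a $ k"
    "low (r *s x) $ a $ k = r * low x $ a $ k" "upp (r *s x) $ a $ k = r * upp x $ a $ k" for x y a k r
    by (simp_all add: low_def upp_def)
  have l1: "Vector_Spaces.linear (*s) (*s) (\<lambda>x. B x y)" for y
    by (rule vec_linearI) (simp_all add: vec_eq_iff Bn lu algebra_simps sum.distrib sum_distrib_left)
  have l2: "Vector_Spaces.linear (*s) (*s) (B x)" for x
    by (rule vec_linearI) (simp_all add: vec_eq_iff Bn lu algebra_simps sum.distrib sum_distrib_left)
  define \<Phi> where "\<Phi> = (\<lambda>x. one_mat + x + B x x)"
  obtain U V g where UV: "open U" "0 \<in> U" "open V" "one_mat \<in> V" "\<And>y. y \<in> V \<Longrightarrow> g y \<in> U \<and> \<Phi> (g y) = y"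
    "\<And>x. x \<in> U \<Longrightarrow> \<Phi> x \<in> V \<and> g (\<Phi> x) = x" "holo_map_on \<Phi> U" "holo_map_on g V"
    using quadratic_chart[OF l1 l2, of one_mat] unfolding \<Phi>_def by blast
  have fac: "to_matrix (\<Phi> x) = (mat 1 + low x) ** (mat 1 + upp x)" for x
  proof -
    have "to_matrix x = low x + upp x" by (auto simp: vec_eq_iff low_def upp_def)
    moreover have "to_matrix (u + v) = to_matrix u + to_matrix v" for u v :: "complex^('n \<times> 'n)"
      by (simp add: vec_eq_iff)
    ultimately show ?thesis
      by (simp add: \<Phi>_def B_def matrix_add_ldistrib matrix_add_rdistrib add.assoc)
  qed
  \<comment> \<open>The positions in or above the diagonal blocks are free, being absorbed by the
    stabilizer; below them only the positions allowed by the Borel group remain.\<close>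
  define L :: "(complex^('n \<times> 'n)) set" where "L = coord_space {(a, a'). b a \<le> b a' \<or> q a < q a'}"
  define W where "W = V \<inter> {y. invertible (to_matrix y)}"
  have opW: "open W" unfolding W_def using UV(3) open_invertible by blast
  have gW: "g ` W = U \<inter> \<Phi> -` {y. invertible (to_matrix y)}"
  proof (intro equalityI subsetI)
    fix x assume "x \<in> g ` W"
    then obtain y where "y \<in> V" "invertible (to_matrix y)" "x = g y" unfolding W_def by blast
    then show "x \<in> U \<inter> \<Phi> -` {y. invertible (to_matrix y)}" using UV(5)[of y] by simp
  next
    fix x assume "x \<in> U \<inter> \<Phi> -` {y. invertible (to_matrix y)}"
    then have "\<Phi> x \<in> W" "g (\<Phi> x) = x" using UV(6)[of x] unfolding W_def by auto
    then show "x \<in> g ` W" by (metis imageI)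
  qed
  have opgW: "open (g ` W)" unfolding gW
    by (rule continuous_open_preimage[OF holo_map_on_continuous[OF UV(7)] UV(1) open_invertible])
  have key: "y \<in> orbit_preimage E (orbit (borel_group q) E) \<longleftrightarrow> g y \<in> L" if y: "y \<in> W" for y
  proof -
    let ?x = "g y"
    have inv: "invertible (to_matrix y)" and yx: "to_matrix y = (mat 1 + low ?x) ** (mat 1 + upp ?x)"
      using y UV(5)[of y] fac[of ?x] unfolding W_def by auto
    have "det (mat 1 + low ?x) * det (mat 1 + upp ?x) \<noteq> 0"
      using inv unfolding yx invertible_det_nz by (simp add: det_mul)
    then have i: "invertible (mat 1 + low ?x)" "invertible (mat 1 + upp ?x)"
      by (auto simp: invertible_det_nz)
    \<comment> \<open>The right factor fixes the flag, so membership in the orbit depends only on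
      the unipotent factor.\<close>
    have "act (mat 1 + upp ?x) E = E"
      unfolding E_def act_coord_flag_fixed_iff[OF i(2) b] by (auto simp: upp_def mat_def)
    then have act: "act (to_matrix y) E = act (mat 1 + low ?x) E" unfolding yx act_mult by simp
    have low: "(mat 1 + low ?x) $ a $ a' = (if a = a' then 1 else 0)" if "b a \<le> b a'" for a a'
      using that by (simp add: low_def mat_def)
    have low': "(mat 1 + low ?x) $ a $ a' = ?x $ (a, a')" if "b a' < b a" for a a'
      using that by (auto simp: low_def mat_def)
    have "act (to_matrix y) E \<in> orbit (borel_group q) E \<longleftrightarrow> ?x \<in> L"
    proof
      assume "act (to_matrix y) E \<in> orbit (borel_group q) E"
      then have orb: "act (mat 1 + low ?x) (coord_flag (length c) b) \<in> orbit (borel_group q) (coord_flag (length c) b)"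
        unfolding act unfolding E_def .
      have "?x $ (a, a') = 0" if "b a' < b a" "\<not> q a < q a'" for a a'
      proof -
        have "a \<noteq> a'" using that by auto
        then have "q a' < q a" using that(2) q unfolding numbering_def bij_betw_def
          by (metis injD linorder_neqE_nat)
        then show ?thesis
          using unipotent_in_borel_orbit[OF q b low i(1) orb] low'[OF that(1)] by simp
      qed
      then show "?x \<in> L" unfolding L_def coord_space_def by auto
    next
      assume xL: "?x \<in> L"
      have "(mat 1 + low ?x) $ a $ a' = 0" if "q a' < q a" for a a'
      proof (cases "b a \<le> b a'")
        case True then show ?thesis using low[OF True] that by auto
      next
        case False then show ?thesis using low'[of a' a] xL that unfolding L_def coord_space_def by auto
      qed
      then show "act (to_matrix y) E \<in> orbit (borel_group q) E"
        unfolding act unfolding E_def by (rule upper_triangular_act[OF q b i(1)])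
    qed
    then show ?thesis using inv by (simp add: orbit_preimage_def)
  qed
  have "inversions q b + stab_dim b = vec.dim L"
  proof -
    have "{(a, a'). b a \<le> b a' \<or> q a < q a'} = {(a, a'). q a < q a' \<and> b a' < b a} \<union> {(a, a'). b a \<le> b a'}"
      by auto
    moreover have "card ({(a, a'). q a < q a' \<and> b a' < b a} \<union> {(a, a'). b a \<le> b a'}) = inversions q b + stab_dim b"
      unfolding inversions_def stab_dim_def by (rule card_Un_disjoint) auto
    ultimately show ?thesis by (simp add: L_def coord_space_dim)
  qed
  moreover have "g ` (orbit_preimage E (orbit (borel_group q) E) \<inter> W) = g ` W \<inter> L"
    using key by auto
  moreover have "one_mat \<in> W" using UV(4) by (simp add: W_def)
  moreover have "holo_map_on g W" by (rule holo_map_on_subset[OF UV(8) opW]) (auto simp: W_def)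
  moreover have "holo_map_on \<Phi> (g ` W)" by (rule holo_map_on_subset[OF UV(7) opgW]) (auto simp: gW)
  moreover have "\<forall>y\<in>W. \<Phi> (g y) = y" using UV(5) by (auto simp: W_def)
  moreover have "vec.subspace L" by (simp add: L_def coord_space_subspace)
  ultimately show ?thesis unfolding submanifold_at_def by metis
qed

lemma flag_submanifold_cell:
  fixes b q :: "'n::finite \<Rightarrow> nat"
  assumes q: "numbering q" and b: "fits c b"
  shows "flag_submanifold c (inversions q b) (orbit (borel_group q) (coord_flag (length c) b))"
  by (rule flag_submanifold_orbit[OF coord_flag_in_manifold[OF b] flag_manifold_transitive[OF _ b]
        matrix_group_borel submanifold_at_stabilizer[OF b] submanifold_at_cell[OF q b]])

lemma cdim_flag_manifold:
  fixes b :: "'n::finite \<Rightarrow> nat"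
  assumes b: "fits c b"
  shows "cdim c (flag_manifold c :: 'n flag set) + stab_dim b = CARD('n)\<^sup>2"
proof -
  let ?E = "coord_flag (length c) b"
  have le: "stab_dim b \<le> CARD('n)\<^sup>2"
  proof -
    have "stab_dim b \<le> card (UNIV :: ('n \<times> 'n) set)" unfolding stab_dim_def by (rule card_mono) auto
    then show ?thesis by (simp add: power2_eq_square)
  qed
  have Z: "orbit {A. invertible A} ?E = flag_manifold c"
    using flag_manifold_transitive[OF _ b] coord_flag_in_manifold[OF b]
    by (auto simp: orbit_def act_flag_manifold)
  have "submanifold_at (vec.dim (UNIV :: (complex^('n \<times> 'n)) set)) (UNIV \<inter> {x. invertible (to_matrix x)}) (one_mat :: complex^('n \<times> 'n))"
    by (rule submanifold_at_open_subspace) (simp_all add: open_invertible)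
  then have sub: "submanifold_at (CARD('n)\<^sup>2 - stab_dim b + stab_dim b) (orbit_preimage ?E (orbit {A. invertible A} ?E)) one_mat"
    using le by (simp add: Z orbit_preimage_manifold[OF coord_flag_in_manifold[OF b]] card_cart_basis power2_eq_square)
  have "flag_submanifold c (CARD('n)\<^sup>2 - stab_dim b) (orbit {A. invertible A} ?E)"
    by (rule flag_submanifold_orbit[OF coord_flag_in_manifold[OF b] flag_manifold_transitive[OF _ b]
        matrix_group_invertibles submanifold_at_stabilizer[OF b] sub])
  moreover have "flag_manifold c \<noteq> ({} :: 'n flag set)" using coord_flag_in_manifold[OF b] by blast
  ultimately have "cdim c (flag_manifold c :: 'n flag set) = CARD('n)\<^sup>2 - stab_dim b"
    unfolding Z by (intro cdim_submanifold)
  then show ?thesis using le by simp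
qed

section \<open>Semicontinuity of intersection dimensions\<close>

lemma vec_complement_exists:
  fixes W D :: "(complex^'n) set"
  assumes W: "vec.subspace W" and D: "vec.subspace D" "D \<subseteq> W"
  obtains W1 where "vec.subspace W1" "W1 \<subseteq> W" "W1 \<inter> D = {0}" "vec.dim W1 + vec.dim D = vec.dim W"
proof -
  obtain S where S: "S \<subseteq> D" "vec.independent S" "D \<subseteq> vec.span S" "card S = vec.dim D"
    by (rule vec.basis_exists)
  have "S \<subseteq> W" using S(1) D(2) by blast
  then obtain T where T: "S \<subseteq> T" "T \<subseteq> W" "vec.independent T" "W \<subseteq> vec.span T"
    using vec.maximal_independent_subset_extend[of S W] S(2) by blast
  have finT: "finite T" using T(3) vec.finiteI_independent by blast
  define W1 where "W1 = vec.span (T - S)"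
  have sub: "vec.subspace W1" by (simp add: W1_def)
  have W1W: "W1 \<subseteq> W" unfolding W1_def using T(2) W by (intro vec.span_minimal) auto
  have cT: "card T = vec.dim W" using T vec.basis_card_eq_dim by blast
  have d1: "vec.dim W1 = vec.dim W - vec.dim D"
  proof -
    have "vec.independent (T - S)" using T(3) by (rule vec.independent_mono) auto
    then have "vec.dim W1 = card (T - S)" unfolding W1_def by (simp add: vec.dim_eq_card_independent)
    then show ?thesis using card_Diff_subset[of S T] T(1) finT S(4) cT finite_subset by metis
  qed
  have le: "vec.dim D \<le> vec.dim W" by (rule vec.dim_subset[OF D(2)])
  have "W \<subseteq> {x + y |x y. x \<in> W1 \<and> y \<in> D}"
  proof
    fix w assume "w \<in> W"
    then have "w \<in> vec.span ((T - S) \<union> S)" using T(1,4) by (auto simp: Un_absorb2)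
    then obtain x y where "w = x + y" "x \<in> vec.span (T - S)" "y \<in> vec.span S"
      unfolding vec.span_Un by blast
    moreover have "vec.span S \<subseteq> D" using S(1) D(1) by (rule vec.span_minimal)
    ultimately show "w \<in> {x + y |x y. x \<in> W1 \<and> y \<in> D}" unfolding W1_def by blast
  qed
  then have "vec.dim W \<le> vec.dim {x + y |x y. x \<in> W1 \<and> y \<in> D}" by (rule vec.dim_subset)
  then have "vec.dim (W1 \<inter> D) = 0" using vec.dim_sums_Int[OF sub D(1)] d1 le by linarith
  then have "W1 \<inter> D \<subseteq> {0}" by (simp add: vec.dim_eq_0)
  then have "W1 \<inter> D = {0}" using sub D(1) vec.subspace_0 by blast
  then show ?thesis using that[OF sub W1W] d1 le by simp
qed

text \<open>The unit sphere of \<open>W\<close> is compact, so a limit of matrices sending some unit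
  vector of \<open>W\<close> into the closed set \<open>F\<close> does so too.\<close>

lemma open_image_avoids:
  fixes W F :: "(complex^'n::finite) set"
  assumes W: "vec.subspace W" and F: "vec.subspace F"
  shows "open {x. \<forall>u\<in>W. norm u = 1 \<longrightarrow> to_matrix x *v u \<notin> F}"
proof -
  let ?K = "W \<inter> sphere 0 1"
  have K: "compact ?K" by (rule closed_Int_compact) (use vec_subspace_closed[OF W] in auto)
  have cont: "continuous_on UNIV (\<lambda>p. to_matrix (fst p) *v (snd p :: complex^'n))"
    unfolding matrix_vector_mult_def to_matrix_def by (intro continuous_intros)
  have "closed {x. \<exists>u\<in>?K. to_matrix x *v u \<in> F}"
      unfolding closed_sequential_limits
  proof (intro allI impI)
    fix f :: "nat \<Rightarrow> complex^('n \<times> 'n)" and l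
    assume "(\<forall>n. f n \<in> {x. \<exists>u\<in>?K. to_matrix x *v u \<in> F}) \<and> f \<longlonglongrightarrow> l"
    then have fl: "f \<longlonglongrightarrow> l" and "f n \<in> {x. \<exists>u\<in>?K. to_matrix x *v u \<in> F}" for n by blast+
    then have ex: "\<forall>n. \<exists>u. u \<in> ?K \<and> to_matrix (f n) *v u \<in> F" by (simp add: Bex_def)
    obtain u where "\<forall>n. u n \<in> ?K \<and> to_matrix (f n) *v u n \<in> F" using choice[OF ex] by blast
    then have u: "\<And>n. u n \<in> ?K" "\<And>n. to_matrix (f n) *v u n \<in> F" by auto
    obtain v r where v: "v \<in> ?K" "strict_mono r" "(u \<circ> r) \<longlonglongrightarrow> v"
      using K u(1) unfolding compact_def by metis
    have lim: "((\<lambda>n. (f (r n), u (r n))) \<longlonglongrightarrow> (l, v))"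
      using tendsto_Pair[OF LIMSEQ_subseq_LIMSEQ[OF fl v(2)] v(3)] by (simp add: o_def)
    have "(\<lambda>n. to_matrix (f (r n)) *v u (r n)) \<longlonglongrightarrow> to_matrix l *v v"
      using continuous_on_tendsto_compose[OF cont lim] by simp
    then have "to_matrix l *v v \<in> F"
      by (rule closed_sequentially[OF vec_subspace_closed[OF F], rotated]) (rule u(2))
    then show "l \<in> {x. \<exists>u\<in>?K. to_matrix x *v u \<in> F}" using v(1) by blast
  qed
  then have "open (- {x. \<exists>u\<in>?K. to_matrix x *v u \<in> F})" by (rule open_Compl)
  moreover have "- {x. \<exists>u\<in>?K. to_matrix x *v u \<in> F} = {x. \<forall>u\<in>W. norm u = 1 \<longrightarrow> to_matrix x *v u \<notin> F}"
    by auto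
  ultimately show ?thesis by simp
qed

text \<open>Upper semicontinuity: split \<open>V ! i\<close> into the part \<open>D\<close> that the
  matrix sends into \<open>F\<close> and a complement \<open>W1\<close>. For nearby matrices the
  image of \<open>W1\<close> still avoids \<open>F\<close> apart from \<open>0\<close>, so the
  intersection has at most the dimension of \<open>D\<close>.\<close>

lemma openin_dim_Int_le:
  fixes F :: "(complex^'n::finite) set"
  assumes F: "vec.subspace F" and i: "i < length c"
  shows "openin (flag_topology c) {V \<in> flag_manifold c. vec.dim (V ! i \<inter> F) \<le> k}"
  unfolding openin_flag_topology
proof (intro conjI ballI)
  fix V :: "'n flag" assume V: "V \<in> flag_manifold c"
  let ?W = "V ! i"
  have W: "vec.subspace ?W" and len: "i < length V" using flag_subspace[OF V i] flag_length[OF V] i by auto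
  let ?P = "orbit_preimage V {V \<in> flag_manifold c. vec.dim (V ! i \<inter> F) \<le> k}"
  have P: "x \<in> ?P \<longleftrightarrow> invertible (to_matrix x) \<and> vec.dim ((*v) (to_matrix x) ` ?W \<inter> F) \<le> k" for x
    using V act_flag_manifold[OF _ V, of "to_matrix x"] len by (auto simp: orbit_preimage_def act_nth)
  show "open ?P"
    unfolding open_subopen[of ?P]
  proof
    fix x0 assume x0: "x0 \<in> ?P"
    let ?X = "to_matrix x0"
    have inv: "invertible ?X" using x0 P by blast
    have injX: "inj ((*v) ?X)" by (rule inj_matrix_vector_mult[OF inv])
    define D where "D = ?W \<inter> (*v) ?X -` F"
    have D: "vec.subspace D" "D \<subseteq> ?W"
      unfolding D_def using W F by (auto simp: vec.subspace_def matrix_vector_right_distrib vec.scale)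
    have imD: "(*v) ?X ` D = (*v) ?X ` ?W \<inter> F" unfolding D_def by auto
    have dD: "vec.dim D \<le> k"
      using vec_dim_inj_image[OF matrix_vector_mul_linear_gen injX, of D] x0 P unfolding imD by simp
    obtain W1 where W1: "vec.subspace W1" "W1 \<subseteq> ?W" "W1 \<inter> D = {0}" "vec.dim W1 + vec.dim D = vec.dim ?W"
      using vec_complement_exists[OF W D] by blast
    define T where "T = {x. \<forall>u\<in>W1. norm u = 1 \<longrightarrow> to_matrix x *v u \<notin> F} \<inter> {x. invertible (to_matrix x)}"
    have "open T" unfolding T_def using open_image_avoids[OF W1(1) F] open_invertible by blast
    moreover have "x0 \<in> T"
    proof -
      have "?X *v u \<notin> F" if "u \<in> W1" "norm u = 1" for u
      proof
        assume "?X *v u \<in> F"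
        then have "u \<in> W1 \<inter> D" using that W1(2) unfolding D_def by auto
        then show False using W1(3) that(2) by auto
      qed
      then show ?thesis using inv unfolding T_def by blast
    qed
    moreover have "T \<subseteq> ?P"
    proof
      fix x assume x: "x \<in> T"
      let ?Y = "to_matrix x"
      have iY: "invertible ?Y" using x unfolding T_def by blast
      have injY: "inj ((*v) ?Y)" by (rule inj_matrix_vector_mult[OF iY])
      let ?A = "(*v) ?Y ` ?W \<inter> F" and ?B = "(*v) ?Y ` W1"
      have sub: "vec.subspace ((*v) ?Y ` ?W)" "vec.subspace ?B"
        using vec.linear_subspace_image[OF matrix_vector_mul_linear_gen] W W1(1) by blast+
      have sA: "vec.subspace ?A" using sub(1) F by (rule vec.subspace_inter)
      have "?A \<inter> ?B \<subseteq> {0}"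
      proof
        fix y assume "y \<in> ?A \<inter> ?B"
        then obtain u where u: "u \<in> W1" "y = ?Y *v u" "y \<in> F" by auto
        show "y \<in> {0}"
        proof (rule ccontr)
          assume "y \<notin> {0}"
          then have "u \<noteq> 0" using u(2) by auto
          let ?r = "complex_of_real (inverse (norm u))"
          have "norm (inverse (norm u) *\<^sub>R u) = 1" using \<open>u \<noteq> 0\<close> by simp
          moreover have "inverse (norm u) *\<^sub>R u = ?r *s u" by (rule scaleR_eq_vector_scalar)
          ultimately have "norm (?r *s u) = 1" by simp
          moreover have "?r *s u \<in> W1" using W1(1) u(1) by (rule vec.subspace_scale)
          ultimately have "?Y *v (?r *s u) \<notin> F" using x unfolding T_def by blast
          moreover have "?Y *v (?r *s u) = ?r *s y" unfolding u(2) by (rule vec.scale)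
          ultimately show False using F u(3) vec.subspace_scale by metis
        qed
      qed
      then have 0: "vec.dim (?A \<inter> ?B) = 0" by (simp add: vec.dim_eq_0)
      have "{x + y |x y. x \<in> ?A \<and> y \<in> ?B} \<subseteq> (*v) ?Y ` ?W"
        using sub(1) W1(2) by (auto intro: vec.subspace_add)
      then have "vec.dim {x + y |x y. x \<in> ?A \<and> y \<in> ?B} \<le> vec.dim ((*v) ?Y ` ?W)"
        by (rule vec.dim_subset)
      then have "vec.dim ?A + vec.dim W1 \<le> vec.dim ?W"
        using vec.dim_sums_Int[OF sA sub(2)] 0
          vec_dim_inj_image[OF matrix_vector_mul_linear_gen injY] by simp
      then have "vec.dim ?A \<le> k" using W1(4) dD by simp
      then show "x \<in> ?P" using P iY by blast
    qed
    ultimately show "\<exists>T. open T \<and> x0 \<in> T \<and> T \<subseteq> ?P" by blast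
  qed
qed auto

lemma flag_closure_subset: "flag_topology c closure_of S \<subseteq> flag_manifold c"
  using closure_of_subset_topspace[of "flag_topology c" S] by (simp add: topspace_flag_topology)

lemma flag_subset_closure: "S \<subseteq> flag_manifold c \<Longrightarrow> S \<subseteq> flag_topology c closure_of S"
  by (simp add: closure_of_subset topspace_flag_topology)

lemma closure_of_meets:
  assumes "x \<in> X closure_of S" "openin X T" "x \<in> T" obtains y where "y \<in> S" "y \<in> T"
  using assms unfolding in_closure_of by blast

text \<open>By semicontinuity the entries of the rank table can only grow on the closure of the
  cell, while bounding them from above is an open condition. The cell is therefore cut out of its
  closure by finitely many open conditions.\<close>

lemma openin_borel_orbit_closure:
  fixes b q :: "'n::finite \<Rightarrow> nat"
  assumes q: "numbering q" and b: "fits c b"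
  defines "O' \<equiv> orbit (borel_group q) (coord_flag (length c) b)"
  shows "openin (subtopology (flag_topology c) (flag_topology c closure_of O')) O'"
proof -
  let ?F = "\<lambda>k. coord_space {a. q a < k}"
  let ?N = "{..CARD('n)}"
  have OZ: "O' \<subseteq> flag_manifold c"
    using flag_submanifold_cell[OF q b] unfolding O'_def flag_submanifold_def by blast
  have qn: "q a < CARD('n)" for a using q unfolding numbering_def bij_betw_def by auto
  \<comment> \<open>Beyond \<open>k = CARD('n)\<close> nothing changes, which makes the intersection
    \<open>U\<close> of open sets finite.\<close>
  have Fk: "\<exists>k'\<in>?N. ?F k = ?F k' \<and> (\<forall>i. cell_dim q b i k = cell_dim q b i k')" for k
  proof (cases "k \<le> CARD('n)")
    case False
    have "q a < k" for a using qn[of a] False by simp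
    then show ?thesis using qn by (intro bexI[of _ "CARD('n)"]) (auto simp: cell_dim_def)
  qed auto
  have Oiff: "V \<in> O' \<longleftrightarrow> (\<forall>i<length c. \<forall>k\<in>?N. vec.dim (V ! i \<inter> ?F k) = cell_dim q b i k)"
    if "V \<in> flag_manifold c" for V
    unfolding O'_def borel_orbit_iff[OF q b that] using Fk by metis
  define U where "U = (\<Inter>i<length c. \<Inter>k\<in>?N. {V \<in> flag_manifold c. vec.dim (V ! i \<inter> ?F k) \<le> cell_dim q b i k})"
  have ne: "{..<length c} \<noteq> {}" using b unfolding fits_def by auto
  have opU: "openin (flag_topology c) U"
    unfolding U_def by (intro openin_INT2 finite_lessThan finite_atMost openin_dim_Int_le coord_space_subspace ne) auto
  have ge: "cell_dim q b i k \<le> vec.dim (V ! i \<inter> ?F k)"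
    if cl: "V \<in> flag_topology c closure_of O'" and that: "i < length c" "k \<in> ?N" for V i k
  proof (rule ccontr)
    assume *: "\<not> ?thesis"
    have VZ: "V \<in> flag_manifold c"
      using cl flag_closure_subset by blast
    let ?S = "{V \<in> flag_manifold c. vec.dim (V ! i \<inter> ?F k) \<le> cell_dim q b i k - 1}"
    have "openin (flag_topology c) ?S" by (rule openin_dim_Int_le[OF coord_space_subspace that(1)])
    moreover have "V \<in> ?S" using VZ * by simp
    ultimately obtain V' where V': "V' \<in> O'" "V' \<in> ?S" by (rule closure_of_meets[OF cl])
    then have "vec.dim (V' ! i \<inter> ?F k) = cell_dim q b i k" using Oiff OZ that by blast
    then show False using V'(2) * by auto
  qed
  have "O' = U \<inter> flag_topology c closure_of O'"
  proof (intro equalityI subsetI)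
    fix V assume V: "V \<in> O'"
    then have VZ: "V \<in> flag_manifold c" using OZ by blast
    then have "V \<in> U" using V Oiff[OF VZ] ne unfolding U_def by auto
    moreover have "V \<in> flag_topology c closure_of O'"
      using V flag_subset_closure[OF OZ] by blast
    ultimately show "V \<in> U \<inter> flag_topology c closure_of O'" by blast
  next
    fix V assume V: "V \<in> U \<inter> flag_topology c closure_of O'"
    then have VZ: "V \<in> flag_manifold c" using flag_closure_subset by blast
    have "vec.dim (V ! i \<inter> ?F k) = cell_dim q b i k" if "i < length c" "k \<in> ?N" for i k
    proof (rule antisym)
      show "vec.dim (V ! i \<inter> ?F k) \<le> cell_dim q b i k" using V that unfolding U_def by blast
      show "cell_dim q b i k \<le> vec.dim (V ! i \<inter> ?F k)" using V that ge by blast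
    qed
    then show "V \<in> O'" using Oiff[OF VZ] by blast
  qed
  then show ?thesis using opU unfolding openin_subtopology by blast
qed

lemma cdim_closure_borel_orbit:
  fixes b q :: "'n::finite \<Rightarrow> nat"
  assumes q: "numbering q" and b: "fits c b"
  shows "cdim c (flag_topology c closure_of orbit (borel_group q) (coord_flag (length c) b)) = inversions q b"
proof (rule cdim_eqI[OF _ flag_submanifold_cell[OF q b] openin_borel_orbit_closure[OF q b]])
  show "orbit (borel_group q) (coord_flag (length c) b) \<noteq> {}"
    using orbit_refl[OF matrix_group_borel] by blast
qed auto

text \<open>A cell is open and dense in its closure, so closures that agree come from cells that meet.\<close>

lemma closure_borel_orbit_inj:
  fixes b b' q :: "'n::finite \<Rightarrow> nat"
  assumes q: "numbering q" and b: "fits c b" and b': "fits c b'"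
    and eq: "flag_topology c closure_of orbit (borel_group q) (coord_flag (length c) b) =
      flag_topology c closure_of orbit (borel_group q) (coord_flag (length c) b')"
  shows "b = b'"
proof -
  let ?O = "\<lambda>b. orbit (borel_group q) (coord_flag (length c) b)"
  obtain U where U: "openin (flag_topology c) U" "?O b = U \<inter> flag_topology c closure_of ?O b"
    using openin_borel_orbit_closure[OF q b] unfolding openin_subtopology by blast
  have "coord_flag (length c) b \<in> ?O b" by (rule orbit_refl[OF matrix_group_borel])
  then have "coord_flag (length c) b \<in> U" "coord_flag (length c) b \<in> flag_topology c closure_of ?O b'"
    using U(2) eq by blast+
  then obtain V where V: "V \<in> ?O b'" "V \<in> U" using U(1) unfolding in_closure_of by blast
  have sub: "?O b' \<subseteq> flag_manifold c"
    using flag_submanifold_cell[OF q b'] unfolding flag_submanifold_def by blast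
  then have VZ: "V \<in> flag_manifold c" using V(1) by blast
  have "V \<in> flag_topology c closure_of ?O b'"
    using V(1) flag_subset_closure[OF sub] by blast
  then have "V \<in> ?O b" using V(2) U(2) eq by blast
  then have dims: "cell_dim q b i k = cell_dim q b' i k" if "i < length c" for i k
    using V(1) borel_orbit_iff[OF q b VZ] borel_orbit_iff[OF q b' VZ] that by metis
  have inj: "inj q" using q unfolding numbering_def bij_betw_def by simp
  \<comment> \<open>The table jumps at \<open>q a\<close> in row \<open>i\<close> exactly when
    \<open>b a \<le> i\<close>, so it determines \<open>b\<close>.\<close>
  have step: "cell_dim q b i (Suc (q a)) = cell_dim q b i (q a) + (if b a \<le> i then 1 else 0)"
    for b :: "'n \<Rightarrow> nat" and i a
  proof (cases "b a \<le> i")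
    case True
    have "{x. b x \<le> i \<and> q x < Suc (q a)} = insert a {x. b x \<le> i \<and> q x < q a}"
      using True inj by (auto simp: less_Suc_eq dest: injD)
    then show ?thesis using True by (simp add: cell_dim_def)
  next
    case False
    have "{x. b x \<le> i \<and> q x < Suc (q a)} = {x. b x \<le> i \<and> q x < q a}"
      using False inj by (auto simp: less_Suc_eq dest: injD)
    then show ?thesis using False by (simp add: cell_dim_def)
  qed
  have iff: "b a \<le> i \<longleftrightarrow> b' a \<le> i" if "i < length c" for a i
    using step[of b i a] step[of b' i a] dims[OF that] by (simp split: if_splits)
  show ?thesis
  proof
    fix a
    have "b a < length c" "b' a < length c" using b b' unfolding fits_def by auto
    then show "b a = b' a" using iff[of "b a" a] iff[of "b' a" a] by simp
  qed
qed

section \<open>The quaternionic structure\<close>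

definition swap :: "'m + 'm \<Rightarrow> 'm + 'm" where
  "swap a = (case a of Inl i \<Rightarrow> Inr i | Inr i \<Rightarrow> Inl i)"

text \<open>The signs of \<open>J_mat\<close>: the coordinate \<open>a\<close> of
  \<open>jmap v\<close> is \<open>tau a\<close> times the conjugate of the coordinate
  \<open>swap a\<close> of \<open>v\<close>. This uniform description avoids splitting into
  \<open>Inl\<close> and \<open>Inr\<close>.\<close>

definition tau :: "'m + 'm \<Rightarrow> complex" where
  "tau a = (case a of Inl i \<Rightarrow> 1 | Inr i \<Rightarrow> -1)"

lemma swap_swap [simp]: "swap (swap a) = a"
  by (simp add: swap_def split: sum.split)

lemma swap_neq [simp]: "swap a \<noteq> a" "a \<noteq> swap a"
  by (auto simp: swap_def split: sum.splits)

lemma swap_eq_iff: "swap a = b \<longleftrightarrow> a = swap b"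
  by auto

lemma bij_swap: "bij swap"
  by (rule bij_betwI[of _ _ _ swap]) auto

lemma tau_swap [simp]: "tau (swap a) = - tau a"
  by (simp add: swap_def tau_def split: sum.split)

lemma tau_square [simp]: "tau a * tau a = 1" "tau a * (tau a * z) = z"
  by (simp_all add: tau_def split: sum.split)

lemma cnj_tau [simp]: "cnj (tau a) = tau a"
  by (simp add: tau_def split: sum.split)

lemma tau_nonzero [simp]: "tau a \<noteq> 0"
  by (simp add: tau_def split: sum.split)

lemma sum_UNIV_swap: "(\<Sum>a\<in>UNIV. f (swap a)) = (\<Sum>a\<in>UNIV. f (a :: 'm::finite + 'm))"
  using sum.reindex_bij_betw[OF bij_swap, of f] by simp

lemma sum_UNIV_Plus: "(\<Sum>a\<in>UNIV. f a) = (\<Sum>i\<in>UNIV. f (Inl i)) + (\<Sum>i\<in>UNIV. f (Inr i :: 'm::finite + 'm))"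
proof -
  have "(UNIV :: ('m + 'm) set) = UNIV <+> UNIV" by simp
  then show ?thesis using sum.Plus[of "UNIV :: 'm set" "UNIV :: 'm set" f] by (simp add: o_def)
qed

lemma jmap_nth: "jmap v $ a = tau a * cnj (v $ swap a)"
proof (cases a)
  case (Inl i)
  then show ?thesis
    by (simp add: jmap_def J_mat_def matrix_vector_mult_def sum_UNIV_Plus tau_def swap_def if_distrib
        sum.delta cong: if_cong) (simp add: if_distribR sum.delta cong: if_cong)
next
  case (Inr i)
  then show ?thesis
    by (simp add: jmap_def J_mat_def matrix_vector_mult_def sum_UNIV_Plus tau_def swap_def if_distrib
        sum.delta cong: if_cong) (simp add: if_distribR sum.delta cong: if_cong)
qed

lemma jmap_add: "jmap (v + w) = jmap v + jmap w"
  by (simp add: vec_eq_iff jmap_nth algebra_simps)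

lemma jmap_scale: "jmap (c *s v) = cnj c *s jmap v"
  by (simp add: vec_eq_iff jmap_nth algebra_simps)

lemma jmap_jmap [simp]: "jmap (jmap v) = - v"
  by (simp add: vec_eq_iff jmap_nth)

lemma jmap_0 [simp]: "jmap 0 = 0"
  by (simp add: vec_eq_iff jmap_nth)

lemma jmap_uminus [simp]: "jmap (- v) = - jmap v"
  by (simp add: vec_eq_iff jmap_nth)

lemma jmap_eq_0_iff [simp]: "jmap v = 0 \<longleftrightarrow> v = 0"
  by (metis jmap_0 jmap_jmap neg_equal_0_iff_equal)

lemma jmap_axis: "jmap (axis a 1) = - tau a *s axis (swap a) 1"
  by (auto simp: vec_eq_iff jmap_nth axis_def)

lemma linear_jmap: "linear jmap"
  by (rule linearI) (auto simp: jmap_add vec_eq_iff jmap_nth)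

lemma bounded_linear_jmap: "bounded_linear jmap"
  using linear_jmap by (simp add: linear_conv_bounded_linear)

definition herm :: "complex^'n::finite \<Rightarrow> complex^'n \<Rightarrow> complex" where
  "herm v w = (\<Sum>a\<in>UNIV. v $ a * cnj (w $ a))"

lemma herm_add: "herm (v + v') w = herm v w + herm v' w" "herm v (w + w') = herm v w + herm v w'"
  by (simp_all add: herm_def algebra_simps sum.distrib)

lemma herm_diff: "herm (v - v') w = herm v w - herm v' w" "herm v (w - w') = herm v w - herm v w'"
  by (simp_all add: herm_def algebra_simps sum_subtractf)

lemma herm_scale: "herm (c *s v) w = c * herm v w" "herm v (c *s w) = cnj c * herm v w"
  by (simp_all add: herm_def algebra_simps sum_distrib_left)

lemma herm_minus: "herm (- v) w = - herm v w" "herm v (- w) = - herm v w"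
  by (simp_all add: herm_def sum_negf)

lemma herm_0 [simp]: "herm 0 w = 0" "herm v 0 = 0"
  by (simp_all add: herm_def)

lemma herm_sum: "herm (\<Sum>x\<in>S. f x) w = (\<Sum>x\<in>S. herm (f x) w)"
  by (induction S rule: infinite_finite_induct) (simp_all add: herm_add)

lemma cnj_herm: "cnj (herm v w) = herm w v"
  by (simp add: herm_def mult.commute)

lemma herm_axis: "herm v (axis a 1) = v $ a" "herm (axis a 1) v = cnj (v $ a)"
  by (simp_all add: herm_def axis_def if_distrib if_distribR sum.delta cong: if_cong)

lemma Re_herm: "Re (herm v w) = inner v w"
  by (simp add: herm_def inner_vec_def inner_complex_def)

lemma herm_self: "herm v v = complex_of_real ((norm v)\<^sup>2)"
proof -
  have "Im (herm v v) = 0" using cnj_herm[of v v] by (simp add: complex_eq_iff)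
  then show ?thesis by (simp add: complex_eq_iff Re_herm power2_norm_eq_inner)
qed

lemma herm_self_eq_0_iff [simp]: "herm v v = 0 \<longleftrightarrow> v = 0"
  by (simp add: herm_self)

text \<open>The two conjugations cancel, so \<open>herm v (jmap w)\<close> is complex bilinear: it
  is the symplectic form with matrix \<open>J_mat\<close>. This is the form behind all isotropy
  conditions below.\<close>

lemma herm_jmap_swap: "herm v (jmap w) = - herm w (jmap v)"
proof -
  have "herm v (jmap w) = (\<Sum>a\<in>UNIV. v $ swap a * cnj (jmap w $ swap a))"
    unfolding herm_def by (rule sum_UNIV_swap[symmetric])
  also have "\<dots> = - herm w (jmap v)"
    unfolding herm_def sum_negf[symmetric] by (intro sum.cong) (simp_all add: jmap_nth)
  finally show ?thesis .
qed

lemma herm_jmap_self [simp]: "herm v (jmap v) = 0" "herm (jmap v) v = 0"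
proof -
  show "herm v (jmap v) = 0" using herm_jmap_swap[of v v] by (simp add: eq_neg_iff_add_eq_0)
  then show "herm (jmap v) v = 0" using cnj_herm[of v "jmap v"] by simp
qed

lemma herm_jmap_jmap: "herm (jmap v) (jmap w) = herm w v"
  using herm_jmap_swap[of "jmap v" w] by (simp add: herm_minus)

lemma herm_jmap_left: "herm (jmap v) w = - cnj (herm v (jmap w))"
  using herm_jmap_swap[of w v] cnj_herm[of w "jmap v"] by simp

lemma norm_jmap [simp]: "norm (jmap v) = norm v"
proof -
  have "(norm (jmap v))\<^sup>2 = (norm v)\<^sup>2"
    using herm_jmap_jmap[of v v] unfolding herm_self by (simp only: of_real_eq_iff)
  then show ?thesis by simp
qed

lemma bounded_bilinear_herm: "bounded_bilinear (herm :: complex^'n::finite \<Rightarrow> complex^'n \<Rightarrow> complex)"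
proof -
  have "linear (herm v)" "linear (\<lambda>v. herm v w)" for v w :: "complex^'n"
    by (auto intro!: linearI simp: herm_add scaleR_eq_vector_scalar herm_scale scaleR_conv_of_real)
  then show ?thesis by (simp add: bilinear_conv_bounded_bilinear[symmetric] bilinear_def)
qed

section \<open>The compact group\<close>

definition quaternionic :: "complex^('m::finite + 'm)^('m + 'm) \<Rightarrow> bool" where
  "quaternionic X \<longleftrightarrow> (\<forall>v. jmap (X *v v) = X *v jmap v)"

definition adjoint_mat :: "complex^'n^'n \<Rightarrow> complex^'n^'n::finite" where
  "adjoint_mat X = (\<chi> a b. cnj (X $ b $ a))"

lemma K0_iff: "X \<in> K0 \<longleftrightarrow> adjoint_mat X ** X = mat 1 \<and> det X = 1 \<and> quaternionic X"
  by (auto simp: K0_def SU_def G0_def SL_def adjoint_mat_def quaternionic_def)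

lemma herm_adjoint: "herm (X *v v) w = herm v (adjoint_mat X *v w)"
proof -
  have "herm (X *v v) w = (\<Sum>a\<in>UNIV. \<Sum>b\<in>UNIV. X $ a $ b * v $ b * cnj (w $ a))"
    by (simp add: herm_def matrix_vector_mult_def sum_distrib_right)
  also have "\<dots> = (\<Sum>b\<in>UNIV. \<Sum>a\<in>UNIV. X $ a $ b * v $ b * cnj (w $ a))" by (rule sum.swap)
  also have "\<dots> = herm v (adjoint_mat X *v w)"
    by (simp add: herm_def matrix_vector_mult_def adjoint_mat_def sum_distrib_left mult_ac)
  finally show ?thesis .
qed

lemma unitary_herm:
  assumes "adjoint_mat X ** X = mat 1" shows "herm (X *v v) (X *v w) = herm v w"
  unfolding herm_adjoint by (simp add: matrix_vector_mul_assoc assms)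

lemma unitaryI:
  assumes "\<And>v w. herm (X *v v) (X *v w) = herm v w"
  shows "adjoint_mat X ** X = mat 1"
proof -
  have "cnj ((adjoint_mat X *v (X *v w)) $ a) = cnj (w $ a)" for w a
    using assms[of "axis a 1" w] unfolding herm_adjoint herm_axis .
  then show ?thesis by (simp add: matrix_eq vec_eq_iff matrix_vector_mul_assoc[symmetric])
qed

lemma det_cnj: "det (\<chi> a b. cnj (X $ a $ b)) = cnj (det (X :: complex^'n^'n::finite))"
  by (simp add: det_def)

lemma det_adjoint: "det (adjoint_mat X) = cnj (det X)"
proof -
  have "adjoint_mat X = transpose (\<chi> a b. cnj (X $ a $ b))"
    by (simp add: adjoint_mat_def transpose_def)
  then show ?thesis by (simp only: det_transpose det_cnj)
qed

text \<open>Commuting with \<open>jmap\<close> means that \<open>J_mat\<close> conjugates the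
  entrywise conjugate of \<open>X\<close> into \<open>X\<close>, so both have the same
  determinant.\<close>

lemma det_quaternionic:
  fixes X :: "complex^('m::finite + 'm)^('m + 'm)"
  assumes "quaternionic X" shows "cnj (det X) = det X"
proof -
  define c where "c Y = (\<chi> a b. cnj (Y $ a $ b))" for Y :: "complex^('m + 'm)^('m + 'm)"
  have cv: "(\<chi> a. cnj ((Y *v v) $ a)) = c Y *v (\<chi> a. cnj (v $ a))" for Y v
    by (simp add: c_def matrix_vector_mult_def vec_eq_iff)
  have comm: "J_mat ** c X = X ** J_mat"
    unfolding matrix_eq
  proof
    fix v :: "complex^('m + 'm)"
    define u :: "complex^('m + 'm)" where "u = (\<chi> a. cnj (v $ a))"
    have v: "v = (\<chi> a. cnj (u $ a))" by (simp add: u_def vec_eq_iff)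
    have "(J_mat ** c X) *v v = jmap (X *v u)"
      unfolding jmap_def cv v by (simp add: matrix_vector_mul_assoc)
    also have "\<dots> = (X ** J_mat) *v v"
      using assms unfolding quaternionic_def jmap_def v by (simp add: matrix_vector_mul_assoc)
    finally show "(J_mat ** c X) *v v = (X ** J_mat) *v v" .
  qed
  have "det (J_mat :: complex^('m + 'm)^('m + 'm)) * det (c X) = det (J_mat ** c X)"
    by (rule det_mul[symmetric])
  also have "\<dots> = det X * det (J_mat :: complex^('m + 'm)^('m + 'm))"
    unfolding comm by (rule det_mul)
  finally have "det (J_mat :: complex^('m + 'm)^('m + 'm)) * det (c X) = det X * det (J_mat :: complex^('m + 'm)^('m + 'm))" .
  moreover have "invertible (J_mat :: complex^('m + 'm)^('m + 'm))"
    unfolding invertible_iff_ker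
  proof (intro allI impI)
    fix v :: "complex^('m + 'm)" assume "J_mat *v v = 0"
    then have "jmap (\<chi> a. cnj (v $ a)) = 0" by (simp add: jmap_def)
    then have "(\<chi> a. cnj (v $ a)) = 0" by (simp only: jmap_eq_0_iff)
    then show "v = 0" by (simp add: vec_eq_iff)
  qed
  ultimately have "det (c X) = det X" by (simp add: invertible_det_nz)
  then show ?thesis unfolding c_def det_cnj .
qed

lemma quaternionic_mult: "quaternionic X \<Longrightarrow> quaternionic Y \<Longrightarrow> quaternionic (X ** Y)"
  by (simp add: quaternionic_def matrix_vector_mul_assoc[symmetric])

lemma unitary_mult: "adjoint_mat X ** X = mat 1 \<Longrightarrow> adjoint_mat Y ** Y = mat 1 \<Longrightarrow> adjoint_mat (X ** Y) ** (X ** Y) = mat 1"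
  by (rule unitaryI) (simp add: matrix_vector_mul_assoc[symmetric] unitary_herm)

lemma quaternionic_left_inverse:
  assumes "quaternionic X" "Y ** X = mat 1" "X ** Y = mat 1" shows "quaternionic Y"
  unfolding quaternionic_def
proof
  fix v
  have "jmap (Y *v v) = Y *v (X *v jmap (Y *v v))" by (simp add: matrix_vector_mul_assoc assms)
  also have "X *v jmap (Y *v v) = jmap (X *v (Y *v v))" using assms(1) unfolding quaternionic_def by simp
  also have "\<dots> = jmap v" by (simp add: matrix_vector_mul_assoc assms)
  finally show "jmap (Y *v v) = Y *v jmap v" .
qed

lemma matrix_group_K0: "matrix_group K0"
  unfolding matrix_group_def
proof (intro conjI ballI)
  show "(mat 1 :: complex^('a + 'a)^('a + 'a)) \<in> K0"
  proof -
    have "adjoint_mat (mat 1) = (mat 1 :: complex^('a + 'a)^('a + 'a))"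
      by (simp add: adjoint_mat_def mat_def vec_eq_iff)
    then show ?thesis unfolding K0_iff by (simp add: quaternionic_def)
  qed
  show "A ** B \<in> K0" if "A \<in> K0" "B \<in> K0" for A B :: "complex^('a + 'a)^('a + 'a)"
    using that unfolding K0_iff by (simp add: unitary_mult quaternionic_mult det_mul)
  fix A :: "complex^('a + 'a)^('a + 'a)" assume A: "A \<in> K0"
  let ?B = "adjoint_mat A"
  have B: "?B ** A = mat 1" using A K0_iff by blast
  then have B': "A ** ?B = mat 1" by (simp add: matrix_left_right_inverse)
  have "herm (?B *v v) (?B *v w) = herm v w" for v w
    using unitary_herm[OF B, of "?B *v v" "?B *v w"] B' by (simp add: matrix_vector_mul_assoc)
  then have "adjoint_mat ?B ** ?B = mat 1" by (rule unitaryI)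
  moreover have "quaternionic ?B" using quaternionic_left_inverse[OF _ B B'] A K0_iff by blast
  moreover have "det ?B = 1" using A unfolding K0_iff det_adjoint by simp
  ultimately show "\<exists>B\<in>K0. A ** B = mat 1 \<and> B ** A = mat 1" using B B' K0_iff by blast
qed

section \<open>One-parameter subgroups of the compact group\<close>

definition outer :: "complex^'n \<Rightarrow> complex^'n \<Rightarrow> complex^'n^'n::finite" where
  "outer u w = (\<chi> a b. u $ a * cnj (w $ b))"

lemma outer_mult: "outer u w *v x = herm x w *s u"
  by (simp add: outer_def matrix_vector_mult_def herm_def vec_eq_iff sum_distrib_left mult_ac)

text \<open>For a unit vector \<open>v\<close> this multiplies \<open>v\<close> by
  \<open>cis t\<close> and \<open>jmap v\<close> by \<open>cis (-t)\<close> and fixes their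
  orthogonal complement. The opposite angles are what commuting with \<open>jmap\<close>
  demands.\<close>

definition rotation :: "complex^('m::finite + 'm) \<Rightarrow> real \<Rightarrow> complex^('m + 'm)^('m + 'm)" where
  "rotation v t = (\<chi> a b. mat 1 $ a $ b + (cis t - 1) * outer v v $ a $ b + (cis (-t) - 1) * outer (jmap v) (jmap v) $ a $ b)"

lemma rotation_mult:
  "rotation v t *v x = x + ((cis t - 1) * herm x v) *s v + ((cis (-t) - 1) * herm x (jmap v)) *s jmap v"
proof -
  have "(rotation v t *v x) $ a = (mat 1 *v x) $ a + (cis t - 1) * (outer v v *v x) $ a
      + (cis (-t) - 1) * (outer (jmap v) (jmap v) *v x) $ a" for a
    by (simp add: rotation_def matrix_vector_mult_def algebra_simps sum.distrib sum_distrib_left sum_subtractf)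
  then show ?thesis by (simp add: vec_eq_iff outer_mult mult.assoc)
qed

lemma rotation_add:
  assumes "norm v = 1" shows "rotation v s ** rotation v t = rotation v (s + t)"
proof -
  have h: "herm v v = 1" "herm (jmap v) (jmap v) = 1" using assms by (simp_all add: herm_self)
  have c: "cis (s + t) = cis s * cis t" "cis (- s - t) = cis (-s) * cis (-t)"
    by (simp_all add: cis_mult)
  show ?thesis
    unfolding matrix_eq
  proof
    fix x
    show "(rotation v s ** rotation v t) *v x = rotation v (s + t) *v x"
      unfolding matrix_vector_mul_assoc[symmetric] rotation_mult
      by (simp add: herm_add herm_scale h c vec_eq_iff) (simp add: algebra_simps)
  qed
qed

lemma rotation_0 [simp]: "rotation v 0 = mat 1"
  by (simp add: rotation_def vec_eq_iff)

lemma quaternionic_rotation: "quaternionic (rotation v t)"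
  unfolding quaternionic_def
  by (simp add: rotation_mult jmap_add jmap_scale cis_cnj herm_jmap_jmap cnj_herm herm_jmap_left[of _ v])

lemma unitary_rotation:
  assumes "norm v = 1" shows "adjoint_mat (rotation v t) ** rotation v t = mat 1"
proof -
  have "adjoint_mat (rotation v t) = rotation v (- t)"
    by (simp add: adjoint_mat_def rotation_def vec_eq_iff outer_def mat_def cis_cnj mult_ac)
  then show ?thesis using rotation_add[OF assms, of "-t" t] by simp
qed

text \<open>The determinant has modulus 1 because \<open>X\<close> is unitary and is real because
  \<open>X\<close> is quaternionic.\<close>

lemma det_unitary_quaternionic:
  assumes "adjoint_mat X ** X = mat 1" "quaternionic X" shows "det X * det X = 1"
  using arg_cong[OF assms(1), of det] det_quaternionic[OF assms(2)] by (simp add: det_mul det_adjoint)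

text \<open>The determinant is 1 and not \<open>-1\<close>: a rotation is the square of a matrix with real
  determinant.\<close>

lemma rotation_in_K0:
  assumes "norm v = 1" shows "rotation v t \<in> K0"
proof -
  have "rotation v t = rotation v (t/2) ** rotation v (t/2)" by (simp add: rotation_add[OF assms])
  then have "det (rotation v t) = det (rotation v (t/2)) * det (rotation v (t/2))" by (simp add: det_mul)
  also have "\<dots> = 1" by (rule det_unitary_quaternionic[OF unitary_rotation[OF assms] quaternionic_rotation])
  finally show ?thesis unfolding K0_iff using unitary_rotation[OF assms] quaternionic_rotation by blast
qed

text \<open>If \<open>-1\<close> is not an eigenvalue of \<open>X\<close>, the determinant of \<open>X + 1\<close> is real and nonzero, and
  \<open>X + 1 = X (X + 1)\<^sup>*\<close>. Otherwise half-turns remove the eigenvalue \<open>-1\<close>.\<close>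

lemma unitary_quaternionic_in_K0:
  fixes X :: "complex^('m::finite + 'm)^('m + 'm)"
  assumes "adjoint_mat X ** X = mat 1" "quaternionic X"
  shows "X \<in> K0"
proof -
  have "det X = 1" using assms
  proof (induction "vec.dim {x. X *v x = - x}" arbitrary: X rule: less_induct)
    case less
    note uni = less.prems(1) and quat = less.prems(2)
    show ?case
    proof (cases "\<exists>x. x \<noteq> 0 \<and> X *v x = - x")
      case False
      define Y where "Y = X + mat 1"
      have Yx: "Y *v x = X *v x + x" for x by (simp add: Y_def matrix_vector_mult_add_rdistrib)
      have "Y *v x = 0 \<longrightarrow> x = 0" for x using False by (auto simp: Yx eq_neg_iff_add_eq_0)
      then have nz: "det Y \<noteq> 0" unfolding invertible_det_nz[symmetric] invertible_iff_ker by blast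
      have "quaternionic Y" using quat by (simp add: quaternionic_def Yx jmap_add)
      then have real: "cnj (det Y) = det Y" by (rule det_quaternionic)
      have XX: "X ** adjoint_mat X = mat 1" using uni by (simp add: matrix_left_right_inverse)
      have "adjoint_mat Y = adjoint_mat X + mat 1" by (auto simp: Y_def adjoint_mat_def vec_eq_iff mat_def)
      then have "Y = X ** adjoint_mat Y" by (simp add: matrix_add_ldistrib XX Y_def add.commute)
      then have "det Y = det (X ** adjoint_mat Y)" by (rule arg_cong)
      then have "det Y = det X * det Y" by (simp only: det_mul det_adjoint real)
      then show ?thesis using nz by simp
    next
      case True
      then obtain u where u: "u \<noteq> 0" "X *v u = - u" by blast
      define v where "v = complex_of_real (inverse (norm u)) *s u"
      have nv: "norm v = 1" using u(1) unfolding v_def scaleR_eq_vector_scalar[symmetric] by simp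
      have Xv: "X *v v = - v" unfolding v_def by (simp add: vec.scale u(2))
      have Xj: "X *v jmap v = - jmap v" using quat Xv unfolding quaternionic_def by (metis jmap_uminus)
      let ?R = "rotation v pi"
      have R: "?R *v x = x - (2 * herm x v) *s v - (2 * herm x (jmap v)) *s jmap v" for x
      proof -
        have "cis pi = -1" "cis (- pi) = -1" by (simp_all add: complex_eq_iff)
        then show ?thesis by (simp add: rotation_mult vec_eq_iff algebra_simps)
      qed
      have hv: "herm v v = 1" "herm (jmap v) (jmap v) = 1" using nv by (simp_all add: herm_self)
      have Rv: "?R *v v = - v" "?R *v jmap v = - jmap v" by (simp_all add: R hv vec_eq_iff)
      let ?X = "X ** ?R"
      have uni': "adjoint_mat ?X ** ?X = mat 1" by (rule unitary_mult[OF uni unitary_rotation[OF nv]])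
      have quat': "quaternionic ?X" by (rule quaternionic_mult[OF quat quaternionic_rotation])
      have fixed: "?X *v v = v" "?X *v jmap v = jmap v"
        by (simp_all add: matrix_vector_mul_assoc[symmetric] Rv Xv Xj vec.neg)
      \<comment> \<open>\<open>v\<close> and \<open>jmap v\<close> are now fixed by the unitary
        matrix \<open>?X\<close>, hence orthogonal to its eigenvectors for \<open>-1\<close>; on
        this complement \<open>?X\<close> and \<open>X\<close> agree. So the eigenspace for
        \<open>-1\<close> shrinks, losing at least \<open>v\<close>.\<close>
      have orth: "herm x v = 0 \<and> herm x (jmap v) = 0 \<and> X *v x = - x" if "?X *v x = - x" for x
      proof -
        have 1: "herm x v = 0" using unitary_herm[OF uni', of x v] that fixed by (simp add: herm_minus)
        have 2: "herm x (jmap v) = 0" using unitary_herm[OF uni', of x "jmap v"] that fixed by (simp add: herm_minus)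
        have "?R *v x = x" by (simp add: R 1 2)
        then show ?thesis using that 1 2 by (simp add: matrix_vector_mul_assoc[symmetric])
      qed
      have sub: "vec.subspace {x. Y *v x = - x}" for Y :: "complex^('m + 'm)^('m + 'm)"
        by (auto simp: vec.subspace_def matrix_vector_right_distrib vec.scale)
      have "{x. ?X *v x = - x} \<subset> {x. X *v x = - x}"
      proof
        show "{x. ?X *v x = - x} \<subseteq> {x. X *v x = - x}" using orth by blast
        have "v \<notin> {x. ?X *v x = - x}" using orth[of v] hv by auto
        then show "{x. ?X *v x = - x} \<noteq> {x. X *v x = - x}" using Xv by blast
      qed
      then have "vec.dim {x. ?X *v x = - x} < vec.dim {x. X *v x = - x}"
        by (intro vec.dim_psubset) (simp add: vec.span_eq_iff[THEN iffD2, OF sub])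
      then have "det ?X = 1" using less.hyps uni' quat' by blast
      moreover have "det ?R = 1" using rotation_in_K0[OF nv] K0_iff by blast
      ultimately show ?thesis by (simp add: det_mul)
    qed
  qed
  then show ?thesis using assms K0_iff by blast
qed

section \<open>Base cycles are isotropic\<close>

lemma bounded_linear_to_matrix_mult: "bounded_linear (\<lambda>x. to_matrix x *v (u :: complex^'n::finite))"
proof -
  have "linear (\<lambda>x. to_matrix x *v u)"
    by (rule linearI) (simp_all add: matrix_vector_mult_def vec_eq_iff algebra_simps sum.distrib scaleR_right.sum)
  then show ?thesis by (simp add: linear_conv_bounded_linear)
qed

lemma tangent_spaceI:
  assumes "\<gamma> 0 = a" "(\<gamma> has_vector_derivative v) (at 0)" "\<forall>\<^sub>F t in at (0::real). \<gamma> t \<in> A"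
  shows "v \<in> tangent_space A a"
  unfolding tangent_space_def using assms by (intro CollectI exI[of _ \<gamma>] conjI)

text \<open>The velocity of \<open>rotation v\<close> at time 0, multiplied by
  \<open>-\<i>\<close>.\<close>

definition hgen :: "complex^('m::finite + 'm) \<Rightarrow> complex^(('m + 'm) \<times> ('m + 'm))" where
  "hgen v = of_matrix (outer v v - outer (jmap v) (jmap v))"

text \<open>The rotations around \<open>v\<close> give the tangent vector
  \<open>\<i> *s hgen v\<close>; the factor \<open>\<i>\<close> can be removed because the tangent
  space is a complex subspace. A merely real tangent space would not allow this.\<close>

lemma hgen_in_tangent_space:
  fixes V :: "('m::finite + 'm) flag"
  assumes sub: "vec.subspace (tangent_space (orbit_preimage V (orbit K0 V)) one_mat)" and v: "norm v = 1"
  shows "hgen v \<in> tangent_space (orbit_preimage V (orbit K0 V)) one_mat"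
proof -
  let ?A = "orbit_preimage V (orbit K0 V)"
  define \<gamma> where "\<gamma> t = one_mat + (cis t - 1) *s of_matrix (outer v v) + (cis (-t) - 1) *s of_matrix (outer (jmap v) (jmap v))" for t
  have "to_matrix (\<gamma> t) = rotation v t" for t
    by (simp add: \<gamma>_def rotation_def vec_eq_iff one_mat_def algebra_simps)
  then have mem: "\<gamma> t \<in> ?A" for t
    using rotation_in_K0[OF v] matrix_group_invertible[OF matrix_group_K0]
    by (auto simp: orbit_preimage_def orbit_def)
  have bl: "bounded_linear (\<lambda>c. c *s (x :: complex^'k))" for x
  proof -
    have "linear (\<lambda>c. c *s x)" by (rule linearI) (simp_all add: vec_eq_iff algebra_simps)
    then show ?thesis by (simp add: linear_conv_bounded_linear)
  qed
  have c1: "((\<lambda>t. cis t - 1) has_vector_derivative \<i>) (at 0)"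
    by (auto intro!: derivative_eq_intros simp: has_vector_derivative_complex_iff)
  have c2: "((\<lambda>t. cis (-t) - 1) has_vector_derivative -\<i>) (at 0)"
    by (auto intro!: derivative_eq_intros simp: has_vector_derivative_complex_iff)
  have "(\<gamma> has_vector_derivative (0 + \<i> *s of_matrix (outer v v) + (-\<i>) *s of_matrix (outer (jmap v) (jmap v)))) (at 0)"
    unfolding \<gamma>_def[abs_def]
    by (intro has_vector_derivative_add has_vector_derivative_const
        bounded_linear.has_vector_derivative[OF bl c1] bounded_linear.has_vector_derivative[OF bl c2])
  moreover have "0 + \<i> *s of_matrix (outer v v) + (-\<i>) *s of_matrix (outer (jmap v) (jmap v)) = \<i> *s hgen v"
    by (simp add: hgen_def vec_eq_iff of_matrix_def algebra_simps)
  moreover have "\<gamma> 0 = one_mat" by (simp add: \<gamma>_def)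
  ultimately have "\<i> *s hgen v \<in> tangent_space ?A one_mat"
    using mem by (intro tangent_spaceI[of \<gamma>]) auto
  then have "(-\<i>) *s (\<i> *s hgen v) \<in> tangent_space ?A one_mat" by (rule vec.subspace_scale[OF sub])
  then show ?thesis by simp
qed

lemma tangent_space_K0_orbit_subspace:
  fixes V :: "('m::finite + 'm) flag"
  assumes "flag_submanifold c d (orbit K0 V)"
  shows "vec.subspace (tangent_space (orbit_preimage V (orbit K0 V)) one_mat)"
proof -
  have V: "V \<in> orbit K0 V" by (rule orbit_refl[OF matrix_group_K0])
  then have "V \<in> flag_manifold c" using assms unfolding flag_submanifold_def by blast
  then obtain p where "complex_submanifold (d + p) (orbit_preimage V (orbit K0 V))"
    using assms unfolding flag_submanifold_def by blast
  then have "submanifold_at (d + p) (orbit_preimage V (orbit K0 V)) one_mat"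
    using V unfolding complex_submanifold_iff by simp
  then show ?thesis by (rule tangent_space_submanifold(1)) (simp add: V)
qed

text \<open>The largest value \<open>c0\<close> of \<open>\<bar>herm u (jmap w)\<bar>\<close> over unit vectors is an invariant of the
  \<open>K0\<close>-orbit. The orbit being complex, its tangent space contains the hermitian direction
  \<open>hgen u\<close>, and stationarity in this direction leaves only the values 0 and 1; the value 1 means
  that the two subspaces meet.\<close>

lemma base_cycle_orthogonal:
  fixes V :: "('m::finite + 'm) flag"
  assumes sub: "flag_submanifold c d (orbit K0 V)" and i: "i < length c" and k: "k < length c"
    and disj: "V ! i \<inter> jmap ` (V ! k) = {0}"
    and x: "x \<in> V ! i" and y: "y \<in> V ! k"
  shows "herm x (jmap y) = 0"
proof (rule ccontr)
  assume nz: "herm x (jmap y) \<noteq> 0"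
  have V: "V \<in> flag_manifold c"
    using sub orbit_refl[OF matrix_group_K0] unfolding flag_submanifold_def by blast
  have len: "i < length V" "k < length V" using flag_length[OF V] i k by auto
  have subi: "vec.subspace (V ! i)" and subk: "vec.subspace (V ! k)" using flag_subspace[OF V] i k by auto
  let ?S = "\<lambda>i. V ! i \<inter> sphere 0 1"
  have comp: "compact (?S i)" if "i < length c" for i
    by (rule closed_Int_compact) (use vec_subspace_closed[OF flag_subspace[OF V that]] in auto)
  have unit: "\<exists>u. u \<in> ?S i \<and> x = of_real (norm x) *s u" if "x \<in> V ! i" "x \<noteq> 0" "vec.subspace (V ! i)" for x i
  proof (intro exI[of _ "of_real (inverse (norm x)) *s x"] conjI)
    have "norm (of_real (inverse (norm x)) *s x) = 1"
      unfolding scaleR_eq_vector_scalar[symmetric] using that(2) by simp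
    then show "of_real (inverse (norm x)) *s x \<in> ?S i"
      using vec.subspace_scale[OF that(3,1)] by simp
  qed (use that in \<open>simp add: vec_eq_iff\<close>)
  have xy0: "x \<noteq> 0" "y \<noteq> 0" using nz by auto
  obtain x1 where x1: "x1 \<in> ?S i" "x = of_real (norm x) *s x1" using unit[OF x xy0(1) subi] by blast
  obtain y1 where y1: "y1 \<in> ?S k" "y = of_real (norm y) *s y1" using unit[OF y xy0(2) subk] by blast
  interpret h: bounded_bilinear "herm :: complex^('m+'m) \<Rightarrow> complex^('m+'m) \<Rightarrow> complex" by (rule bounded_bilinear_herm)
  have cj: "continuous_on S jmap" for S by (rule linear_continuous_on[OF bounded_linear_jmap])
  have cont: "continuous_on (?S i \<times> ?S k) (\<lambda>p. cmod (herm (fst p) (jmap (snd p))))"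
    by (intro continuous_intros h.continuous_on continuous_on_compose2[OF cj]) auto
  have cpt: "compact (?S i \<times> ?S k)" using comp i k by (simp add: compact_Times)
  have ne: "?S i \<times> ?S k \<noteq> {}" using x1(1) y1(1) by blast
  have "\<exists>p\<in>?S i \<times> ?S k. \<forall>p'\<in>?S i \<times> ?S k. cmod (herm (fst p') (jmap (snd p'))) \<le> cmod (herm (fst p) (jmap (snd p)))"
    by (rule continuous_attains_sup[OF cpt ne cont])
  then obtain p where p: "p \<in> ?S i \<times> ?S k"
    and p_max: "\<forall>p'\<in>?S i \<times> ?S k. cmod (herm (fst p') (jmap (snd p'))) \<le> cmod (herm (fst p) (jmap (snd p)))"
    by (rule bexE)
  define u w where "u = fst p" and "w = snd p"
  have uw: "u \<in> ?S i" "w \<in> ?S k" using p unfolding u_def w_def mem_Times_iff by simp_all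
  note uw_max = p_max[folded u_def w_def]
  define c0 where "c0 = cmod (herm u (jmap w))"
  have u: "u \<in> V ! i" "norm u = 1" and w: "w \<in> V ! k" "norm w = 1" using uw by auto
  have max: "cmod (herm a (jmap b)) \<le> c0" if "a \<in> ?S i" "b \<in> ?S k" for a b
    using bspec[OF uw_max, of "(a, b)"] that unfolding c0_def by simp
  have max': "cmod (herm a (jmap b)) \<le> c0 * norm a * norm b" if a: "a \<in> V ! i" and b: "b \<in> V ! k" for a b
  proof (cases "a = 0 \<or> b = 0")
    case False
    then obtain a1 b1 where a1: "a1 \<in> ?S i" "a = of_real (norm a) *s a1"
      and b1: "b1 \<in> ?S k" "b = of_real (norm b) *s b1"
      using unit[OF a _ subi] unit[OF b _ subk] by blast
    have "herm a (jmap b) = of_real (norm a) * of_real (norm b) * herm a1 (jmap b1)"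
      by (subst a1(2), subst b1(2)) (simp add: jmap_scale herm_scale mult_ac)
    then have "cmod (herm a (jmap b)) = norm a * norm b * cmod (herm a1 (jmap b1))"
      by (simp add: norm_mult)
    also have "\<dots> \<le> norm a * norm b * c0" using max[OF a1(1) b1(1)] by (simp add: mult_left_mono)
    finally show ?thesis by (simp add: mult_ac)
  qed auto
  have "cmod (herm x1 (jmap y1)) > 0"
    using nz by (subst (asm) x1(2), subst (asm) y1(2)) (simp add: jmap_scale herm_scale)
  then have c0: "c0 > 0" using max[OF x1(1) y1(1)] by linarith
  let ?A = "orbit_preimage V (orbit K0 V)"
  \<comment> \<open>The direction \<open>hgen u\<close> stretches \<open>u\<close> and contracts
    \<open>jmap u\<close>, so it would change the angle between \<open>u\<close> and
    \<open>jmap w\<close>.\<close>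
  have "hgen u \<in> tangent_space ?A one_mat"
    by (rule hgen_in_tangent_space[OF tangent_space_K0_orbit_subspace[OF sub] u(2)])
  then obtain \<gamma> :: "real \<Rightarrow> _" where g: "\<gamma> 0 = one_mat" "(\<gamma> has_vector_derivative hgen u) (at 0)"
    "\<forall>\<^sub>F t in at 0. \<gamma> t \<in> ?A" unfolding tangent_space_def by blast
  define P where "P v t = to_matrix (\<gamma> t) *v v" for v t
  define H where "H = outer u u - outer (jmap u) (jmap u)"
  have Hx: "H *v z = herm z u *s u - herm z (jmap u) *s jmap u" for z
    by (simp add: H_def matrix_vector_mult_diff_rdistrib outer_mult)
  have P0: "P v 0 = v" for v by (simp add: P_def g(1))
  have dP: "(P v has_vector_derivative H *v v) (at 0)" for v
    using bounded_linear.has_vector_derivative[OF bounded_linear_to_matrix_mult g(2), of v]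
    by (simp add: P_def[abs_def] hgen_def H_def)
  define h where "h t = herm (P u t) (jmap (P w t))" for t
  have "(h has_vector_derivative (herm (P u 0) (jmap (H *v w)) + herm (H *v u) (jmap (P w 0)))) (at 0)"
    unfolding h_def
    by (rule h.has_vector_derivative[OF dP bounded_linear.has_vector_derivative[OF bounded_linear_jmap dP]])
  \<comment> \<open>\<open>H\<close> lies in the complex symplectic Lie algebra, hence the form
    itself is stationary and only the lengths of \<open>P u t\<close> and \<open>P w t\<close> vary
    to first order.\<close>
  moreover have "herm (P u 0) (jmap (H *v w)) + herm (H *v u) (jmap (P w 0)) = 0"
  proof -
    have hu: "herm u u = 1" using u by (simp add: herm_self)
    show ?thesis unfolding P0 Hx
      using herm_jmap_swap[of u w]
      by (simp add: herm_diff herm_add cnj_herm herm_scale jmap_scale jmap_add linear_diff[OF linear_jmap] herm_minus hu)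
  qed
  ultimately have dh: "(h has_vector_derivative 0) (at 0)" by simp
  \<comment> \<open>The bound \<open>max'\<close> in squared form, which makes it differentiable. It
    holds along the whole curve, since the flags there are images of \<open>V\<close> under unitary
    quaternionic matrices, and is sharp at 0; so \<open>G\<close> has a minimum at 0.\<close>
  define G where "G t = c0\<^sup>2 * (inner (P u t) (P u t) * inner (P w t) (P w t)) - inner (h t) (h t)" for t
  have dI: "((\<lambda>t. inner (f t) (f t)) has_real_derivative 2 * inner (f 0) f') (at 0)"
    if "(f has_vector_derivative f') (at 0)" for f :: "real \<Rightarrow> 'z::real_inner" and f'
    using bounded_bilinear.has_vector_derivative[OF bounded_bilinear_inner that that]
    by (simp add: has_real_derivative_iff_has_vector_derivative inner_commute)
  have "(G has_real_derivative c0\<^sup>2 * (2 * inner u (H *v u) + 2 * inner w (H *v w))) (at 0)"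
  proof -
    have one: "inner u u = 1" "inner w w = 1" using u w by (simp_all add: power2_norm_eq_inner[symmetric])
    show ?thesis
      using DERIV_diff[OF DERIV_cmult[OF DERIV_mult[OF dI[OF dP[of u]] dI[OF dP[of w]]], of "c0\<^sup>2"] dI[OF dh]]
      unfolding G_def[abs_def, symmetric] by (simp add: P0 one)
  qed
  moreover have "\<exists>e>0. \<forall>t. \<bar>0 - t\<bar> < e \<longrightarrow> G 0 \<le> G t"
  proof -
    have G0: "G 0 = 0"
      using u w by (simp add: G_def P0 h_def c0_def power2_norm_eq_inner[symmetric])
    have "G t \<ge> 0" if mem: "\<gamma> t \<in> ?A" for t
    proof -
      obtain K where K: "K \<in> K0" "act (to_matrix (\<gamma> t)) V = act K V"
        using mem unfolding orbit_preimage_def orbit_def by blast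
      have uni: "adjoint_mat K ** K = mat 1" and quat: "quaternionic K" using K(1) K0_iff by blast+
      have nK: "norm (K *v a) = norm a" for a
      proof -
        have "(norm (K *v a))\<^sup>2 = (norm a)\<^sup>2"
          using unitary_herm[OF uni, of a a] unfolding herm_self by (simp only: of_real_eq_iff)
        then show ?thesis by simp
      qed
      have "P u t \<in> act (to_matrix (\<gamma> t)) V ! i" "P w t \<in> act (to_matrix (\<gamma> t)) V ! k"
        using u w len by (simp_all add: act_nth P_def)
      then obtain a b where a: "a \<in> V ! i" "P u t = K *v a" and b: "b \<in> V ! k" "P w t = K *v b"
        unfolding K(2) using len by (auto simp: act_nth)
      have "h t = herm a (jmap b)"
        using quat unfolding h_def a(2) b(2) quaternionic_def by (simp add: unitary_herm[OF uni])
      then have "cmod (h t) \<le> c0 * norm (P u t) * norm (P w t)"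
        using max'[OF a(1) b(1)] by (simp add: a(2) b(2) nK)
      then have "(cmod (h t))\<^sup>2 \<le> (c0 * norm (P u t) * norm (P w t))\<^sup>2" by (rule power_mono) simp
      then show ?thesis by (simp add: G_def power2_norm_eq_inner[symmetric] power_mult_distrib mult_ac)
    qed
    then have "\<forall>\<^sub>F t in at 0. G 0 \<le> G t" unfolding G0 by (rule eventually_mono[OF g(3)])
    then obtain e where e: "e > 0" "\<forall>t\<in>UNIV. t \<noteq> 0 \<and> dist t 0 < e \<longrightarrow> G 0 \<le> G t"
      unfolding eventually_at by (elim exE conjE)
    have "G 0 \<le> G t" if "\<bar>0 - t\<bar> < e" for t
      using e(2) that by (cases "t = 0") (simp_all add: dist_real_def)
    then show ?thesis using e(1) by (intro exI[of _ e] conjI allI impI)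
  qed
  ultimately have "c0\<^sup>2 * (2 * inner u (H *v u) + 2 * inner w (H *v w)) = 0"
    using DERIV_local_min by blast
  then have eq: "inner u (H *v u) + inner w (H *v w) = 0" using c0 by simp
  have "inner u (H *v u) = 1"
    unfolding Hx using u by (simp add: herm_self power2_norm_eq_inner[symmetric])
  moreover have "inner w (H *v w) = (cmod (herm w u))\<^sup>2 - c0\<^sup>2"
  proof -
    have "herm w (H *v w) = herm w u * cnj (herm w u) - herm w (jmap u) * cnj (herm w (jmap u))"
      unfolding Hx by (simp add: herm_diff herm_scale mult.commute)
    then have "herm w (H *v w) = of_real ((cmod (herm w u))\<^sup>2 - (cmod (herm w (jmap u)))\<^sup>2)"
      by (simp only: complex_norm_square[symmetric] of_real_diff of_real_power)
    then have "inner w (H *v w) = (cmod (herm w u))\<^sup>2 - (cmod (herm w (jmap u)))\<^sup>2"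
      unfolding Re_herm[symmetric] by simp
    then show ?thesis using herm_jmap_swap[of u w] by (simp add: c0_def norm_minus_cancel)
  qed
  \<comment> \<open>Stationarity reads \<open>1 + (cmod (herm w u))^2 = c0^2\<close>.\<close>
  ultimately have c1: "c0\<^sup>2 \<ge> 1" using eq by (smt (verit) zero_le_power2)
  \<comment> \<open>The component of \<open>u\<close> orthogonal to \<open>jmap w\<close> has
    squared length \<open>1 - c0^2\<close>. It vanishes, so \<open>u\<close> is a multiple of
    \<open>jmap w\<close>, against \<open>disj\<close>.\<close>
  let ?z = "herm u (jmap w)"
  have "herm (u - ?z *s jmap w) (u - ?z *s jmap w) = of_real (1 - c0\<^sup>2)"
  proof -
    have "herm u u = 1" "herm (jmap w) (jmap w) = 1" using u w by (simp_all add: herm_self)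
    then have "herm (u - ?z *s jmap w) (u - ?z *s jmap w) = 1 - ?z * cnj ?z"
      using cnj_herm[of u "jmap w"] by (simp add: herm_diff herm_scale mult.commute)
    then show ?thesis unfolding c0_def by (simp only: complex_norm_square[symmetric] of_real_diff of_real_power of_real_1)
  qed
  then have "(norm (u - ?z *s jmap w))\<^sup>2 = 1 - c0\<^sup>2" unfolding herm_self by (simp only: of_real_eq_iff)
  then have "norm (u - ?z *s jmap w) = 0" using c1 by (smt (verit) zero_le_power2 power2_eq_square mult_eq_0_iff)
  then have "u = jmap (cnj ?z *s w)" by (simp add: jmap_scale)
  moreover have "cnj ?z *s w \<in> V ! k" by (rule vec.subspace_scale[OF subk w(1)])
  ultimately have "u \<in> V ! i \<inter> jmap ` (V ! k)" using u(1) by blast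
  then show False using disj u(2) by auto
qed

section \<open>The dimension of the base cycle\<close>

text \<open>Steps are counted from 0, whence the summand 2: for a symmetric sequence of
  \<open>r\<close> positive entries, \<open>i + k + 2 \<le> r\<close> says that the dimensions of
  \<open>V ! i\<close> and \<open>V ! k\<close> add up to at most that of the whole space.\<close>

definition isotropic :: "nat \<Rightarrow> ('m::finite + 'm) flag \<Rightarrow> bool" where
  "isotropic r V \<longleftrightarrow> (\<forall>i k. i + k + 2 \<le> r \<longrightarrow> (\<forall>x\<in>V ! i. \<forall>y\<in>V ! k. herm x (jmap y) = 0))"

definition balanced :: "nat \<Rightarrow> ('m + 'm \<Rightarrow> nat) \<Rightarrow> bool" where
  "balanced r b \<longleftrightarrow> (\<forall>a. b a + b (swap a) + 1 = r)"

lemma balanced_sum: "balanced r b \<Longrightarrow> b a + b (swap a) + 1 = r"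
  by (simp add: balanced_def)

lemma balanced_swap: "balanced r b \<Longrightarrow> b (swap a) = r - 1 - b a"
  using balanced_sum[of r b a] by linarith

lemma coord_flag_isotropic:
  assumes "balanced r b" shows "isotropic r (coord_flag r b)"
  unfolding isotropic_def
proof (intro allI impI ballI)
  fix i k x y assume ik: "i + k + 2 \<le> r" and "x \<in> coord_flag r b ! i" "y \<in> coord_flag r b ! k"
  then have x: "x \<in> coord_space {a. b a \<le> i}" and y: "y \<in> coord_space {a. b a \<le> k}"
    by (simp_all add: coord_flag_nth)
  have "x $ a * cnj (jmap y $ a) = 0" for a
  proof (cases "b a \<le> i")
    case True
    then have "\<not> b (swap a) \<le> k" using ik balanced_swap[OF assms, of a] by simp
    then show ?thesis using y by (simp add: jmap_nth coord_space_def)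
  next
    case False then show ?thesis using x by (simp add: coord_space_def)
  qed
  then show "herm x (jmap y) = 0" unfolding herm_def by (intro sum.neutral ballI)
qed

lemma isotropic_act_K0:
  assumes "K \<in> K0" "isotropic r V" "length V = r" shows "isotropic r (act K V)"
proof -
  have uni: "adjoint_mat K ** K = mat 1" and quat: "quaternionic K" using assms(1) K0_iff by blast+
  have "herm (K *v x) (jmap (K *v y)) = herm x (jmap y)" for x y
    using quat unfolding quaternionic_def by (simp add: unitary_herm[OF uni])
  then show ?thesis using assms(2,3) unfolding isotropic_def by (auto simp: act_nth)
qed

text \<open>The number of conditions imposed by isotropy. The form is alternating, so a condition
  belongs to an unordered pair of distinct coordinates; \<open>q\<close> serves to count each pair
  once.\<close>

definition pair_count :: "('n::finite \<Rightarrow> nat) \<Rightarrow> ('n \<Rightarrow> nat) \<Rightarrow> nat \<Rightarrow> nat" where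
  "pair_count q b r = card {(a, a'). q a < q a' \<and> b a + b a' + 2 \<le> r}"

text \<open>Isotropy linearized at a balanced coordinate flag: the equation for the position
  \<open>(a, a')\<close> is the derivative of the form on the images of the basis vectors
  \<open>a'\<close> and \<open>swap a\<close>. Positions in or above the diagonal blocks are
  unrestricted.\<close>

definition cycle_tangent :: "('m::finite + 'm \<Rightarrow> nat) \<Rightarrow> (complex^(('m + 'm) \<times> ('m + 'm))) set" where
  "cycle_tangent b = {x. \<forall>a a'. b a' < b a \<longrightarrow> x $ (a, a') = - tau a * tau a' * x $ (swap a', swap a)}"

lemma cycle_tangent_subspace: "vec.subspace (cycle_tangent b)"
  unfolding vec.subspace_def cycle_tangent_def by (auto simp: algebra_simps)

text \<open>For balanced \<open>b\<close> the involution \<open>?flip\<close> preserves the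
  positions below the block diagonal, and the equations tie each position to its image. One position
  of every two-element orbit is thereby eliminated, and these orbits correspond to the pairs of
  \<open>pair_count\<close>.\<close>

lemma cycle_tangent_dim:
  fixes b :: "'m::finite + 'm \<Rightarrow> nat"
  assumes bal: "balanced r b" and q: "numbering q"
  shows "vec.dim (cycle_tangent b) + pair_count q b r = CARD('m + 'm)\<^sup>2"
proof -
  have inj: "inj q" using q unfolding numbering_def bij_betw_def by simp
  let ?flip = "\<lambda>p. (swap (snd p), swap (fst p)) :: ('m + 'm) \<times> ('m + 'm)"
  \<comment> \<open>One representative of each two-element orbit of \<open>?flip\<close>. At a fixed
    position, where \<open>a' = swap a\<close>, the equation is void because
    \<open>tau a * tau (swap a) = -1\<close>.\<close>
  define Q :: "(('m + 'm) \<times> ('m + 'm)) set" where "Q = {(a, a'). b a' < b a \<and> q a' < q (swap a)}"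
  define s :: "('m + 'm) \<times> ('m + 'm) \<Rightarrow> complex" where "s p = tau (fst p) * tau (snd p)" for p
  have flip_Q: "?flip p \<notin> Q" if "p \<in> Q" for p using that by (auto simp: Q_def)
  \<comment> \<open>A shear that turns the equation at a position of \<open>Q\<close> into the
    vanishing of one coordinate; \<open>F'\<close> is its inverse.\<close>
  define F :: "complex^(('m + 'm) \<times> ('m + 'm)) \<Rightarrow> complex^(('m + 'm) \<times> ('m + 'm))" where
    "F x = (\<chi> p. if p \<in> Q then x $ p + s p * x $ ?flip p else x $ p)" for x
  define F' :: "complex^(('m + 'm) \<times> ('m + 'm)) \<Rightarrow> complex^(('m + 'm) \<times> ('m + 'm))" where
    "F' x = (\<chi> p. if p \<in> Q then x $ p - s p * x $ ?flip p else x $ p)" for x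
  have lin: "Vector_Spaces.linear (*s) (*s) F"
    by (rule vec_linearI) (auto simp: vec_eq_iff F_def algebra_simps)
  have FF: "F' (F x) = x" "F (F' x) = x" for x
    using flip_Q by (auto simp: vec_eq_iff F_def F'_def)
  have "F ` cycle_tangent b = coord_space (- Q)"
  proof (intro equalityI subsetI)
    fix y assume "y \<in> F ` cycle_tangent b"
    then obtain x where x: "x \<in> cycle_tangent b" "y = F x" by blast
    show "y \<in> coord_space (- Q)"
      using x(1) unfolding x(2) coord_space_def cycle_tangent_def F_def s_def Q_def by auto
  next
    fix y assume y: "y \<in> coord_space (- Q)"
    have Qy: "y $ p = 0" if "p \<in> Q" for p using y that by (cases p) (auto simp: coord_space_def)
    have "F' y \<in> cycle_tangent b"
      unfolding cycle_tangent_def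
    proof (intro CollectI allI impI)
      fix a a' assume lt: "b a' < b a"
      consider "a' = swap a" | "q a' < q (swap a)" | "q (swap a) < q a'"
        using inj by (metis injD linorder_neqE_nat)
      then show "F' y $ (a, a') = - tau a * tau a' * F' y $ (swap a', swap a)"
      proof cases
        case 2
        then have "(a, a') \<in> Q" using lt by (simp add: Q_def)
        then show ?thesis using flip_Q[of "(a, a')"] Qy[of "(a, a')"] by (simp add: F'_def s_def)
      next
        case 3
        have "b (swap a) < b (swap a')"
          using lt balanced_sum[OF bal, of a] balanced_sum[OF bal, of a'] by linarith
        then have "(swap a', swap a) \<in> Q" using 3 by (simp add: Q_def)
        then show ?thesis using flip_Q[of "(swap a', swap a)"] Qy[of "(swap a', swap a)"]
          by (simp add: F'_def s_def mult_ac)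
      qed (simp add: F'_def)
    qed
    then show "y \<in> F ` cycle_tangent b" using FF(2)[of y] by (metis imageI)
  qed
  then have "vec.dim (cycle_tangent b) = card (- Q)"
    using vec_dim_inj_image[OF lin inj_on_inverseI[of UNIV F' F]] FF(1) coord_space_dim[of "- Q"] by metis
  moreover have "card (- Q) + card Q = CARD('m + 'm)\<^sup>2"
  proof -
    have "card (- Q) + card Q = card (- Q \<union> Q)" by (rule card_Un_disjoint[symmetric]) auto
    then show ?thesis by (simp add: power2_eq_square Compl_partition2)
  qed
  moreover have "card Q = pair_count q b r"
  proof -
    have "bij_betw (\<lambda>p. (snd p, swap (fst p))) Q {(a, a'). q a < q a' \<and> b a + b a' + 2 \<le> r}"
    proof (rule bij_betwI[of _ _ _ "\<lambda>p. (swap (snd p), fst p)"])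
      show "(\<lambda>p. (snd p, swap (fst p))) \<in> Q \<rightarrow> {(a, a'). q a < q a' \<and> b a + b a' + 2 \<le> r}"
      proof
        fix p assume "p \<in> Q"
        then have "b (snd p) < b (fst p)" "q (snd p) < q (swap (fst p))" by (auto simp: Q_def)
        moreover have "b (fst p) + b (swap (fst p)) + 1 = r" by (rule balanced_sum[OF bal])
        ultimately show "(snd p, swap (fst p)) \<in> {(a, a'). q a < q a' \<and> b a + b a' + 2 \<le> r}" by simp
      qed
      show "(\<lambda>p. (swap (snd p), fst p)) \<in> {(a, a'). q a < q a' \<and> b a + b a' + 2 \<le> r} \<rightarrow> Q"
      proof
        fix p assume p: "p \<in> {(a, a'). q a < q a' \<and> b a + b a' + 2 \<le> r}"
        moreover have "b (snd p) + b (swap (snd p)) + 1 = r" by (rule balanced_sum[OF bal])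
        ultimately show "(swap (snd p), fst p) \<in> Q" by (auto simp: Q_def)
      qed
    qed auto
    then show ?thesis unfolding pair_count_def by (rule bij_betw_same_card)
  qed
  ultimately show ?thesis by simp
qed

text \<open>After rescaling, \<open>hgen v\<close> lies in \<open>T\<close> for every
  \<open>v\<close>. It is the diagonal of a form linear in \<open>v\<close> and conjugate linear in
  \<open>w\<close>, so complex polarization recovers the form from its diagonal.\<close>

lemma hgen_polarized:
  fixes T :: "(complex^(('m::finite + 'm) \<times> ('m + 'm))) set"
  assumes T: "vec.subspace T" and unit: "\<And>v. norm v = 1 \<Longrightarrow> hgen v \<in> T"
  shows "of_matrix (outer v w - outer (jmap w) (jmap v)) \<in> T"
proof -
  have all: "hgen v \<in> T" for v
  proof (cases "v = 0")
    case True
    have "hgen v = 0" unfolding True hgen_def by (simp add: outer_def vec_eq_iff of_matrix_def)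
    then show ?thesis using vec.subspace_0[OF T] by simp
  next
    case False
    let ?u = "of_real (inverse (norm v)) *s v"
    have "norm ?u = 1" unfolding scaleR_eq_vector_scalar[symmetric] using False by simp
    then have "of_real ((norm v)\<^sup>2) *s hgen ?u \<in> T" using unit vec.subspace_scale[OF T] by blast
    moreover have "of_real ((norm v)\<^sup>2) *s hgen ?u = hgen v"
      using False by (simp add: hgen_def outer_def vec_eq_iff of_matrix_def jmap_scale power2_eq_square field_simps)
    ultimately show ?thesis by simp
  qed
  let ?x = "(1/2) *s (hgen (v + w) - hgen v - hgen w + \<i> *s (hgen (v + \<i> *s w) - hgen v - hgen w))"
  have "?x \<in> T"
    by (intro vec.subspace_scale[OF T] vec.subspace_add[OF T] vec.subspace_diff[OF T] all)
  moreover have "?x = of_matrix (outer v w - outer (jmap w) (jmap v))"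
    by (simp add: hgen_def outer_def vec_eq_iff of_matrix_def jmap_add jmap_scale algebra_simps)
  ultimately show ?thesis by simp
qed

text \<open>The tangent space of the preimage is exactly \<open>cycle_tangent b\<close>. It is
  contained there because isotropy persists along the orbit; it fills that space because it contains
  the stabilizer directions and all polarized Hermitian generators.\<close>

lemma base_cycle_dim:
  fixes b :: "'m::finite + 'm \<Rightarrow> nat"
  assumes b: "fits c b" and bal: "balanced (length c) b" and q: "numbering q"
    and sub: "flag_submanifold c d (orbit K0 (coord_flag (length c) b))"
  shows "d + stab_dim b + pair_count q b (length c) = CARD('m + 'm)\<^sup>2"
proof -
  let ?r = "length c"
  let ?E = "coord_flag ?r b"
  let ?A = "orbit_preimage ?E (orbit K0 ?E)"
  let ?T = "tangent_space ?A one_mat"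
  have E: "?E \<in> flag_manifold c" by (rule coord_flag_in_manifold[OF b])
  have E_orb: "?E \<in> orbit K0 ?E" by (rule orbit_refl[OF matrix_group_K0])
  obtain p where p: "complex_submanifold p (orbit_preimage ?E {?E})" "complex_submanifold (d + p) ?A"
    using sub E unfolding flag_submanifold_def by blast
  have sp: "submanifold_at p (orbit_preimage ?E {?E}) one_mat" using p(1) by (simp add: complex_submanifold_iff)
  have "p = stab_dim b"
    by (rule submanifold_at_dim_unique[OF sp submanifold_at_stabilizer[OF b], where W = UNIV]) auto
  then have "submanifold_at (d + stab_dim b) ?A one_mat" using p(2) E_orb by (simp add: complex_submanifold_iff)
  then have dimT: "vec.dim ?T = d + stab_dim b"
    by (rule tangent_space_submanifold(2)) (simp add: E_orb)
  have T: "vec.subspace ?T" by (rule tangent_space_K0_orbit_subspace[OF sub])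
  have "?T \<subseteq> cycle_tangent b"
  proof
    fix x assume "x \<in> ?T"
    then obtain \<gamma> :: "real \<Rightarrow> _" where g: "\<gamma> 0 = one_mat" "(\<gamma> has_vector_derivative x) (at 0)"
      "\<forall>\<^sub>F t in at 0. \<gamma> t \<in> ?A" unfolding tangent_space_def by blast
    interpret h: bounded_bilinear "herm :: complex^('m+'m) \<Rightarrow> complex^('m+'m) \<Rightarrow> complex" by (rule bounded_bilinear_herm)
    show "x \<in> cycle_tangent b"
      unfolding cycle_tangent_def
    proof (intro CollectI allI impI)
      fix a a' assume lt: "b a' < b a"
      \<comment> \<open>Since \<open>b a' < b a\<close> and \<open>b\<close> is balanced, these
        basis vectors lie in steps whose indices satisfy the bound in
        \<open>isotropic\<close>.\<close>
      define u where "u = (axis a' 1 :: complex^('m + 'm))"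
      define w where "w = (axis (swap a) 1 :: complex^('m + 'm))"
      define h where "h t = herm (to_matrix (\<gamma> t) *v u) (jmap (to_matrix (\<gamma> t) *v w))" for t
      have d: "((\<lambda>t. to_matrix (\<gamma> t) *v v) has_vector_derivative to_matrix x *v v) (at 0)" for v
        by (rule bounded_linear.has_vector_derivative[OF bounded_linear_to_matrix_mult g(2)])
      have "(h has_vector_derivative herm (to_matrix (\<gamma> 0) *v u) (jmap (to_matrix x *v w)) +
          herm (to_matrix x *v u) (jmap (to_matrix (\<gamma> 0) *v w))) (at 0)"
        unfolding h_def
        by (rule h.has_vector_derivative[OF d bounded_linear.has_vector_derivative[OF bounded_linear_jmap d]])
      then have dh: "(h has_vector_derivative (herm u (jmap (to_matrix x *v w)) + herm (to_matrix x *v u) (jmap w))) (at 0)"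
        by (simp add: g(1))
      have lens: "b a' < ?r" "b (swap a) < ?r" using b unfolding fits_def by auto
      have sum: "b a' + b (swap a) + 2 \<le> ?r" using lt balanced_sum[OF bal, of a] by linarith
      have h0: "h t = 0" if "\<gamma> t \<in> ?A" for t
      proof -
        have "act (to_matrix (\<gamma> t)) ?E \<in> orbit K0 ?E" using that by (simp add: orbit_preimage_def)
        then have iso: "isotropic ?r (act (to_matrix (\<gamma> t)) ?E)"
          using isotropic_act_K0[OF _ coord_flag_isotropic[OF bal]] unfolding orbit_def by auto
        have "to_matrix (\<gamma> t) *v u \<in> act (to_matrix (\<gamma> t)) ?E ! b a'"
          "to_matrix (\<gamma> t) *v w \<in> act (to_matrix (\<gamma> t)) ?E ! b (swap a)"
          using lens by (auto simp: act_nth coord_flag_nth u_def w_def axis_in_coord_space)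
        then show ?thesis using iso sum unfolding h_def isotropic_def by blast
      qed
      have "h 0 = 0" using h0[of 0] g(1) E_orb by simp
      have "\<forall>\<^sub>F t in at 0. h t = 0" by (rule eventually_mono[OF g(3)]) (rule h0)
      then have "(h has_vector_derivative 0) (at 0)"
        using has_vector_derivative_const[of 0 "at 0"] \<open>h 0 = 0\<close>
        by (simp add: has_vector_derivative_def has_derivative_transform_eventually[where f = "\<lambda>_. 0" and g = h])
      then have "herm u (jmap (to_matrix x *v w)) + herm (to_matrix x *v u) (jmap w) = 0"
        using vector_derivative_unique_at[OF dh] by simp
      then have "tau a' * x $ (swap a', swap a) + tau a * x $ (a, a') = 0"
        unfolding u_def w_def by (simp add: jmap_axis herm_scale herm_axis jmap_nth)
      then have "tau a * (tau a' * x $ (swap a', swap a) + tau a * x $ (a, a')) = 0" by simp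
      then show "x $ (a, a') = - tau a * tau a' * x $ (swap a', swap a)"
        by (simp add: distrib_left mult.assoc add_eq_0_iff)
    qed
  qed
  moreover have "cycle_tangent b \<subseteq> ?T"
  proof
    fix x assume x: "x \<in> cycle_tangent b"
    have stab: "y \<in> ?T" if "y \<in> coord_space {(a, a'). b a \<le> b a'}" for y
    proof (rule tangent_spaceI)
      let ?L = "coord_space {(a, a'). b a \<le> b a'} :: (complex^(('m + 'm) \<times> ('m + 'm))) set"
      let ?\<gamma> = "\<lambda>t::real. one_mat + t *\<^sub>R y"
      show "?\<gamma> 0 = one_mat" by simp
      show "(?\<gamma> has_vector_derivative y) (at 0)" by (auto intro!: derivative_eq_intros)
      have "((\<lambda>t. ?\<gamma> t) \<longlongrightarrow> one_mat) (at 0)" by (auto intro!: tendsto_eq_intros)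
      then have ev: "\<forall>\<^sub>F t in at 0. ?\<gamma> t \<in> {x. invertible (to_matrix x)}"
        by (rule topological_tendstoD[OF _ open_invertible]) simp
      have one: "one_mat \<in> ?L" by (auto simp: coord_space_def one_mat_def mat_def)
      have "?\<gamma> t \<in> ?L" for t
        using one that by (auto simp: coord_space_def)
      then have "\<forall>\<^sub>F t in at 0. ?\<gamma> t \<in> orbit_preimage ?E {?E}"
        unfolding orbit_preimage_stabilizer[OF b] by (intro eventually_mono[OF ev]) auto
      then show "\<forall>\<^sub>F t in at 0. ?\<gamma> t \<in> ?A"
        by (rule eventually_mono) (use E_orb in \<open>auto simp: orbit_preimage_def\<close>)
    qed
    \<comment> \<open>The element of the complex symplectic Lie algebra with entry 1 at the position
      \<open>p\<close> and the matching entry at the flipped position.\<close>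
    define e where "e p = of_matrix (outer (axis (fst p) 1) (axis (snd p) 1) - outer (jmap (axis (snd p) 1)) (jmap (axis (fst p) 1)))"
      for p :: "('m + 'm) \<times> ('m + 'm)"
    have eT: "e p \<in> ?T" for p
      unfolding e_def by (rule hgen_polarized[OF T hgen_in_tangent_space[OF T]])
    have en: "e p $ (k, l) = (if (k, l) = p then 1 else 0) - (if (k, l) = (swap (snd p), swap (fst p)) then tau (fst p) * tau (snd p) else 0)" for p k l
    proof -
      have ax: "axis x (1 :: complex) $ k = (if k = x then 1 else 0)" for x k :: "'m + 'm"
        by (simp add: axis_def)
      have jax: "jmap (axis x 1) $ k = (if k = swap x then - tau x else 0)" for x k :: "'m + 'm"
        unfolding jmap_axis by (simp add: ax)
      have "e p $ (k, l) = axis (fst p) 1 $ k * cnj (axis (snd p) 1 $ l)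
          - jmap (axis (snd p) 1) $ k * cnj (jmap (axis (fst p) 1) $ l)"
        by (simp add: e_def outer_def)
      moreover have "(if A then 1 else 0) * cnj (if B then 1 else 0) - (if C then - tau y else 0) * cnj (if D then - tau x else 0)
          = (if A \<and> B then 1 else 0) - (if C \<and> D then tau x * tau y else 0)" for A B C D and x y :: "'m + 'm"
        by (simp add: mult.commute)
      ultimately show ?thesis unfolding ax jax prod_eq_iff fst_conv snd_conv by (simp only:)
    qed
    define Q where "Q = {(a, a'). b a' < b a}"
    have flipQ: "(k, l) \<in> Q \<longleftrightarrow> (swap l, swap k) \<in> Q" for k l
    proof -
      show ?thesis using balanced_sum[OF bal, of k] balanced_sum[OF bal, of l]
        unfolding Q_def mem_Collect_eq case_prod_conv by linarith
    qed
    \<comment> \<open>Each position below the block diagonal is reached by \<open>e p\<close> and by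
      the generator of the flipped position, hence the factor one half. The equations on
      \<open>x\<close> make both contributions agree, and \<open>x - z\<close> is a stabilizer
      direction.\<close>
    define z where "z = (\<Sum>p\<in>Q. (x $ p / 2) *s e p)"
    have "z \<in> ?T" unfolding z_def by (intro vec.subspace_sum[OF T] vec.subspace_scale[OF T] eT)
    moreover have "x - z \<in> ?T"
    proof (rule stab)
      have "z $ (k, l) = x $ (k, l)" if kl: "(k, l) \<in> Q" for k l
      proof -
        have "z $ (k, l) = (\<Sum>p\<in>Q. (if p = (k, l) then x $ p / 2 else 0) -
            (if p = (swap l, swap k) then x $ p / 2 * (tau (fst p) * tau (snd p)) else 0))"
          unfolding z_def sum_component
        proof (rule sum.cong[OF refl])
          fix p assume "p \<in> Q"
          have eq: "(k, l) = (swap (snd p), swap (fst p)) \<longleftrightarrow> p = (swap l, swap k)"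
            unfolding prod_eq_iff fst_conv snd_conv by (metis swap_swap)
          have "y * ((if A then 1 else 0) - (if B then t else 0)) = (if A then y else 0) - (if B then y * t else 0)"
            for y t :: complex and A B by (simp add: right_diff_distrib)
          then show "((x $ p / 2) *s e p) $ (k, l) = (if p = (k, l) then x $ p / 2 else 0) -
              (if p = (swap l, swap k) then x $ p / 2 * (tau (fst p) * tau (snd p)) else 0)"
            unfolding vector_smult_component en eq eq_commute[of "(k, l)" p] .
        qed
        also have "\<dots> = x $ (k, l) / 2 - x $ (swap l, swap k) / 2 * (tau (swap l) * tau (swap k))"
          using kl flipQ[of k l] by (simp add: sum_subtractf sum.delta)
        also have "\<dots> = x $ (k, l)"
        proof -
          have "x $ (k, l) = - tau k * tau l * x $ (swap l, swap k)"
            using x kl unfolding cycle_tangent_def Q_def by blast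
          then show ?thesis by (simp add: mult_ac)
        qed
        finally show ?thesis .
      qed
      then show "x - z \<in> coord_space {(a, a'). b a \<le> b a'}"
        unfolding coord_space_def Q_def by auto
    qed
    ultimately have "z + (x - z) \<in> ?T" by (rule vec.subspace_add[OF T])
    then show "x \<in> ?T" by simp
  qed
  ultimately have "?T = cycle_tangent b" by blast
  then show ?thesis using dimT cycle_tangent_dim[OF bal q] by simp
qed

lemma dim_le_dim_herm_orthogonal:
  fixes W :: "(complex^'n::finite) set"
  assumes W: "vec.subspace W" and Y: "finite Y"
  shows "vec.dim W \<le> vec.dim (W \<inter> {z. \<forall>y\<in>Y. herm z y = 0}) + card Y"
  using Y
proof (induction Y)
  case (insert y Y)
  let ?W = "W \<inter> {z. \<forall>y\<in>Y. herm z y = 0}"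
  let ?W' = "W \<inter> {z. \<forall>y'\<in>insert y Y. herm z y' = 0}"
  have sub: "vec.subspace ?W'"
    using W unfolding vec.subspace_def by (auto simp: herm_add herm_scale)
  have "vec.dim ?W \<le> vec.dim ?W' + 1"
  proof (cases "?W \<subseteq> ?W'")
    case True
    then show ?thesis using vec.dim_subset[OF True] by simp
  next
    case False
    then obtain w where w: "w \<in> ?W" "herm w y \<noteq> 0" by auto
    have "?W \<subseteq> vec.span (insert w ?W')"
    proof
      fix z assume z: "z \<in> ?W"
      let ?k = "herm z y / herm w y"
      have "z - ?k *s w \<in> W" using z w W by (auto intro: vec.subspace_diff vec.subspace_scale)
      then have "z - ?k *s w \<in> ?W'" using z w by (auto simp: herm_diff herm_scale)
      then have "(z - ?k *s w) + ?k *s w \<in> vec.span (insert w ?W')"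
        by (intro vec.span_add vec.span_scale vec.span_base insertI1 insertI2)
      then show "z \<in> vec.span (insert w ?W')" by simp
    qed
    then have "vec.dim ?W \<le> vec.dim (vec.span (insert w ?W'))" by (rule vec.dim_subset)
    also have "\<dots> = vec.dim (insert w ?W')" by (rule vec.dim_span)
    also have "\<dots> \<le> vec.dim ?W' + 1" by (simp add: vec.dim_insert)
    finally show ?thesis .
  qed
  then show ?case using insert by simp
qed simp

lemma unit_vector_orthogonal:
  fixes W :: "(complex^'n::finite) set"
  assumes W: "vec.subspace W" and Y: "finite Y" and lt: "card Y < vec.dim W"
  obtains z where "z \<in> W" "norm z = 1" "\<And>y. y \<in> Y \<Longrightarrow> herm z y = 0"
proof -
  let ?W = "W \<inter> {z. \<forall>y\<in>Y. herm z y = 0}"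
  have "vec.dim ?W > 0" using dim_le_dim_herm_orthogonal[OF W Y] lt by simp
  then have "\<not> ?W \<subseteq> {0}" by (simp only: vec.dim_eq_0[symmetric])
  then obtain z where z: "z \<in> W" "\<forall>y\<in>Y. herm z y = 0" "z \<noteq> 0" by auto
  let ?z = "of_real (inverse (norm z)) *s z"
  have "norm ?z = 1" unfolding scaleR_eq_vector_scalar[symmetric] using z(3) by simp
  moreover have "?z \<in> W" by (rule vec.subspace_scale[OF W z(1)])
  moreover have "herm ?z y = 0" if "y \<in> Y" for y using z(2) that by (simp add: herm_scale)
  ultimately show ?thesis by (intro that[of ?z])
qed

text \<open>One vector of each pair \<open>a\<close>, \<open>swap a\<close> is chosen greedily, in the order of \<open>b\<close>; the other
  one is its image under \<open>jmap\<close>.\<close>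

lemma K0_transitive:
  fixes b :: "'m::finite + 'm \<Rightarrow> nat"
  assumes V: "V \<in> flag_manifold c" and iso: "isotropic (length c) V"
    and b: "fits c b" and bal: "balanced (length c) b"
  shows "\<exists>K\<in>K0. act K (coord_flag (length c) b) = V"
proof -
  let ?r = "length c"
  have bs: "b a + b (swap a) + 1 = ?r" for a by (rule balanced_sum[OF bal])
  have br: "b a < ?r" for a using b by (simp add: fits_def)
  \<comment> \<open>Chooses from each pair the coordinate in the earlier block; within the middle
    block, where both indices agree, the one of the form \<open>Inl i\<close>.\<close>
  define H where "H = {a. b a < b (swap a) \<or> b a = b (swap a) \<and> (\<exists>i. a = Inl i)}"
  have Hs: "swap a \<in> H \<longleftrightarrow> a \<notin> H" for a
    by (cases a) (auto simp: H_def swap_def)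
  define good where "good S v \<longleftrightarrow> (\<forall>a\<in>S. v a \<in> V ! b a \<and> norm (v a) = 1) \<and>
      (\<forall>a\<in>S. \<forall>a'\<in>S. (a \<noteq> a' \<longrightarrow> herm (v a) (v a') = 0) \<and> herm (v a) (jmap (v a')) = 0)" for S v
  have goodD: "v a \<in> V ! b a" "norm (v a) = 1" "a' \<in> S \<Longrightarrow> a \<noteq> a' \<Longrightarrow> herm (v a) (v a') = 0"
      "a' \<in> S \<Longrightarrow> herm (v a) (jmap (v a')) = 0" if "good S v" "a \<in> S" for S v a a'
    using that unfolding good_def by simp_all
  have "\<exists>v. good S v" if "S \<subseteq> H" for S
    using finite[of S] that
  proof (induction S rule: finite_ranking_induct[where f = b])
    case (insert a S)
    show ?case
    proof (cases "a \<in> S")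
      case True
      then show ?thesis using insert by (simp add: insert_absorb)
    next
      case False
      have SH: "S \<subseteq> H" and aH: "a \<in> H" using insert.prems by auto
      obtain v where good_v: "good S v" using insert.IH[OF SH] by (rule exE)
      note v = goodD[OF good_v]
      \<comment> \<open>Orthogonality to \<open>jmap (v y)\<close> must be imposed only when the
        partner of \<open>y\<close> lies in a step up to \<open>b a\<close>; for the other
        \<open>y\<close> it follows from isotropy. This keeps the number of conditions below the
        dimension of \<open>V ! b a\<close>.\<close>
      define S' where "S' = {y \<in> S. b (swap y) \<le> b a}"
      define Y where "Y = v ` S \<union> (\<lambda>y. jmap (v y)) ` S'"
      have "card Y \<le> card S + card S'"
        unfolding Y_def by (rule order_trans[OF card_Un_le add_mono[OF card_image_le card_image_le]]) auto
      also have "card S' = card (swap ` S')" by (rule card_image[symmetric]) (auto simp: inj_on_def swap_eq_iff)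
      also have "card S + card (swap ` S') = card (S \<union> swap ` S')"
        by (rule card_Un_disjoint[symmetric]) (use SH Hs in \<open>auto simp: S'_def\<close>)
      also have "\<dots> < card {x. b x \<le> b a}"
      proof (rule psubset_card_mono)
        have "a \<notin> swap ` S'"
        proof
          assume "a \<in> swap ` S'"
          then obtain y where "y \<in> S" "a = swap y" unfolding S'_def by blast
          then show False using aH SH Hs by auto
        qed
        moreover have "S \<union> swap ` S' \<subseteq> {x. b x \<le> b a}" using insert.hyps unfolding S'_def by auto
        ultimately show "S \<union> swap ` S' \<subset> {x. b x \<le> b a}" using False by auto
      qed simp
      also have "\<dots> = vec.dim (V ! b a)" using b br[of a] flag_dim[OF V br] unfolding fits_def by simp
      finally obtain z where z: "z \<in> V ! b a" "norm z = 1" "\<And>y. y \<in> Y \<Longrightarrow> herm z y = 0"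
        using unit_vector_orthogonal[OF flag_subspace[OF V br], of Y a] by (auto simp: Y_def)
      have z1: "herm z (v y) = 0" if "y \<in> S" for y using z(3) that unfolding Y_def by blast
      have z2: "herm z (jmap (v y)) = 0" if "y \<in> S" for y
      proof (cases "b (swap y) \<le> b a")
        case True
        then show ?thesis using z(3) that unfolding Y_def S'_def by blast
      next
        case False
        then have "b a + b y + 2 \<le> ?r" using bs[of y] by simp
        then show ?thesis using iso z(1) v(1)[OF that] unfolding isotropic_def by blast
      qed
      let ?v = "v(a := z)"
      have vS: "?v y = v y" if "y \<in> S" for y using that False by auto
      have "good (insert a S) ?v"
        unfolding good_def
      proof (intro conjI ballI)
        fix x assume "x \<in> insert a S"
        then show "?v x \<in> V ! b x" "norm (?v x) = 1" using v z by auto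
      next
        fix x y assume "x \<in> insert a S" "y \<in> insert a S"
        then consider "x = a" "y = a" | "x = a" "y \<in> S" | "x \<in> S" "y = a" | "x \<in> S" "y \<in> S" by auto
        then have "(x \<noteq> y \<longrightarrow> herm (?v x) (?v y) = 0) \<and> herm (?v x) (jmap (?v y)) = 0"
        proof cases
          case 3
          then show ?thesis
            using vS[of x] z1[of x] z2[of x] cnj_herm[of z "v x"] herm_jmap_swap[of "v x" z] by simp
        qed (use vS v z1 z2 in auto)
        then show "x \<noteq> y \<longrightarrow> herm (?v x) (?v y) = 0" "herm (?v x) (jmap (?v y)) = 0" by auto
      qed
      then show ?thesis by (rule exI[of _ ?v])
    qed
  qed (auto simp: good_def)
  from this[OF order_refl] obtain v where good_v: "good H v" by (rule exE)
  note v = goodD[OF good_v]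
  define u where "u a = (if a \<in> H then v a else tau a *s jmap (v (swap a)))" for a
  have ju: "jmap (u a) = - tau a *s u (swap a)" for a
    using Hs[of a] by (auto simp: u_def jmap_scale vec_eq_iff)
  have orth: "herm (u a) (u a') = (if a = a' then 1 else 0)" for a a'
  proof -
    have vv: "herm (v x) (v y) = (if x = y then 1 else 0)" if "x \<in> H" "y \<in> H" for x y
      using v(2)[OF that(1)] v(3)[OF that] by (auto simp: herm_self)
    have vj: "herm (jmap (v x)) (v y) = 0" if "x \<in> H" "y \<in> H" for x y
      using cnj_herm[of "v y" "jmap (v x)"] v(4)[OF that(2,1)] by simp
    show ?thesis
      by (cases "a \<in> H"; cases "a' \<in> H")
        (use Hs vv vj v(4) in \<open>auto simp: u_def herm_scale herm_jmap_jmap swap_eq_iff\<close>)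
  qed
  define K where "K = column_matrix u"
  have Ka: "K *v axis a 1 = u a" for a by (simp add: K_def)
  have hK: "herm (K *v x) (u a) = x $ a" for x a
  proof -
    have "herm (K *v x) (u a) = (\<Sum>a'\<in>UNIV. x $ a' * (if a' = a then 1 else 0))"
      unfolding K_def column_matrix_mult herm_sum by (intro sum.cong) (auto simp: herm_scale orth)
    then show ?thesis by (simp add: if_distrib cong: if_cong)
  qed
  have uni: "adjoint_mat K ** K = mat 1"
  proof -
    have "(adjoint_mat K *v (K *v x)) $ a = x $ a" for x a
      using herm_adjoint[of K "axis a 1" "K *v x"] hK[of x a] cnj_herm[of "K *v x" "u a"]
      unfolding Ka by (metis complex_cnj_cnj herm_axis(2))
    then show ?thesis by (simp add: matrix_eq vec_eq_iff matrix_vector_mul_assoc[symmetric])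
  qed
  have "quaternionic K"
    unfolding quaternionic_def
  proof
    fix x
    have "jmap (K *v x) = (\<Sum>a\<in>UNIV. jmap (x $ a *s u a))"
      unfolding K_def column_matrix_mult by (rule linear_sum[OF linear_jmap])
    also have "\<dots> = (\<Sum>a\<in>UNIV. (jmap x $ swap a) *s u (swap a))"
      by (intro sum.cong) (simp_all add: jmap_scale ju jmap_nth mult.commute)
    also have "\<dots> = (\<Sum>a\<in>UNIV. (jmap x $ a) *s u a)" by (rule sum_UNIV_swap)
    finally show "jmap (K *v x) = K *v jmap x" unfolding K_def column_matrix_mult .
  qed
  then have K: "K \<in> K0" by (rule unitary_quaternionic_in_K0[OF uni])
  have iK: "invertible K" by (rule matrix_group_invertible[OF matrix_group_K0 K])
  have KE: "act K (coord_flag ?r b) \<in> flag_manifold c"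
    by (rule act_flag_manifold[OF iK coord_flag_in_manifold[OF b]])
  \<comment> \<open>A step containing only chosen coordinates is spanned by vectors placed in
    \<open>V ! i\<close> by construction. For a later step the partners of the missing coordinates
    are chosen ones, and isotropy makes the corresponding coefficients of vectors in
    \<open>V ! i\<close> vanish. Equality of dimensions then turns one inclusion into
    equality.\<close>
  have "act K (coord_flag ?r b) ! i = V ! i" if i: "i < ?r" for i
  proof (cases "\<exists>a\<in>H. i < b a")
    case True
    then obtain a where a: "a \<in> H" "i < b a" by blast
    then have "2 * i + 2 < ?r + 1" using bs[of a] unfolding H_def by auto
    then have inH: "x \<in> H" if "b x \<le> i" for x using that bs[of x] unfolding H_def by auto
    have "act K (coord_flag ?r b) ! i \<subseteq> V ! i"
    proof
      fix y assume "y \<in> act K (coord_flag ?r b) ! i"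
      then obtain x where x: "x \<in> coord_space {a. b a \<le> i}" "y = K *v x"
        using i by (auto simp: act_nth coord_flag_nth)
      have "x $ a *s u a \<in> V ! i" for a
      proof (cases "b a \<le> i")
        case True
        then have "u a \<in> V ! i" using flag_mono[OF V True i] v(1) inH[OF True] by (auto simp: u_def)
        then show ?thesis using flag_subspace[OF V i] by (rule vec.subspace_scale[rotated])
      next
        case False
        then show ?thesis using x(1) flag_subspace[OF V i] by (simp add: coord_space_def vec.subspace_0)
      qed
      then show "y \<in> V ! i" unfolding x(2) K_def column_matrix_mult
        using flag_subspace[OF V i] by (simp add: vec.subspace_sum)
    qed
    then show ?thesis
      by (rule vec.subspace_dim_equal[rotated 2]) (use V KE i in \<open>simp_all add: flag_dim flag_subspace\<close>)
  next
    case False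
    have "V ! i \<subseteq> act K (coord_flag ?r b) ! i"
    proof
      fix y assume y: "y \<in> V ! i"
      obtain x where x: "y = K *v x" using surj_matrix_vector_mult[OF iK] by (metis surjD)
      have "x $ a = 0" if "\<not> b a \<le> i" for a
      proof -
        have "a \<notin> H" using False that by auto
        then have "v (swap a) \<in> V ! b (swap a)" using v(1) Hs by blast
        moreover have "i + b (swap a) + 2 \<le> ?r" using that bs[of a] by simp
        ultimately have "herm y (jmap (v (swap a))) = 0" using iso y unfolding isotropic_def by blast
        then show ?thesis using hK[of x a] \<open>a \<notin> H\<close> unfolding x by (simp add: u_def herm_scale)
      qed
      then show "y \<in> act K (coord_flag ?r b) ! i"
        unfolding x using i by (auto simp: act_nth coord_flag_nth coord_space_def)
    qed
    then show ?thesis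
      by (intro vec.subspace_dim_equal[symmetric]) (use V KE i in \<open>simp_all add: flag_dim flag_subspace\<close>)
  qed
  then have "act K (coord_flag ?r b) = V"
    using flag_length[OF V] by (intro nth_equalityI) auto
  then show ?thesis using K by blast
qed

section \<open>The open orbit\<close>

lemma matrix_group_G0: "matrix_group (G0 :: (complex^('m::finite + 'm)^('m + 'm)) set)"
  unfolding matrix_group_def
proof (intro conjI ballI)
  have iff: "X \<in> G0 \<longleftrightarrow> det X = 1 \<and> quaternionic X" for X :: "complex^('m + 'm)^('m + 'm)"
    by (simp add: G0_def SL_def quaternionic_def)
  show "(mat 1 :: complex^('m + 'm)^('m + 'm)) \<in> G0" by (simp add: iff quaternionic_def)
  show "A ** B \<in> G0" if "A \<in> G0" "B \<in> G0" for A B :: "complex^('m + 'm)^('m + 'm)"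
    using that by (simp add: iff quaternionic_mult det_mul)
  fix A :: "complex^('m + 'm)^('m + 'm)" assume A: "A \<in> G0"
  then have "invertible A" by (simp add: iff invertible_det_nz)
  then obtain B where B: "A ** B = mat 1" "B ** A = mat 1" by (rule invertibleE)
  have "det A * det B = 1" using arg_cong[OF B(1), of det] by (simp add: det_mul)
  then have "det B = 1" using A by (simp add: iff)
  moreover have "quaternionic B" using quaternionic_left_inverse[OF _ B(2,1)] A iff by blast
  ultimately show "\<exists>B\<in>G0. A ** B = mat 1 \<and> B ** A = mat 1" using B iff by blast
qed

lemma G0_quaternionic: "X \<in> G0 \<Longrightarrow> quaternionic X"
  by (simp add: G0_def quaternionic_def)

lemma swap_inject: "swap a = swap b \<longleftrightarrow> a = b"
  by (metis swap_swap)

lemma det_affine_polynomial: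
  fixes A B :: "complex^'n^'n::finite"
  shows "\<exists>p. \<forall>t. poly p t = det (\<chi> i j. A $ i $ j + t * B $ i $ j)"
proof (intro exI allI)
  fix t
  show "poly (\<Sum>\<sigma> | \<sigma> permutes UNIV. of_int (sign \<sigma>) * (\<Prod>i\<in>UNIV. [:A $ i $ \<sigma> i, B $ i $ \<sigma> i:])) t
      = det (\<chi> i j. A $ i $ j + t * B $ i $ j)"
    by (simp add: det_def poly_sum poly_prod)
qed

definition transversal :: "nat \<Rightarrow> ('m::finite + 'm) flag \<Rightarrow> bool" where
  "transversal r V \<longleftrightarrow> (\<forall>i k. i + k + 2 = r \<longrightarrow> V ! i \<inter> jmap ` (V ! k) = {0})"

lemma transversal_act_G0:
  assumes X: "X \<in> G0" and V: "transversal r V" and len: "length V = r"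
  shows "transversal r (act X V)"
  unfolding transversal_def
proof (intro allI impI)
  fix i k assume ik: "i + k + 2 = r"
  then have disj: "V ! i \<inter> jmap ` (V ! k) = {0}" using V unfolding transversal_def by blast
  have inj: "inj ((*v) X)"
    by (rule inj_matrix_vector_mult[OF matrix_group_invertible[OF matrix_group_G0 X]])
  have quat: "jmap (X *v v) = X *v jmap v" for v using G0_quaternionic[OF X] by (simp add: quaternionic_def)
  have "act X V ! i \<inter> jmap ` (act X V ! k) = (*v) X ` (V ! i) \<inter> (*v) X ` (jmap ` (V ! k))"
    using ik len by (simp add: act_nth image_image quat)
  also have "\<dots> = (*v) X ` (V ! i \<inter> jmap ` (V ! k))" by (rule image_Int[OF inj, symmetric])
  finally show "act X V ! i \<inter> jmap ` (act X V ! k) = {0}" unfolding disj by simp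
qed

text \<open>Transversality is a dense condition: along a segment from any flag to a balanced coordinate
  flag it fails at most at the zeros of finitely many nonzero polynomials.\<close>

lemma open_meets_transversal:
  fixes b :: "'m::finite + 'm \<Rightarrow> nat" and U :: "('m + 'm) flag set"
  assumes b: "fits c b" and bal: "balanced (length c) b"
    and U: "openin (flag_topology c) U" and V: "V \<in> U"
  shows "\<exists>V'\<in>U. transversal (length c) V'"
proof -
  let ?r = "length c"
  let ?E = "coord_flag ?r b"
  have "V \<in> flag_manifold c" using U V unfolding openin_flag_topology by blast
  then obtain g where g: "invertible g" "V = act g ?E" using flag_manifold_transitive[OF _ b] by blast
  define B where "B = mat 1 - g"
  define X where "X t = (\<chi> k a. g $ k $ a + of_real t * B $ k $ a)" for t :: real
  have Xn: "X t $ k $ a = g $ k $ a + of_real t * B $ k $ a" for t k a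
    by (simp add: X_def)
  define P where "P = orbit_preimage ?E U"
  have "open P" unfolding P_def using U coord_flag_in_manifold[OF b] by (simp add: openin_flag_topology)
  have X0: "X 0 = g" "X 1 = mat 1" by (simp_all add: vec_eq_iff Xn B_def)
  have "of_matrix (X 0) \<in> P" unfolding P_def using g V by (simp add: orbit_preimage_def X0)
  moreover have "((\<lambda>t. of_matrix (X t)) \<longlongrightarrow> of_matrix (X 0)) (at 0)"
    unfolding of_matrix_def Xn by (intro tendsto_intros tendsto_eq_intros) auto
  ultimately have ev: "\<forall>\<^sub>F t in at 0. of_matrix (X t) \<in> P"
    using topological_tendstoD[OF _ \<open>open P\<close>] by blast
  \<comment> \<open>The columns are a basis of step \<open>i\<close> followed by the
    \<open>jmap\<close>-image of a basis of the complementary step, so a nonzero determinant means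
    transversality. Since \<open>t\<close> is real, the conjugated entries are still affine in
    \<open>t\<close>.\<close>
  define M where "M i t = (\<chi> k a. if b a \<le> i then X t $ k $ a else jmap (X t *v axis (swap a) 1) $ k)" for i t
  have ex: "\<exists>p. p \<noteq> 0 \<and> (\<forall>t. poly p (of_real t) = det (M i t))" for i
  proof -
    define M0 where "M0 = (\<chi> k a. if b a \<le> i then g $ k $ a else tau k * cnj (g $ swap k $ swap a))"
    define M1 where "M1 = (\<chi> k a. if b a \<le> i then B $ k $ a else tau k * cnj (B $ swap k $ swap a))"
    have M: "M i t = (\<chi> k a. M0 $ k $ a + of_real t * M1 $ k $ a)" for t
      by (simp add: M_def M0_def M1_def Xn vec_eq_iff jmap_nth algebra_simps)
    obtain p where p: "\<And>z. poly p z = det (\<chi> k a. M0 $ k $ a + z * M1 $ k $ a)"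
      using det_affine_polynomial[of M0 M1] by blast
    \<comment> \<open>At \<open>t = 1\<close> the matrix \<open>X t\<close> is the identity and the
      columns are basis vectors up to sign, so the polynomial is not zero.\<close>
    have "det (M i 1) = (\<Prod>a\<in>UNIV. M i 1 $ a $ a)"
      by (rule det_diagonal) (auto simp: M_def X0 mat_def jmap_nth swap_inject)
    also have "\<dots> \<noteq> 0" by (simp add: M_def X0 mat_def jmap_nth)
    finally have "poly p (of_real 1) \<noteq> 0" unfolding p M .
    then have "p \<noteq> 0" by auto
    then show ?thesis using p M by (intro exI[of _ p]) simp
  qed
  define bad where "bad = (\<Union>i<?r. {t. det (M i t) = 0})"
  have "finite {t. det (M i t) = 0}" for i
  proof -
    obtain p where p: "p \<noteq> 0" "\<And>t. poly p (of_real t) = det (M i t)" using ex by blast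
    have "finite (of_real -` {z. poly p z = 0} :: real set)"
      by (rule finite_vimageI) (use p(1) poly_roots_finite in \<open>auto simp: inj_on_def\<close>)
    then show ?thesis by (simp add: p vimage_def)
  qed
  then have "finite bad" unfolding bad_def by blast
  obtain e where e: "e > 0" "\<forall>t\<in>UNIV. t \<noteq> 0 \<and> dist t 0 < e \<longrightarrow> of_matrix (X t) \<in> P"
    using ev unfolding eventually_at by (elim exE conjE)
  have "infinite {0<..<e}" using e(1) by simp
  then have "\<not> {0<..<e} \<subseteq> bad" using \<open>finite bad\<close> finite_subset by blast
  then obtain t where "t \<in> {0<..<e}" "t \<notin> bad" by blast
  then have t: "0 < t" "t < e" "t \<notin> bad" by simp_all
  then have XP: "of_matrix (X t) \<in> P" using e(2) by (simp add: dist_real_def)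
  then have mem: "act (X t) ?E \<in> U" by (simp add: P_def orbit_preimage_def)
  moreover have "transversal ?r (act (X t) ?E)"
    unfolding transversal_def
  proof (intro allI impI equalityI subsetI)
    fix i k y assume ik: "i + k + 2 = ?r" and y: "y \<in> act (X t) ?E ! i \<inter> jmap ` (act (X t) ?E ! k)"
    have lens: "i < ?r" "k < ?r" using ik by auto
    obtain u where u: "u \<in> coord_space {a. b a \<le> i}" "y = X t *v u"
      using y lens by (auto simp: act_nth coord_flag_nth)
    obtain w where w: "w \<in> coord_space {a. b a \<le> k}" "y = jmap (X t *v w)"
      using y lens by (auto simp: act_nth coord_flag_nth)
    \<comment> \<open>The coefficients, in the columns of \<open>M i t\<close>, of the relation that
      says that both descriptions of \<open>y\<close> agree; the conjugate comes from
      \<open>jmap\<close> being conjugate linear.\<close>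
    define x where "x = (\<chi> a. if b a \<le> i then u $ a else - cnj (w $ swap a))"
    have Xa: "X t *v v = (\<Sum>a\<in>UNIV. v $ a *s (X t *v axis a 1))" for v
    proof -
      have "column_matrix (\<lambda>a. X t *v axis a 1) = X t" by (simp add: column_matrix_def vec_eq_iff)
      then show ?thesis using column_matrix_mult[of "\<lambda>a. X t *v axis a 1" v] by simp
    qed
    have "M i t *v x = (\<Sum>a\<in>UNIV. x $ a *s (if b a \<le> i then X t *v axis a 1 else jmap (X t *v axis (swap a) 1)))"
    proof -
      have "M i t = column_matrix (\<lambda>a. if b a \<le> i then X t *v axis a 1 else jmap (X t *v axis (swap a) 1))"
        by (simp add: M_def column_matrix_def vec_eq_iff)
      then show ?thesis by (simp only: column_matrix_mult)
    qed
    also have "\<dots> = (\<Sum>a\<in>UNIV. u $ a *s (X t *v axis a 1) - jmap (w $ swap a *s (X t *v axis (swap a) 1)))"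
    proof (rule sum.cong[OF refl])
      fix a
      have "b a \<le> i \<longleftrightarrow> \<not> b (swap a) \<le> k" using balanced_sum[OF bal, of a] ik by linarith
      then show "x $ a *s (if b a \<le> i then X t *v axis a 1 else jmap (X t *v axis (swap a) 1))
          = u $ a *s (X t *v axis a 1) - jmap (w $ swap a *s (X t *v axis (swap a) 1))"
        using u(1) w(1) by (cases "b a \<le> i") (simp_all add: x_def coord_space_def jmap_scale)
    qed
    also have "\<dots> = y - (\<Sum>a\<in>UNIV. jmap (w $ swap a *s (X t *v axis (swap a) 1)))"
      unfolding u(2) by (simp add: sum_subtractf Xa[of u])
    also have "(\<Sum>a\<in>UNIV. jmap (w $ swap a *s (X t *v axis (swap a) 1))) = (\<Sum>a\<in>UNIV. jmap (w $ a *s (X t *v axis a 1)))"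
      by (rule sum_UNIV_swap)
    also have "\<dots> = y" unfolding w(2) Xa[of w] by (rule linear_sum[OF linear_jmap, symmetric])
    finally have "M i t *v x = 0" by simp
    moreover have "invertible (M i t)" using t(3) lens unfolding bad_def by (auto simp: invertible_det_nz)
    ultimately have x0: "x = 0" unfolding invertible_iff_ker by blast
    have "u = 0"
    proof (rule vec_eq_iff[THEN iffD2], rule allI)
      fix a
      show "u $ a = 0 $ a"
        using arg_cong[OF x0, of "\<lambda>x. x $ a"] u(1) by (cases "b a \<le> i") (simp_all add: x_def coord_space_def)
    qed
    then show "y \<in> {0}" unfolding u(2) by simp
  next
    fix i k y assume ik: "i + k + 2 = ?r" and y: "y \<in> {0 :: complex^('m + 'm)}"
    have lens: "i < ?r" "k < ?r" using ik by auto
    have E: "act (X t) ?E \<in> flag_manifold c" using mem U unfolding openin_flag_topology by blast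
    have "0 \<in> act (X t) ?E ! i" "0 \<in> act (X t) ?E ! k"
      using vec.subspace_0[OF flag_subspace[OF E]] lens by auto
    then show "y \<in> act (X t) ?E ! i \<inter> jmap ` (act (X t) ?E ! k)" using y image_eqI[of 0 jmap 0] by simp
  qed
  ultimately show ?thesis by blast
qed

lemma open_orbit_transversal:
  fixes b :: "'m::finite + 'm \<Rightarrow> nat" and D :: "('m + 'm) flag set"
  assumes b: "fits c b" and bal: "balanced (length c) b" and D: "is_open_orbit c D" and V: "V \<in> D"
  shows "transversal (length c) V"
proof -
  obtain V0 where V0: "V0 \<in> flag_manifold c" "D = orbit G0 V0" and op: "openin (flag_topology c) D"
    using D unfolding is_open_orbit_def by blast
  obtain V' where V': "V' \<in> D" "transversal (length c) V'"
    using open_meets_transversal[OF b bal op V] by blast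
  have "V \<in> orbit G0 V'" using orbit_eq[OF matrix_group_G0, of V' V0] V' V V0 by simp
  then obtain X where X: "X \<in> G0" "V = act X V'" unfolding orbit_def by blast
  have "V' \<in> flag_manifold c" using V' op unfolding openin_flag_topology by blast
  then show ?thesis unfolding X(2) using transversal_act_G0[OF X(1) V'(2)] flag_length by metis
qed

text \<open>Transversality on \<open>D\<close> excludes the value 1 in
  \<open>base_cycle_orthogonal\<close>, so a member of the cycle is isotropic. Since
  \<open>K0\<close> acts transitively on the isotropic flags, its orbit is all of them.\<close>

lemma base_cycle_isotropic:
  fixes b :: "'m::finite + 'm \<Rightarrow> nat" and D C :: "('m + 'm) flag set"
  assumes b: "fits c b" and bal: "balanced (length c) b" and D: "is_open_orbit c D"
    and C: "is_base_cycle c D C"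
  shows "C = {V \<in> flag_manifold c. isotropic (length c) V}" "\<exists>d. flag_submanifold c d C"
proof -
  let ?r = "length c"
  obtain V d where V: "V \<in> D" "C = orbit K0 V" and d: "flag_submanifold c d C"
    using C unfolding is_base_cycle_def by blast
  show "\<exists>d. flag_submanifold c d C" using d by blast
  have VC: "V \<in> C" unfolding V(2) by (rule orbit_refl[OF matrix_group_K0])
  then have VZ: "V \<in> flag_manifold c" using d unfolding flag_submanifold_def by blast
  have tr: "transversal ?r V" by (rule open_orbit_transversal[OF b bal D V(1)])
  have isoV: "isotropic ?r V"
    unfolding isotropic_def
  proof (intro allI impI ballI)
    fix i k x y assume ik: "i + k + 2 \<le> ?r" and x: "x \<in> V ! i" and y: "y \<in> V ! k"
    \<comment> \<open>The index complementary to \<open>i\<close>; the condition for smaller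
      \<open>k\<close> follows because \<open>V ! k\<close> is contained in
      \<open>V ! l\<close>.\<close>
    define l where "l = ?r - 2 - i"
    have l: "i + l + 2 = ?r" "k \<le> l" "l < ?r" "i < ?r" using ik by (auto simp: l_def)
    have "y \<in> V ! l" using flag_mono[OF VZ l(2,3)] y by blast
    moreover have "V ! i \<inter> jmap ` (V ! l) = {0}" using tr l(1) unfolding transversal_def by blast
    ultimately show "herm x (jmap y) = 0"
      using base_cycle_orthogonal[OF d[unfolded V(2)] l(4,3) _ x] by blast
  qed
  obtain K where K: "K \<in> K0" "act K (coord_flag ?r b) = V" using K0_transitive[OF VZ isoV b bal] by blast
  then have "V \<in> orbit K0 (coord_flag ?r b)" unfolding orbit_def by blast
  then have CE: "C = orbit K0 (coord_flag ?r b)" unfolding V(2) by (rule orbit_eq[OF matrix_group_K0])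
  show "C = {V \<in> flag_manifold c. isotropic ?r V}"
  proof (intro equalityI subsetI)
    fix W :: "('m + 'm) flag" assume W: "W \<in> C"
    then obtain K where "K \<in> K0" "W = act K (coord_flag ?r b)" unfolding CE orbit_def by blast
    then have "isotropic ?r W" using isotropic_act_K0[OF _ coord_flag_isotropic[OF bal]] by simp
    moreover have "W \<in> flag_manifold c" using W d unfolding flag_submanifold_def by blast
    ultimately show "W \<in> {V \<in> flag_manifold c. isotropic ?r V}" by simp
  next
    fix W :: "('m + 'm) flag" assume "W \<in> {V \<in> flag_manifold c. isotropic ?r V}"
    then obtain K where "K \<in> K0" "act K (coord_flag ?r b) = W" using K0_transitive[OF _ _ b bal] by blast
    then show "W \<in> C" unfolding CE orbit_def by blast
  qed
qed

lemma cdim_base_cycle: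
  fixes b q :: "'m::finite + 'm \<Rightarrow> nat" and D C :: "('m + 'm) flag set"
  assumes b: "fits c b" and bal: "balanced (length c) b" and D: "is_open_orbit c D"
    and C: "is_base_cycle c D C" and q: "numbering q"
  shows "cdim c C + pair_count q b (length c) = cdim c (flag_manifold c :: ('m + 'm) flag set)"
proof -
  let ?E = "coord_flag (length c) b"
  obtain d where d: "flag_submanifold c d C" using base_cycle_isotropic(2)[OF b bal D C] by blast
  obtain V where V: "V \<in> D" "C = orbit K0 V" using C unfolding is_base_cycle_def by blast
  have EC: "?E \<in> C"
    unfolding base_cycle_isotropic(1)[OF b bal D C]
    using coord_flag_in_manifold[OF b] coord_flag_isotropic[OF bal] by simp
  have "C = orbit K0 ?E" using orbit_eq[OF matrix_group_K0, of ?E V] EC V(2) by simp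
  then have "d + stab_dim b + pair_count q b (length c) = CARD('m + 'm)\<^sup>2"
    using base_cycle_dim[OF b bal q] d by simp
  moreover have "cdim c C = d" by (rule cdim_submanifold[OF _ d]) (use EC in blast)
  moreover have "cdim c (flag_manifold c :: ('m + 'm) flag set) + stab_dim b = CARD('m + 'm)\<^sup>2"
    by (rule cdim_flag_manifold[OF b])
  ultimately show ?thesis by linarith
qed

lemma dim_jmap_image:
  fixes W :: "(complex^('m::finite + 'm)) set"
  assumes W: "vec.subspace W"
  shows "vec.subspace (jmap ` W)" "vec.dim (jmap ` W) = vec.dim W"
proof -
  have sub: "vec.subspace (jmap ` W)" if W: "vec.subspace W" for W :: "(complex^('m + 'm)) set"
    unfolding vec.subspace_def
  proof (intro conjI ballI allI)
    show "0 \<in> jmap ` W" using vec.subspace_0[OF W] by (auto intro: image_eqI[of 0 jmap 0])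
    show "x + y \<in> jmap ` W" if "x \<in> jmap ` W" "y \<in> jmap ` W" for x y
      using that vec.subspace_add[OF W] by (auto simp: jmap_add[symmetric])
    show "k *s x \<in> jmap ` W" if xW: "x \<in> jmap ` W" for k x
    proof -
      obtain w where w: "w \<in> W" "x = jmap w" using xW by blast
      have "k *s x = jmap (cnj k *s w)" by (simp add: jmap_scale w(2))
      then show ?thesis using vec.subspace_scale[OF W w(1)] by blast
    qed
  qed
  show "vec.subspace (jmap ` W)" by (rule sub[OF W])
  have le: "vec.dim W \<le> vec.dim (jmap ` W)" if "vec.subspace W" for W :: "(complex^('m + 'm)) set"
  proof -
    obtain S where S: "S \<subseteq> jmap ` W" "vec.independent S" "jmap ` W \<subseteq> vec.span S" "card S = vec.dim (jmap ` W)"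
      by (rule vec.basis_exists)
    have "W \<subseteq> vec.span (jmap ` S)"
    proof
      fix w assume "w \<in> W"
      then have "jmap w \<in> vec.span S" using S(3) by blast
      moreover have "vec.span S \<subseteq> jmap ` vec.span (jmap ` S)"
      proof (rule vec.span_minimal)
        show "S \<subseteq> jmap ` vec.span (jmap ` S)"
        proof
          fix s assume "s \<in> S"
          then have "- jmap s \<in> vec.span (jmap ` S)" by (intro vec.span_neg vec.span_base imageI)
          moreover have "s = jmap (- jmap s)" by simp
          ultimately show "s \<in> jmap ` vec.span (jmap ` S)" by blast
        qed
        show "vec.subspace (jmap ` vec.span (jmap ` S))" by (rule sub) simp
      qed
      ultimately obtain z where z: "z \<in> vec.span (jmap ` S)" "jmap w = jmap z" by blast
      have "w = z" using arg_cong[OF z(2), of jmap] by simp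
      then show "w \<in> vec.span (jmap ` S)" using z(1) by simp
    qed
    moreover have "finite S" using S(2) vec.finiteI_independent by blast
    ultimately have "vec.dim W \<le> card (jmap ` S)" by (intro vec.dim_le_card) auto
    also have "\<dots> \<le> card S" by (rule card_image_le[OF \<open>finite S\<close>])
    finally show ?thesis using S(4) by simp
  qed
  have "jmap ` jmap ` W = W"
  proof -
    have "jmap ` jmap ` W = uminus ` W" by (simp add: image_image)
    also have "\<dots> = W"
    proof (intro equalityI subsetI)
      fix x assume "x \<in> W"
      then have "- x \<in> W" by (rule vec.subspace_neg[OF W])
      then show "x \<in> uminus ` W" by (intro image_eqI[of _ _ "- x"]) simp_all
    qed (use vec.subspace_neg[OF W] in blast)
    finally show ?thesis .
  qed
  then show "vec.dim (jmap ` W) = vec.dim W" using le[OF W] le[OF sub[OF W]] by simp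
qed

text \<open>By \<open>k\<close> the map \<open>jmap\<close> preserves the span of the first \<open>k\<close> coordinates, in which the
  intersections with \<open>V ! i\<close> and \<open>jmap ` (V ! l)\<close> are independent.\<close>

lemma cell_meets_transversal:
  fixes b q :: "'m::finite + 'm \<Rightarrow> nat"
  assumes q: "numbering q" and b: "fits c b" and V: "V \<in> flag_manifold c"
    and orb: "V \<in> orbit (borel_group q) (coord_flag (length c) b)" and tr: "transversal (length c) V"
    and k: "\<And>a. q (swap a) < k \<longleftrightarrow> q a < k" and il: "i + l + 2 = length c"
  shows "cell_dim q b i k + cell_dim q b l k \<le> card {a. q a < k}"
proof -
  let ?F = "coord_space {a. q a < k} :: (complex^('m + 'm)) set"
  have lens: "i < length c" "l < length c" using il by auto
  have dims: "vec.dim (V ! i \<inter> ?F) = cell_dim q b i k" "vec.dim (V ! l \<inter> ?F) = cell_dim q b l k"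
    using orb lens unfolding borel_orbit_iff[OF q b V] by blast+
  have sub: "vec.subspace (V ! i \<inter> ?F)" "vec.subspace (V ! l \<inter> ?F)"
    using flag_subspace[OF V] lens coord_space_subspace by (auto intro: vec.subspace_inter)
  let ?A = "V ! i \<inter> ?F" and ?B = "jmap ` (V ! l \<inter> ?F)"
  have jF: "jmap v \<in> ?F" if "v \<in> ?F" for v using that k by (simp add: coord_space_def jmap_nth)
  have "?A \<inter> ?B \<subseteq> {0}"
    using tr il unfolding transversal_def by blast
  then have "vec.dim (?A \<inter> ?B) = 0" by (simp only: vec.dim_eq_0)
  moreover have "{x + y |x y. x \<in> ?A \<and> y \<in> ?B} \<subseteq> ?F"
    using jF by (auto intro: vec.subspace_add[OF coord_space_subspace])
  then have "vec.dim {x + y |x y. x \<in> ?A \<and> y \<in> ?B} \<le> vec.dim ?F" by (rule vec.dim_subset)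
  ultimately show ?thesis
    using vec.dim_sums_Int[OF sub(1) dim_jmap_image(1)[OF sub(2)]] dim_jmap_image(2)[OF sub(2)]
      dims coord_space_dim[of "{a. q a < k}"] by linarith
qed

section \<open>Balanced coordinate flags\<close>

lemma exists_fibre_cards:
  assumes "finite S" "card S = sum_list cs"
  shows "\<exists>h. \<forall>i. card {x \<in> S. h x = i} = (if i < length cs then cs ! i else 0)"
  using assms
proof (induction cs arbitrary: S)
  case Nil
  then show ?case by simp
next
  case (Cons d cs)
  have "d \<le> card S" using Cons.prems by simp
  then obtain T where T: "T \<subseteq> S" "card T = d" by (rule obtain_subset_with_card_n)
  have finT: "finite T" using T(1) Cons.prems(1) finite_subset by blast
  have "card (S - T) = sum_list cs" using Cons.prems T by (simp add: card_Diff_subset[OF finT])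
  then obtain h where h: "\<And>i. card {x \<in> S - T. h x = i} = (if i < length cs then cs ! i else 0)"
    using Cons.IH[of "S - T"] Cons.prems(1) by blast
  show ?case
  proof (intro exI[of _ "\<lambda>x. if x \<in> T then 0 else Suc (h x)"] allI)
    fix i
    show "card {x \<in> S. (if x \<in> T then 0 else Suc (h x)) = i} = (if i < length (d # cs) then (d # cs) ! i else 0)"
    proof (cases i)
      case 0
      have "{x \<in> S. (if x \<in> T then 0 else Suc (h x)) = 0} = T" using T(1) by auto
      then show ?thesis using 0 T(2) by simp
    next
      case (Suc k)
      have "{x \<in> S. (if x \<in> T then 0 else Suc (h x)) = Suc k} = {x \<in> S - T. h x = k}" by auto
      then show ?thesis using Suc h[of k] by simp
    qed
  qed
qed

lemma fitsI:
  assumes "c \<noteq> []" "\<And>a. b a < length c" "\<And>i. i < length c \<Longrightarrow> card {a. b a = i} = c ! i"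
  shows "fits c (b :: 'n::finite \<Rightarrow> nat)"
  unfolding fits_def
proof (intro conjI allI impI)
  fix i assume i: "i < length c"
  have "card {a. b a \<le> i} = card (\<Union>k\<in>{..i}. {a. b a = k})" by (rule arg_cong[of _ _ card]) auto
  also have "\<dots> = (\<Sum>k\<in>{..i}. card {a. b a = k})" by (rule card_UN_disjoint) auto
  also have "\<dots> = (\<Sum>k\<in>{..<Suc i}. take (Suc i) c ! k)"
    by (rule sum.cong) (use i assms(3) in auto)
  also have "\<dots> = sum_list (take (Suc i) c)"
  proof -
    have "length (take (Suc i) c) = Suc i" using i by simp
    then show ?thesis using sum_list_sum_nth[of "take (Suc i) c"] by (simp only: atLeast0LessThan)
  qed
  finally show "card {a. b a \<le> i} = sum_list (take (Suc i) c)" .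
qed (use assms in auto)

lemma length_sym_dims: "length (sym_dims ds e) = 2 * length ds + (if e = 0 then 0 else 1)"
  by (simp add: sym_dims_def)

text \<open>The coordinates \<open>Inl x\<close> fill the first half of the blocks and half of the
  middle block, and the \<open>Inr x\<close> mirror them. The middle entry \<open>e\<close> is even
  because the sum of all entries is.\<close>

lemma exists_balanced:
  assumes sum: "sum_list (sym_dims ds e) = 2 * CARD('m::finite)"
  shows "\<exists>b :: 'm + 'm \<Rightarrow> nat. fits (sym_dims ds e) b \<and> balanced (length (sym_dims ds e)) b"
proof -
  let ?c = "sym_dims ds e"
  let ?r = "length ?c"
  define cs where "cs = ds @ (if e = 0 then [] else [e div 2])"
  have tot: "2 * sum_list ds + e = 2 * CARD('m)" using sum by (cases "e = 0") (simp_all add: sym_dims_def)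
  then have ev: "even e" by presburger
  have "card (UNIV :: 'm set) = sum_list cs" using tot ev by (auto simp: cs_def)
  then obtain h :: "'m \<Rightarrow> nat" where h: "\<And>i. card {x \<in> UNIV. h x = i} = (if i < length cs then cs ! i else 0)"
    using exists_fibre_cards[of "UNIV :: 'm set" cs] by auto
  have hl: "h x < length cs" for x
  proof (rule ccontr)
    assume "\<not> h x < length cs"
    then have "card {y \<in> UNIV. h y = h x} = 0" using h by simp
    then show False by auto
  qed
  have hr: "h x + 1 \<le> ?r" "h x \<le> ?r - 1 - h x" for x
    using hl[of x] by (auto simp: cs_def length_sym_dims split: if_splits)
  define b where "b a = (case a of Inl x \<Rightarrow> h x | Inr x \<Rightarrow> ?r - 1 - h x)" for a :: "'m + 'm"
  have bal: "balanced ?r b"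
    unfolding balanced_def
  proof
    fix a show "b a + b (swap a) + 1 = ?r"
    proof (cases a)
      case (Inl x) then show ?thesis using hr(1)[of x] by (simp add: b_def swap_def)
    next
      case (Inr x) then show ?thesis using hr(1)[of x] by (simp add: b_def swap_def)
    qed
  qed
  have "fits ?c b"
  proof (rule fitsI)
    show "?c \<noteq> []" using sum by auto
    show "b a < ?r" for a using balanced_sum[OF bal, of a] by linarith
    fix i assume i: "i < ?r"
    have split: "{a. b a = i} = Inl ` {x. h x = i} \<union> Inr ` {x. ?r - 1 - h x = i}"
    proof (intro equalityI subsetI)
      fix a assume "a \<in> {a. b a = i}"
      then show "a \<in> Inl ` {x. h x = i} \<union> Inr ` {x. ?r - 1 - h x = i}"
        by (cases a) (auto simp: b_def)
    qed (auto simp: b_def)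
    have "{x. ?r - 1 - h x = i} = {x. h x = ?r - 1 - i}"
    proof (intro Collect_cong)
      fix x show "?r - 1 - h x = i \<longleftrightarrow> h x = ?r - 1 - i" using hr(1)[of x] i by linarith
    qed
    then have "card {a. b a = i} = card {x. h x = i} + card {x. h x = ?r - 1 - i}"
      unfolding split by (subst card_Un_disjoint) (auto simp: card_image)
    also have "\<dots> = ?c ! i"
    proof (cases "e = 0")
      case True
      then have l: "length cs = length ds" "?r = 2 * length ds" "cs = ds" "?c = ds @ rev ds"
        by (simp_all add: cs_def length_sym_dims sym_dims_def)
      show ?thesis using h[of i] h[of "?r - 1 - i"] i unfolding l(2,3,4)
        by (auto simp: nth_append rev_nth not_less intro!: arg_cong[of _ _ "\<lambda>k. ds ! k"])
    next
      case False
      then have l: "?r = 2 * length ds + 1" "cs = ds @ [e div 2]" "?c = ds @ [e] @ rev ds"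
        by (simp_all add: cs_def length_sym_dims sym_dims_def)
      consider "i < length ds" | "i = length ds" | "length ds < i" by linarith
      then show ?thesis
      proof cases
        case 1
        then show ?thesis using h[of i] h[of "?r - 1 - i"] unfolding l by (simp add: nth_append)
      next
        case 2
        then show ?thesis using h[of i] h[of "?r - 1 - i"] ev unfolding l by (simp add: nth_append) presburger
      next
        case 3
        then have "2 * length ds - i = length ds - Suc (i - Suc (length ds))" by linarith
        then show ?thesis using h[of i] h[of "?r - 1 - i"] 3 i unfolding l
          by (simp add: nth_append rev_nth)
      qed
    qed
    finally show "card {a. b a = i} = ?c ! i" .
  qed
  then show ?thesis using bal by blast
qed

section \<open>Counting inversions\<close>

text \<open>The letters \<open>2k\<close> and \<open>2k + 1\<close>, for \<open>k < m\<close>, carry the integer weights \<open>x (2k)\<close> and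
  \<open>x (2k + 1)\<close>. Adding one pair of letters at a time changes the number of inversions minus the
  number of pairs with negative sum by the imbalances of the smaller letters at the new weights.\<close>

definition inv_upto :: "(nat \<Rightarrow> int) \<Rightarrow> nat \<Rightarrow> int" where
  "inv_upto x n = int (card {(l, l'). l < l' \<and> l' < n \<and> x l' < x l})"

definition neg_upto :: "(nat \<Rightarrow> int) \<Rightarrow> nat \<Rightarrow> int" where
  "neg_upto x n = int (card {(l, l'). l < l' \<and> l' < n \<and> x l + x l' < 0})"

definition imbalance :: "(nat \<Rightarrow> int) \<Rightarrow> nat \<Rightarrow> int \<Rightarrow> int" where
  "imbalance x n t = int (card {l. l < n \<and> t \<le> x l}) - int (card {l. l < n \<and> x l \<le> - t})"

lemma card_pairs_Suc:
  "card {(l, l'). l < l' \<and> l' < Suc n \<and> P l l'} = card {(l, l'). l < l' \<and> l' < n \<and> P l l'} + card {l. l < n \<and> P l n}"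
proof -
  have fin: "finite {(l, l'). l < l' \<and> l' < n \<and> P l l'}"
    by (rule finite_subset[of _ "{..<n} \<times> {..<n}"]) auto
  have "{(l, l'). l < l' \<and> l' < Suc n \<and> P l l'} = {(l, l'). l < l' \<and> l' < n \<and> P l l'} \<union> (\<lambda>l. (l, n)) ` {l. l < n \<and> P l n}"
    by (auto simp: less_Suc_eq)
  moreover have "card ({(l, l'). l < l' \<and> l' < n \<and> P l l'} \<union> (\<lambda>l. (l, n)) ` {l. l < n \<and> P l n})
      = card {(l, l'). l < l' \<and> l' < n \<and> P l l'} + card ((\<lambda>l. (l, n)) ` {l. l < n \<and> P l n})"
    by (rule card_Un_disjoint) (use fin in auto)
  moreover have "card ((\<lambda>l. (l, n)) ` {l. l < n \<and> P l n}) = card {l. l < n \<and> P l n}"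
    by (rule card_image) (auto simp: inj_on_def)
  ultimately show ?thesis by (simp only:)
qed

lemma card_letters_Suc:
  "card {l. l < Suc n \<and> P l} = card {l. l < n \<and> P l} + (if P n then 1 else 0)"
proof (cases "P n")
  case True
  then have "{l. l < Suc n \<and> P l} = insert n {l. l < n \<and> P l}" by (auto simp: less_Suc_eq)
  then show ?thesis using True by simp
next
  case False
  then have "{l. l < Suc n \<and> P l} = {l. l < n \<and> P l}" by (auto simp: less_Suc_eq)
  then show ?thesis using False by simp
qed

lemma imbalance_Suc:
  "imbalance x (Suc n) t = imbalance x n t + (if t \<le> x n then 1 else 0) - (if x n \<le> - t then 1 else 0)"
  unfolding imbalance_def card_letters_Suc by simp

text \<open>The left side is the change of inversions minus pairs of negative sum when a letter of
  weight \<open>y\<close> is appended. For \<open>y < 0\<close> both counts are replaced by those of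
  the complementary letters; in either case the threshold on the right is positive.\<close>

lemma excess_eq_imbalance:
  "int (card {l. l < n \<and> y < x l}) - int (card {l. l < n \<and> x l + y < 0}) =
    imbalance x n (if y < 0 then - y else y + 1)"
proof (induction n)
  case (Suc n)
  then show ?case unfolding card_letters_Suc imbalance_Suc by (auto split: if_splits)
qed (simp add: imbalance_def)

definition excess :: "(nat \<Rightarrow> int) \<Rightarrow> nat \<Rightarrow> int" where
  "excess x n = inv_upto x n - neg_upto x n"

lemma excess_step:
  fixes x :: "nat \<Rightarrow> int" and n :: nat
  defines "y \<equiv> x n" and "z \<equiv> x (Suc n)"
  shows "excess x (Suc (Suc n)) = excess x n + imbalance x n (if y < 0 then - y else y + 1)
    + imbalance x n (if z < 0 then - z else z + 1) + (if z < y then 1 else 0) - (if y + z < 0 then 1 else 0)"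
  unfolding excess_def inv_upto_def neg_upto_def card_pairs_Suc card_letters_Suc
    excess_eq_imbalance[symmetric] y_def z_def by simp

lemma excess_0 [simp]: "excess x 0 = 0" "imbalance x 0 t = 0"
  by (simp_all add: excess_def inv_upto_def neg_upto_def imbalance_def)

text \<open>A loss is possible only if the two new weights have negative sum. Then the imbalances
  after the step would be negative unless those before it were large, and this earlier surplus
  outweighs the loss. With nonnegative sum, a zero change leaves no room for an inversion inside the
  pair.\<close>

lemma excess_step_cases:
  assumes n: "\<And>t. 0 < t \<Longrightarrow> 0 \<le> imbalance x n t"
    and n2: "\<And>t. 0 < t \<Longrightarrow> 0 \<le> imbalance x (Suc (Suc n)) t"
  shows "excess x n \<le> excess x (Suc (Suc n))"
    "excess x (Suc (Suc n)) = excess x n \<Longrightarrow> 0 \<le> x n + x (Suc n) \<and> x n \<le> x (Suc n)"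
proof -
  let ?y = "x n" and ?z = "x (Suc n)"
  let ?gy = "imbalance x n (if ?y < 0 then - ?y else ?y + 1)"
  let ?gz = "imbalance x n (if ?z < 0 then - ?z else ?z + 1)"
  have g: "0 \<le> ?gy" "0 \<le> ?gz" using n by auto
  have im: "imbalance x (Suc (Suc n)) t = imbalance x n t + (if t \<le> ?y then 1 else 0) - (if ?y \<le> - t then 1 else 0)
      + (if t \<le> ?z then 1 else 0) - (if ?z \<le> - t then 1 else 0)" for t
    unfolding imbalance_Suc by simp
  have "2 \<le> ?gy + ?gz + (if ?z < ?y then 1 else 0)" if neg: "?y + ?z < 0"
  proof (cases "?y \<le> ?z")
    case True
    show ?thesis
    proof (cases "?z < 0")
      case z: True
      \<comment> \<open>At the threshold \<open>- ?z\<close> both new letters count negatively, so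
        the imbalance drops by 2 and must have been at least 2 before.\<close>
      then have "2 \<le> imbalance x n (- ?z)" using n2[of "- ?z"] im[of "- ?z"] True by auto
      then show ?thesis using g True z by auto
    next
      case False
      have "1 \<le> imbalance x n (?z + 1)" using n2[of "?z + 1"] im[of "?z + 1"] False neg by auto
      moreover have "1 \<le> imbalance x n (- ?y)" using n2[of "- ?y"] im[of "- ?y"] False neg by (auto split: if_splits)
      ultimately show ?thesis using False neg by auto
    qed
  next
    case False
    then have "1 \<le> imbalance x n (- ?z)" using n2[of "- ?z"] im[of "- ?z"] neg by (auto split: if_splits)
    then show ?thesis using g False neg by auto
  qed
  then show "excess x n \<le> excess x (Suc (Suc n))"
    "excess x (Suc (Suc n)) = excess x n \<Longrightarrow> 0 \<le> ?y + ?z \<and> ?y \<le> ?z"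
    using g unfolding excess_step by (auto split: if_splits)
qed

lemma excess_nonneg_aux:
  assumes im: "\<And>k t. k \<le> m \<Longrightarrow> 0 < t \<Longrightarrow> 0 \<le> imbalance x (2 * k) t"
  shows "0 \<le> excess x (2 * m) \<and>
    (excess x (2 * m) = 0 \<longrightarrow> (\<forall>k<m. 0 \<le> x (2 * k) + x (Suc (2 * k)) \<and> x (2 * k) \<le> x (Suc (2 * k))))"
  using im
proof (induction m)
  case (Suc m)
  have IH: "0 \<le> excess x (2 * m)"
    "excess x (2 * m) = 0 \<Longrightarrow> \<forall>k<m. 0 \<le> x (2 * k) + x (Suc (2 * k)) \<and> x (2 * k) \<le> x (Suc (2 * k))"
    using Suc.IH Suc.prems by auto
  have im0: "0 \<le> imbalance x (2 * m) t" "0 \<le> imbalance x (Suc (Suc (2 * m))) t" if "0 < t" for t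
    using Suc.prems[of m t] Suc.prems[of "Suc m" t] that by simp_all
  note step = excess_step_cases[OF im0]
  have eq: "2 * Suc m = Suc (Suc (2 * m))" by simp
  show ?case
    unfolding eq
  proof (intro conjI impI allI)
    show "0 \<le> excess x (Suc (Suc (2 * m)))" using IH(1) step(1) by linarith
    fix k assume z: "excess x (Suc (Suc (2 * m))) = 0" and k: "k < Suc m"
    have e0: "excess x (2 * m) = 0" using IH(1) step(1) z by linarith
    then have "0 \<le> x (2 * m) + x (Suc (2 * m)) \<and> x (2 * m) \<le> x (Suc (2 * m))" using step(2) z by simp
    then show "0 \<le> x (2 * k) + x (Suc (2 * k))" "x (2 * k) \<le> x (Suc (2 * k))"
      using IH(2)[OF e0] k by (cases "k = m"; simp)+
  qed
qed simp

text \<open>Zero excess makes each pair sum nonnegative; since all weights sum to zero, each pair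
  sum is zero.\<close>

lemma excess_zero_imp_paired:
  assumes im: "\<And>k t. k \<le> m \<Longrightarrow> 0 < t \<Longrightarrow> 0 \<le> imbalance x (2 * k) t"
    and sum: "(\<Sum>l<2 * m. x l) = 0" and ex: "excess x (2 * m) = 0" and k: "k < m"
  shows "x (2 * k) + x (Suc (2 * k)) = 0 \<and> x (2 * k) \<le> x (Suc (2 * k))"
proof -
  have all: "\<forall>k<m. 0 \<le> x (2 * k) + x (Suc (2 * k)) \<and> x (2 * k) \<le> x (Suc (2 * k))"
    using excess_nonneg_aux[OF im] ex by blast
  have "(\<Sum>l<2 * m. x l) = (\<Sum>k<m. x (2 * k) + x (Suc (2 * k)))" by (induction m) simp_all
  then have "(\<Sum>k<m. x (2 * k) + x (Suc (2 * k))) = 0" using sum by simp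
  then have "x (2 * k) + x (Suc (2 * k)) = 0"
    using sum_nonneg_eq_0_iff[of "{..<m}" "\<lambda>k. x (2 * k) + x (Suc (2 * k))"] all k by auto
  then show ?thesis using all k by blast
qed

lemma paired_imp_excess_zero:
  assumes "\<And>k. k < m \<Longrightarrow> x (2 * k) + x (Suc (2 * k)) = 0 \<and> x (2 * k) \<le> x (Suc (2 * k))"
  shows "excess x (2 * m) = 0 \<and> (\<forall>t. imbalance x (2 * m) t = 0)"
  using assms
proof (induction m)
  case (Suc m)
  have IH: "excess x (2 * m) = 0" "\<And>t. imbalance x (2 * m) t = 0" using Suc by auto
  have p: "x (2 * m) + x (Suc (2 * m)) = 0" "x (2 * m) \<le> x (Suc (2 * m))" using Suc.prems[of m] by auto
  have eq: "2 * Suc m = Suc (Suc (2 * m))" by simp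
  show ?case unfolding eq excess_step imbalance_Suc using IH p by (auto split: if_splits)
qed simp

section \<open>The numbering of the coordinates\<close>

definition position :: "'m::{finite,linorder} \<Rightarrow> nat" where
  "position i = card {k. k < i}"

text \<open>The place of a coordinate in the Iwasawa basis, counted from 0. The letters of words
  start at 1, so the coordinate \<open>a\<close> belongs to the letter
  \<open>Suc (letter a)\<close>.\<close>

definition letter :: "'m::{finite,linorder} + 'm \<Rightarrow> nat" where
  "letter a = (case a of Inl i \<Rightarrow> 2 * position i | Inr i \<Rightarrow> Suc (2 * position i))"

lemma position_less_iff: "position i < position k \<longleftrightarrow> i < (k :: 'm::{finite,linorder})"
proof -
  have *: "position i < position k" if "i < k" for i k :: 'm
    unfolding position_def by (rule psubset_card_mono) (use that in \<open>auto intro: less_trans\<close>)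
  show ?thesis using *[of i k] *[of k i] by (metis linorder_neqE less_asym less_irrefl)
qed

lemma bij_position: "bij_betw position (UNIV :: 'm::{finite,linorder} set) {..<CARD('m)}"
proof -
  have inj: "inj (position :: 'm \<Rightarrow> nat)"
    by (rule injI) (metis linorder_neqE position_less_iff less_irrefl)
  have "position i < CARD('m)" for i :: 'm
    unfolding position_def by (rule psubset_card_mono) auto
  then have "range (position :: 'm \<Rightarrow> nat) \<subseteq> {..<CARD('m)}" by blast
  then have "range (position :: 'm \<Rightarrow> nat) = {..<CARD('m)}"
    using card_image[OF inj] by (intro card_subset_eq) auto
  then show ?thesis using inj by (simp add: bij_betw_def)
qed

lemma numbering_letter: "numbering (letter :: 'm::{finite,linorder} + 'm \<Rightarrow> nat)"
proof -
  have r: "inj (position :: 'm \<Rightarrow> nat)" "\<And>i :: 'm. position i < CARD('m)"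
    using bij_position by (auto simp: bij_betw_def)
  have inj: "inj (letter :: 'm + 'm \<Rightarrow> nat)"
  proof (rule injI)
    fix a b :: "'m + 'm" assume eq: "letter a = letter b"
    show "a = b"
    proof (cases a; cases b)
      fix i k assume "a = Inl i" "b = Inr k" then show "a = b" using eq unfolding letter_def by simp presburger
    next
      fix i k assume "a = Inr i" "b = Inl k" then show "a = b" using eq unfolding letter_def by simp presburger
    qed (use eq r(1) in \<open>auto simp: letter_def dest: injD\<close>)
  qed
  have "letter a < CARD('m + 'm)" for a :: "'m + 'm"
  proof (cases a)
    case (Inl i) then show ?thesis using r(2)[of i] by (simp add: letter_def)
  next
    case (Inr i) then show ?thesis using r(2)[of i] by (simp add: letter_def)
  qed
  then have "range (letter :: 'm + 'm \<Rightarrow> nat) \<subseteq> {..<CARD('m + 'm)}" by blast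
  then have "range (letter :: 'm + 'm \<Rightarrow> nat) = {..<CARD('m + 'm)}"
    using card_image[OF inj] by (intro card_subset_eq) auto
  then show ?thesis using inj by (simp add: numbering_def bij_betw_def)
qed

lemma letter_swap_less: "letter (swap a) < 2 * k \<longleftrightarrow> letter a < 2 * k"
  by (cases a) (auto simp: letter_def swap_def)

text \<open>Block indices centred at the middle of the word and doubled to stay integral: opposite
  blocks get opposite weights, and the condition \<open>b a + b a' + 2 \<le> r\<close> becomes a
  negative sum.\<close>

definition weight :: "nat \<Rightarrow> ('m::{finite,linorder} + 'm \<Rightarrow> nat) \<Rightarrow> nat \<Rightarrow> int" where
  "weight r b l = 2 * int (b (the_inv letter l)) + 1 - int r"

lemma inj_letter: "inj (letter :: 'm::{finite,linorder} + 'm \<Rightarrow> nat)"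
  using numbering_letter unfolding numbering_def bij_betw_def by blast

lemma the_inv_letter [simp]: "the_inv letter (letter a) = a"
  by (rule the_inv_f_f[OF inj_letter])

lemma weight_letter [simp]: "weight r b (letter a) = 2 * int (b a) + 1 - int r"
  by (simp add: weight_def)

lemma letter_surj:
  assumes "l < CARD('m + 'm)" obtains a :: "'m::{finite,linorder} + 'm" where "l = letter a"
proof -
  have "l \<in> range (letter :: 'm + 'm \<Rightarrow> nat)"
    using numbering_letter assms unfolding numbering_def bij_betw_def by auto
  then show ?thesis using that by blast
qed

lemma letter_bound: "letter (a :: 'm::{finite,linorder} + 'm) < CARD('m + 'm)"
  using numbering_letter unfolding numbering_def bij_betw_def by auto

lemma letter_eq_iff: "letter a = letter b \<longleftrightarrow> a = b"
  using inj_letter by (auto dest: injD)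

lemma card_letter_pairs:
  fixes P :: "'m::{finite,linorder} + 'm \<Rightarrow> 'm + 'm \<Rightarrow> bool"
  shows "card {(a, a'). letter a < letter a' \<and> P a a'} =
    card {(l, l'). l < l' \<and> l' < CARD('m + 'm) \<and> P (the_inv letter l) (the_inv letter l')}"
proof (rule bij_betw_same_card[of "map_prod letter letter"])
  show "bij_betw (map_prod letter letter) {(a, a'). letter a < letter a' \<and> P a a'}
    {(l, l'). l < l' \<and> l' < CARD('m + 'm) \<and> P (the_inv letter l) (the_inv letter l' :: 'm + 'm)}"
    unfolding bij_betw_def
  proof
    show "inj_on (map_prod letter letter) {(a, a'). letter a < letter a' \<and> P a a'}"
      by (auto simp: inj_on_def letter_eq_iff)
    show "map_prod letter letter ` {(a, a'). letter a < letter a' \<and> P a a'} =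
      {(l, l'). l < l' \<and> l' < CARD('m + 'm) \<and> P (the_inv letter l) (the_inv letter l' :: 'm + 'm)}" (is "?L = ?R")
    proof (intro equalityI subsetI)
      fix p assume "p \<in> ?L"
      then show "p \<in> ?R" using letter_bound by auto
    next
      fix p assume p: "p \<in> ?R"
      obtain l l' where pl: "p = (l, l')" by (cases p)
      have l: "l < l'" "l' < CARD('m + 'm)" "P (the_inv letter l) (the_inv letter l')" using p pl by auto
      obtain a :: "'m + 'm" where a: "l = letter a" by (rule letter_surj[OF order.strict_trans[OF l(1,2)]])
      obtain a' :: "'m + 'm" where a': "l' = letter a'" by (rule letter_surj[OF l(2)])
      have "(a, a') \<in> {(a, a'). letter a < letter a' \<and> P a a'}" using l unfolding a a' by simp
      then show "p \<in> ?L" unfolding pl a a' by (intro image_eqI[of _ _ "(a, a')"]) auto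
    qed
  qed
qed

lemma card_letters:
  assumes "n \<le> CARD('m + 'm)"
  shows "card {a :: 'm::{finite,linorder} + 'm. letter a < n \<and> P a} = card {l. l < n \<and> P (the_inv letter l)}"
proof (rule bij_betw_same_card[of letter])
  show "bij_betw letter {a :: 'm + 'm. letter a < n \<and> P a} {l. l < n \<and> P (the_inv letter l)}"
    unfolding bij_betw_def
  proof
    show "letter ` {a :: 'm + 'm. letter a < n \<and> P a} = {l. l < n \<and> P (the_inv letter l)}"
    proof (intro equalityI subsetI)
      fix l assume l: "l \<in> {l. l < n \<and> P (the_inv letter l)}"
      then have "l < CARD('m + 'm)" using assms by simp
      then obtain a :: "'m + 'm" where a: "l = letter a" by (rule letter_surj)
      then show "l \<in> letter ` {a :: 'm + 'm. letter a < n \<and> P a}" using l by auto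
    qed auto
  qed (auto simp: inj_on_def letter_eq_iff)
qed

lemma inversions_letter:
  fixes b :: "'m::{finite,linorder} + 'm \<Rightarrow> nat"
  shows "int (inversions letter b) = inv_upto (weight r b) (CARD('m + 'm))"
  unfolding inversions_def inv_upto_def card_letter_pairs[of "\<lambda>a a'. b a' < b a"] by (simp add: weight_def)

lemma pair_count_letter:
  fixes b :: "'m::{finite,linorder} + 'm \<Rightarrow> nat"
  shows "int (pair_count letter b r) = neg_upto (weight r b) (CARD('m + 'm))"
proof -
  have "b a + b a' + 2 \<le> r \<longleftrightarrow> (2 * int (b a) + 1 - int r) + (2 * int (b a') + 1 - int r) < 0" for a a'
    by linarith
  then show ?thesis
    unfolding pair_count_def neg_upto_def card_letter_pairs[of "\<lambda>a a'. b a + b a' + 2 \<le> r"] weight_def by simp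
qed

lemma sum_fibres_cong:
  fixes b b' :: "'n::finite \<Rightarrow> nat" and F :: "nat \<Rightarrow> 'v::comm_semiring_1"
  assumes "fits c b" "fits c b'"
  shows "(\<Sum>a\<in>UNIV. F (b a)) = (\<Sum>a\<in>UNIV. F (b' a))"
proof -
  have fib: "card {a. b a = i} = sum_list (take (Suc i) c) - sum_list (take i c)" if b: "fits c b" and i: "i < length c" for b :: "'n \<Rightarrow> nat" and i
  proof -
    have "card {a. b a < i} = sum_list (take i c)"
    proof (cases i)
      case (Suc k)
      have "{a. b a < i} = {a. b a \<le> k}" using Suc by auto
      then show ?thesis using b i Suc unfolding fits_def by simp
    qed simp
    moreover have "card {a. b a \<le> i} = card {a. b a = i} + card {a. b a < i}"
      by (subst card_Un_disjoint[symmetric]) (auto intro: arg_cong[of _ _ card])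
    ultimately show ?thesis using b i unfolding fits_def by simp
  qed
  have "(\<Sum>a\<in>UNIV. F (b a)) = (\<Sum>i<length c. of_nat (sum_list (take (Suc i) c) - sum_list (take i c)) * F i)"
    if b: "fits c b" for b :: "'n \<Rightarrow> nat"
  proof -
    have "(\<Sum>a\<in>UNIV. F (b a)) = (\<Sum>i<length c. \<Sum>a | a \<in> UNIV \<and> b a = i. F (b a))"
      by (rule sum.group[symmetric]) (use b in \<open>auto simp: fits_def\<close>)
    also have "\<dots> = (\<Sum>i<length c. of_nat (card {a. b a = i}) * F i)"
      by (intro sum.cong) simp_all
    also have "\<dots> = (\<Sum>i<length c. of_nat (sum_list (take (Suc i) c) - sum_list (take i c)) * F i)"
      using fib[OF b] by (intro sum.cong) simp_all
    finally show ?thesis .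
  qed
  then show ?thesis using assms by simp
qed

text \<open>The condition is symmetric, so counting all ordered pairs gives twice
  \<open>pair_count\<close> plus the diagonal, and both totals depend only on the fibre sizes of
  \<open>b\<close>. This carries the codimension of the cycle from a balanced function over to that
  of an arbitrary word.\<close>

lemma pair_count_cong:
  fixes b b' q :: "'n::finite \<Rightarrow> nat"
  assumes q: "numbering q" and b: "fits c b" and b': "fits c b'"
  shows "pair_count q b r = pair_count q b' r"
proof -
  have inj: "inj q" using q unfolding numbering_def bij_betw_def by simp
  have count: "2 * pair_count q b r + (\<Sum>a\<in>UNIV. of_bool (b a + b a + 2 \<le> r)) =
      (\<Sum>a\<in>UNIV. \<Sum>a'\<in>UNIV. of_bool (b a + b a' + 2 \<le> r))" for b :: "'n \<Rightarrow> nat"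
  proof -
    let ?A = "{(a, a'). q a < q a' \<and> b a + b a' + 2 \<le> r}"
    let ?B = "{(a, a'). q a' < q a \<and> b a + b a' + 2 \<le> r}"
    let ?C = "(\<lambda>a. (a, a)) ` {a. b a + b a + 2 \<le> r}"
    have "card ?B = card ?A"
      by (rule bij_betw_same_card[of prod.swap]) (auto simp: bij_betw_def inj_on_def add.commute image_iff)
    moreover have "card ?C = (\<Sum>a\<in>UNIV. of_bool (b a + b a + 2 \<le> r))"
      by (subst card_image) (auto simp: inj_on_def)
    moreover have "{(a, a'). b a + b a' + 2 \<le> r} = ?A \<union> ?B \<union> ?C"
    proof (intro equalityI subsetI)
      fix p assume p: "p \<in> {(a, a'). b a + b a' + 2 \<le> r}"
      consider "q (fst p) < q (snd p)" | "q (snd p) < q (fst p)" | "fst p = snd p"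
        using inj by (metis injD linorder_neqE_nat)
      then show "p \<in> ?A \<union> ?B \<union> ?C" using p by cases (cases p; auto)+
    qed auto
    moreover have "card (?A \<union> ?B \<union> ?C) = card ?A + card ?B + card ?C"
    proof -
      have "card (?A \<union> ?B \<union> ?C) = card (?A \<union> ?B) + card ?C" by (rule card_Un_disjoint) auto
      moreover have "card (?A \<union> ?B) = card ?A + card ?B" by (rule card_Un_disjoint) auto
      ultimately show ?thesis by simp
    qed
    moreover have "card {(a, a'). b a + b a' + 2 \<le> r} = (\<Sum>a\<in>UNIV. \<Sum>a'\<in>UNIV. of_bool (b a + b a' + 2 \<le> r))"
    proof -
      have "card {(a, a'). b a + b a' + 2 \<le> r} = (\<Sum>p\<in>UNIV. of_bool (b (fst p) + b (snd p) + 2 \<le> r))"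
        by (simp add: case_prod_unfold)
      also have "\<dots> = (\<Sum>p\<in>UNIV \<times> UNIV. of_bool (b (fst p) + b (snd p) + 2 \<le> r))" by simp
      also have "\<dots> = (\<Sum>a\<in>UNIV. \<Sum>a'\<in>UNIV. of_bool (b a + b a' + 2 \<le> r))"
        by (simp only: sum.cartesian_product case_prod_unfold)
      finally show ?thesis .
    qed
    ultimately show ?thesis unfolding pair_count_def by simp
  qed
  have "(\<Sum>a\<in>UNIV. \<Sum>a'\<in>UNIV. of_bool (b a + b a' + 2 \<le> r)) = (\<Sum>a\<in>UNIV. \<Sum>a'\<in>UNIV. of_bool (b a + b' a' + 2 \<le> r) :: nat)"
  proof (rule sum.cong[OF refl])
    fix a
    show "(\<Sum>a'\<in>UNIV. of_bool (b a + b a' + 2 \<le> r)) = (\<Sum>a'\<in>UNIV. of_bool (b a + b' a' + 2 \<le> r) :: nat)"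
      by (rule sum_fibres_cong[OF b b', of "\<lambda>k. of_bool (b a + k + 2 \<le> r)"])
  qed
  also have "\<dots> = (\<Sum>a\<in>UNIV. \<Sum>a'\<in>UNIV. of_bool (b' a + b' a' + 2 \<le> r))"
    using sum_fibres_cong[OF b b', of "\<lambda>k. (\<Sum>a'\<in>UNIV. of_bool (k + b' a' + 2 \<le> r) :: nat)"] by simp
  finally have "2 * pair_count q b r + (\<Sum>a\<in>UNIV. of_bool (b a + b a + 2 \<le> r)) =
      2 * pair_count q b' r + (\<Sum>a\<in>UNIV. of_bool (b' a + b' a + 2 \<le> r))"
    unfolding count .
  moreover have "(\<Sum>a\<in>UNIV. of_bool (b a + b a + 2 \<le> r)) = (\<Sum>a\<in>UNIV. of_bool (b' a + b' a + 2 \<le> r) :: nat)"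
    using sum_fibres_cong[OF b b', of "\<lambda>k. of_bool (k + k + 2 \<le> r)"] .
  ultimately show ?thesis by simp
qed

definition paired :: "nat \<Rightarrow> ('m::{finite,linorder} + 'm \<Rightarrow> nat) \<Rightarrow> bool" where
  "paired r b \<longleftrightarrow> (\<forall>i. b (Inl i) + b (Inr i) + 1 = r \<and> b (Inl i) \<le> b (Inr i))"

lemma paired_balanced: "paired r b \<Longrightarrow> balanced r b"
  unfolding paired_def balanced_def by (auto simp: swap_def add.commute split: sum.split)

lemma position_surj:
  assumes "k < CARD('m)" obtains i :: "'m::{finite,linorder}" where "k = position i"
  using assms bij_position[where 'm = 'm] unfolding bij_betw_def by (metis imageE lessThan_iff)

text \<open>Read through the weights, \<open>cond\<close> says that among the letters of each
  initial run of pairs the imbalances at positive thresholds are nonnegative, which is the input of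
  \<open>excess_zero_imp_paired\<close>.\<close>

lemma inversions_eq_pair_count_iff:
  fixes b :: "'m::{finite,linorder} + 'm \<Rightarrow> nat"
  assumes sum: "(\<Sum>a\<in>UNIV. 2 * int (b a) + 1 - int r) = 0" and br: "\<And>a. b a < r"
    and cond: "\<And>i l k. i + l + 2 = r \<Longrightarrow> cell_dim letter b i (2 * k) + cell_dim letter b l (2 * k) \<le> card {a :: 'm + 'm. letter a < 2 * k}"
    and eq: "inversions letter b = pair_count letter b r"
  shows "paired r b"
proof -
  let ?x = "weight r b"
  let ?m = "CARD('m)"
  have mm: "CARD('m + 'm) = 2 * ?m" by simp
  have im: "0 \<le> imbalance ?x (2 * k) t" if k: "k \<le> ?m" and t: "0 < t" for k t
  proof (cases "int r - 1 < t")
    case True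
    have "\<not> ?x l \<le> - t" for l using True by (simp add: weight_def)
    then show ?thesis by (simp add: imbalance_def)
  next
    case False
    \<comment> \<open>The last block index whose weight is at most \<open>- t\<close>; the blocks of
      weight at least \<open>t\<close> are then those after \<open>l\<close>, the index
      complementary to \<open>i\<close>. Rounding down settles thresholds of the wrong
      parity.\<close>
    define i where "i = nat ((int r - 1 - t) div 2)"
    define l where "l = r - 2 - i"
    have i: "int i = (int r - 1 - t) div 2" using False by (simp add: i_def)
    have il: "i + l + 2 = r" using i t False by (simp add: l_def)
    have k': "2 * k \<le> CARD('m + 'm)" using k by simp
    have 1: "card {n. n < 2 * k \<and> ?x n \<le> - t} = cell_dim letter b i (2 * k)"
    proof -
      have "?x n \<le> - t \<longleftrightarrow> b (the_inv letter n) \<le> i" for n unfolding weight_def using i t False by linarith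
      then have "card {n. n < 2 * k \<and> ?x n \<le> - t} = card {a :: 'm + 'm. letter a < 2 * k \<and> b a \<le> i}"
        using card_letters[OF k', of "\<lambda>a. b a \<le> i"] by simp
      then show ?thesis by (simp add: cell_dim_def conj_commute)
    qed
    have 2: "card {n. n < 2 * k \<and> t \<le> ?x n} + cell_dim letter b l (2 * k) = card {a :: 'm + 'm. letter a < 2 * k}"
    proof -
      have "t \<le> ?x n \<longleftrightarrow> \<not> b (the_inv letter n) \<le> l" for n unfolding weight_def using i t False il by linarith
      then have "card {n. n < 2 * k \<and> t \<le> ?x n} = card {a :: 'm + 'm. letter a < 2 * k \<and> \<not> b a \<le> l}"
        using card_letters[OF k', of "\<lambda>a. \<not> b a \<le> l"] by simp
      moreover have "card {a :: 'm + 'm. letter a < 2 * k} =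
          card {a :: 'm + 'm. letter a < 2 * k \<and> \<not> b a \<le> l} + card {a :: 'm + 'm. b a \<le> l \<and> letter a < 2 * k}"
        by (subst card_Un_disjoint[symmetric]) (auto intro: arg_cong[of _ _ card])
      ultimately show ?thesis by (simp add: cell_dim_def)
    qed
    show ?thesis unfolding imbalance_def using 1 2 cond[OF il, of k] by simp
  qed
  have "(\<Sum>l<2 * ?m. ?x l) = (\<Sum>a\<in>UNIV. ?x (letter (a :: 'm + 'm)))"
    using numbering_letter[where 'm = 'm] unfolding numbering_def mm by (rule sum.reindex_bij_betw[symmetric])
  then have s0: "(\<Sum>l<2 * ?m. ?x l) = 0" using sum by simp
  have ex: "excess ?x (2 * ?m) = 0"
    using eq inversions_letter[of b r] pair_count_letter[of b r] unfolding excess_def mm by simp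
  show ?thesis
    unfolding paired_def
  proof
    fix i :: 'm
    have "position i < ?m" using bij_position[where 'm = 'm] by (auto simp: bij_betw_def)
    then have "?x (2 * position i) + ?x (Suc (2 * position i)) = 0 \<and> ?x (2 * position i) \<le> ?x (Suc (2 * position i))"
      using excess_zero_imp_paired[OF im s0 ex] by blast
    moreover have "2 * position i = letter (Inl i)" "Suc (2 * position i) = letter (Inr i)" by (simp_all add: letter_def)
    ultimately have "(2 * int (b (Inl i)) + 1 - int r) + (2 * int (b (Inr i)) + 1 - int r) = 0 \<and>
        2 * int (b (Inl i)) + 1 - int r \<le> 2 * int (b (Inr i)) + 1 - int r"
      by (simp only: weight_letter)
    then show "b (Inl i) + b (Inr i) + 1 = r \<and> b (Inl i) \<le> b (Inr i)" by linarith
  qed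
qed

lemma paired_inversions:
  fixes b :: "'m::{finite,linorder} + 'm \<Rightarrow> nat"
  assumes "paired r b" shows "inversions letter b = pair_count letter b r"
proof -
  let ?x = "weight r b"
  have "excess ?x (2 * CARD('m)) = 0"
  proof (rule paired_imp_excess_zero[THEN conjunct1])
    fix k assume "k < CARD('m)"
    then obtain i :: 'm where i: "k = position i" by (rule position_surj)
    have l: "2 * k = letter (Inl i)" "Suc (2 * k) = letter (Inr i)" by (simp_all add: letter_def i)
    have "b (Inl i) + b (Inr i) + 1 = r \<and> b (Inl i) \<le> b (Inr i)" using assms by (simp add: paired_def)
    then show "?x (2 * k) + ?x (Suc (2 * k)) = 0 \<and> ?x (2 * k) \<le> ?x (Suc (2 * k))"
      unfolding l(2) unfolding l(1) weight_letter by linarith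
  qed
  then have "inv_upto ?x (2 * CARD('m)) = neg_upto ?x (2 * CARD('m))" by (simp add: excess_def)
  moreover have mm: "CARD('m + 'm) = 2 * CARD('m)" by simp
  ultimately show ?thesis
    using inversions_letter[of b r, unfolded mm] pair_count_letter[of b r, unfolded mm] by linarith
qed

text \<open>The hypothesis gives only a point of the closure on the cycle, while the rank table is
  known on the cell alone. As the cycle lies in the open set \<open>D\<close>, the cell itself meets
  \<open>D\<close>, and the counting argument applies there. Conversely, a paired \<open>b\<close>
  is balanced and its coordinate flag lies on the cycle.\<close>

lemma cell_closure_iff_paired:
  fixes b :: "'m::{finite,linorder} + 'm \<Rightarrow> nat" and D C :: "('m + 'm) flag set"
  assumes b: "fits c b" and ex: "\<exists>b0 :: 'm + 'm \<Rightarrow> nat. fits c b0 \<and> balanced (length c) b0"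
    and D: "is_open_orbit c D" and C: "is_base_cycle c D C"
  defines "S \<equiv> flag_topology c closure_of orbit (borel_group letter) (coord_flag (length c) b)"
  shows "cdim c S + cdim c C = cdim c (flag_manifold c :: ('m + 'm) flag set) \<and> S \<inter> C \<noteq> {} \<longleftrightarrow> paired (length c) b"
proof
  let ?r = "length c"
  let ?O = "orbit (borel_group letter) (coord_flag ?r b)"
  have dS: "cdim c S = inversions letter b"
    unfolding S_def by (rule cdim_closure_borel_orbit[OF numbering_letter b])
  show "cdim c S + cdim c C = cdim c (flag_manifold c :: ('m + 'm) flag set) \<and> S \<inter> C \<noteq> {}" if p: "paired ?r b"
  proof
    have bal: "balanced ?r b" by (rule paired_balanced[OF p])
    show "cdim c S + cdim c C = cdim c (flag_manifold c :: ('m + 'm) flag set)"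
      using cdim_base_cycle[OF b bal D C numbering_letter] dS paired_inversions[OF p] by simp
    have "coord_flag ?r b \<in> C"
      unfolding base_cycle_isotropic(1)[OF b bal D C]
      using coord_flag_in_manifold[OF b] coord_flag_isotropic[OF bal] by simp
    moreover have "coord_flag ?r b \<in> S"
    proof -
      have "?O \<subseteq> flag_manifold c"
        using flag_submanifold_cell[OF numbering_letter b] unfolding flag_submanifold_def by blast
      then show ?thesis unfolding S_def
        using flag_subset_closure orbit_refl[OF matrix_group_borel] by blast
    qed
    ultimately show "S \<inter> C \<noteq> {}" by blast
  qed
  assume L: "cdim c S + cdim c C = cdim c (flag_manifold c :: ('m + 'm) flag set) \<and> S \<inter> C \<noteq> {}"
  obtain b0 :: "'m + 'm \<Rightarrow> nat" where b0: "fits c b0" and bal: "balanced ?r b0" using ex by blast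
  have br: "b a < ?r" for a using b by (simp add: fits_def)
  obtain V0 where V0: "V0 \<in> flag_manifold c" "D = orbit G0 V0" and op: "openin (flag_topology c) D"
    using D unfolding is_open_orbit_def by blast
  have CD: "C \<subseteq> D"
  proof -
    obtain V where V: "V \<in> D" "C = orbit K0 V" using C unfolding is_base_cycle_def by blast
    have "D = orbit G0 V" using orbit_eq[OF matrix_group_G0, of V V0] V V0 by simp
    then show ?thesis unfolding V(2) orbit_def K0_def by blast
  qed
  obtain V where V: "V \<in> S" "V \<in> D" using L CD by blast
  \<comment> \<open>Replaces the limit point by a point of the cell that still lies in the open
    orbit.\<close>
  obtain V' where V': "V' \<in> ?O" "V' \<in> D" by (rule closure_of_meets[OF V(1)[unfolded S_def] op V(2)])
  have V'Z: "V' \<in> flag_manifold c" using V'(2) op unfolding openin_flag_topology by blast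
  have tr: "transversal ?r V'" by (rule open_orbit_transversal[OF b0 bal D V'(2)])
  show "paired ?r b"
  proof (rule inversions_eq_pair_count_iff[OF _ br])
    have "(\<Sum>a\<in>UNIV. 2 * int (b a) + 1 - int ?r) = (\<Sum>a\<in>UNIV. 2 * int (b0 a) + 1 - int ?r)"
      by (rule sum_fibres_cong[OF b b0])
    moreover have "(\<Sum>a\<in>UNIV. 2 * int (b0 a) + 1 - int ?r) = 0"
    proof -
      define s where "s a = 2 * int (b0 a) + 1 - int ?r" for a
      have neg: "s (swap a) = - s a" for a
        unfolding s_def using balanced_sum[OF bal, of a] by linarith
      have "(\<Sum>a\<in>UNIV. s a) = (\<Sum>a\<in>UNIV. - s a)"
        using sum_UNIV_swap[of s] by (simp add: neg)
      then have "(\<Sum>a\<in>UNIV. s a) = 0" by (simp add: sum_negf)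
      then show ?thesis unfolding s_def .
    qed
    ultimately show "(\<Sum>a\<in>UNIV. 2 * int (b a) + 1 - int ?r) = 0"
      by simp
    show "cell_dim letter b i (2 * k) + cell_dim letter b l (2 * k) \<le> card {a :: 'm + 'm. letter a < 2 * k}"
      if il: "i + l + 2 = ?r" for i l k
      by (rule cell_meets_transversal[OF numbering_letter b V'Z V'(1) tr letter_swap_less il])
    have "inversions letter b + cdim c C = cdim c C + pair_count letter b0 ?r"
      using L dS cdim_base_cycle[OF b0 bal D C numbering_letter] by simp
    then show "inversions letter b = pair_count letter b ?r"
      using pair_count_cong[OF numbering_letter b b0] by simp
  qed
qed

section \<open>One-line words\<close>

lemma length_blocks [simp]: "length (blocks c w) = length c"
  by (induction c arbitrary: w) auto

lemma blocks_nth: "i < length c \<Longrightarrow> blocks c w ! i = take (c ! i) (drop (sum_list (take i c)) w)"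
proof (induction c arbitrary: w i)
  case (Cons d c)
  then show ?case by (cases i) (simp_all add: add.commute)
qed simp

lemma concat_blocks: "concat (blocks c w) = take (sum_list c) w"
  by (induction c arbitrary: w) (auto simp: take_add)

lemma take_Suc_block:
  "i < length c \<Longrightarrow> take (sum_list (take (Suc i) c)) w = take (sum_list (take i c)) w @ blocks c w ! i"
  by (simp add: blocks_nth take_Suc_conv_app_nth take_add)

text \<open>The index, from 0, of the block containing \<open>k\<close>. It is expressed through
  prefixes of the word because these span the steps of the flag.\<close>

definition word_block :: "nat list \<Rightarrow> nat list \<Rightarrow> nat \<Rightarrow> nat" where
  "word_block c w k = (LEAST i. k \<in> set (take (sum_list (take (Suc i) c)) w))"

definition word_step :: "nat list \<Rightarrow> nat list \<Rightarrow> 'm::{finite,linorder} + 'm \<Rightarrow> nat" where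
  "word_step c w a = word_block c w (Suc (letter a))"

text \<open>Positive entries make the index \<open>sum_list (take (Suc i) c) - 1\<close> in
  \<open>proj_flag\<close> point at the subspace of the right dimension, with no truncation at
  0.\<close>

definition word_on :: "nat list \<Rightarrow> nat list \<Rightarrow> bool" where
  "word_on c w \<longleftrightarrow> c \<noteq> [] \<and> (\<forall>d\<in>set c. 1 \<le> d) \<and> w \<in> minimal_reps c"

lemma word_onD:
  assumes "word_on c w"
  shows "distinct w" "set w = {1..sum_list c}" "length w = sum_list c"
    "\<And>i. i < length c \<Longrightarrow> sorted_wrt (<) (blocks c w ! i)"
    "\<And>i. i < length c \<Longrightarrow> length (blocks c w ! i) = c ! i" "c \<noteq> []"
proof -
  have w: "w \<in> permutations_of_set {1..sum_list c}" "\<forall>b\<in>set (blocks c w). sorted_wrt (<) b"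
    using assms unfolding word_on_def minimal_reps_def by auto
  then show d: "distinct w" and s: "set w = {1..sum_list c}" unfolding permutations_of_set_def by auto
  then show len: "length w = sum_list c" using distinct_card[OF d] by simp
  show "sorted_wrt (<) (blocks c w ! i)" if "i < length c" for i
    using w(2) that by (simp add: nth_mem)
  show "length (blocks c w ! i) = c ! i" if "i < length c" for i
  proof -
    have "sum_list (take (Suc i) c) \<le> sum_list c"
      using append_take_drop_id[of "Suc i" c] by (metis le_add1 sum_list_append)
    then show ?thesis using that len by (simp add: blocks_nth take_Suc_conv_app_nth)
  qed
  show "c \<noteq> []" using assms unfolding word_on_def by simp
qed

lemma word_block_le_iff:
  assumes "word_on c w" "k \<in> {1..sum_list c}"
  shows "word_block c w k \<le> i \<longleftrightarrow> k \<in> set (take (sum_list (take (Suc i) c)) w)"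
    "word_block c w k < length c"
proof -
  let ?P = "\<lambda>i. k \<in> set (take (sum_list (take (Suc i) c)) w)"
  have c: "c \<noteq> []" by (rule word_onD(6)[OF assms(1)])
  have "?P (length c - 1)" using c assms(2) word_onD(2,3)[OF assms(1)] by simp
  note P = LeastI[of ?P, OF this] and L = Least_le[of ?P, OF this]
  have mono: "?P j" if "?P i" "i \<le> j" for i j
  proof -
    have "take (Suc i) c = take (Suc i) (take (Suc j) c)" using that(2) by (simp add: min_def)
    then have "sum_list (take (Suc i) c) \<le> sum_list (take (Suc j) c)"
      using append_take_drop_id[of "Suc i" "take (Suc j) c"] by (metis le_add1 sum_list_append)
    then show ?thesis using that(1) by (rule subsetD[OF set_take_subset_set_take])
  qed
  have Pb: "?P (word_block c w k)" unfolding word_block_def by (rule P)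
  show "word_block c w k \<le> i \<longleftrightarrow> ?P i"
    using mono[OF Pb] Least_le[of ?P i] unfolding word_block_def by (intro iffI)
  have "word_block c w k \<le> length c - 1" unfolding word_block_def by (rule L)
  moreover have "0 < length c" using c by simp
  ultimately show "word_block c w k < length c" by linarith
qed

lemma in_block_iff:
  assumes w: "word_on c w" and i: "i < length c" and k: "k \<in> {1..sum_list c}"
  shows "k \<in> set (blocks c w ! i) \<longleftrightarrow> word_block c w k = i"
proof -
  let ?A = "set (take (sum_list (take i c)) w)" and ?B = "set (blocks c w ! i)"
  have "distinct (take (sum_list (take i c)) w @ blocks c w ! i)"
    using word_onD(1)[OF w] unfolding take_Suc_block[OF i, symmetric] by simp
  then have disj: "?A \<inter> ?B = {}" by simp
  have le: "word_block c w k \<le> i \<longleftrightarrow> k \<in> ?A \<or> k \<in> ?B"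
    unfolding word_block_le_iff(1)[OF w k] take_Suc_block[OF i] by simp
  have "k \<in> ?A \<longleftrightarrow> word_block c w k < i"
  proof (cases i)
    case (Suc j)
    then show ?thesis using word_block_le_iff(1)[OF w k, of j] by (simp add: less_Suc_eq_le)
  qed simp
  then show ?thesis using le disj by (auto simp: le_less)
qed

lemma block_subset:
  assumes "word_on c w" "i < length c" shows "set (blocks c w ! i) \<subseteq> {1..sum_list c}"
  using word_onD(2)[OF assms(1)] by (auto simp: blocks_nth[OF assms(2)] dest!: in_set_takeD in_set_dropD)

lemma letter_range: "(\<lambda>a :: 'm::{finite,linorder} + 'm. Suc (letter a)) ` UNIV = {1..CARD('m + 'm)}"
proof -
  have "range (letter :: 'm + 'm \<Rightarrow> nat) = {..<CARD('m + 'm)}"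
    using numbering_letter unfolding numbering_def bij_betw_def by blast
  then have "Suc ` range (letter :: 'm + 'm \<Rightarrow> nat) = {1..CARD('m + 'm)}"
    by (simp only: image_Suc_lessThan)
  then show ?thesis by (simp add: image_image)
qed

lemma Suc_letter_mem: "sum_list c = CARD('m + 'm) \<Longrightarrow> Suc (letter (a :: 'm::{finite,linorder} + 'm)) \<in> {1..sum_list c}"
  using letter_bound[of a] by simp

lemma word_step_le_iff:
  assumes "word_on c w" "sum_list c = CARD('m + 'm)"
  shows "word_step c w (a :: 'm::{finite,linorder} + 'm) \<le> i \<longleftrightarrow> Suc (letter a) \<in> set (take (sum_list (take (Suc i) c)) w)"
  unfolding word_step_def by (rule word_block_le_iff(1)[OF assms(1) Suc_letter_mem[OF assms(2)]])

lemma word_step_fits: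
  assumes w: "word_on c w" and c: "sum_list c = CARD('m + 'm)"
  shows "fits c (word_step c w :: 'm::{finite,linorder} + 'm \<Rightarrow> nat)"
  unfolding fits_def
proof (intro conjI allI impI)
  show "c \<noteq> []" by (rule word_onD(6)[OF w])
  show "word_step c w a < length c" for a :: "'m + 'm"
    unfolding word_step_def by (rule word_block_le_iff(2)[OF w Suc_letter_mem[OF c]])
  fix i assume i: "i < length c"
  let ?S = "set (take (sum_list (take (Suc i) c)) w)"
  have inj: "inj (\<lambda>a :: 'm + 'm. Suc (letter a))" by (auto simp: inj_on_def letter_eq_iff)
  have "(\<lambda>a :: 'm + 'm. Suc (letter a)) ` {a. word_step c w a \<le> i} = ?S"
  proof (intro equalityI subsetI)
    fix k assume k: "k \<in> ?S"
    then have "k \<in> (\<lambda>a :: 'm + 'm. Suc (letter a)) ` UNIV"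
      unfolding letter_range using word_onD(2)[OF w] c by (auto dest: in_set_takeD)
    then show "k \<in> (\<lambda>a :: 'm + 'm. Suc (letter a)) ` {a. word_step c w a \<le> i}"
      using k word_step_le_iff[OF w c] by auto
  qed (use word_step_le_iff[OF w c] in auto)
  then have "card {a :: 'm + 'm. word_step c w a \<le> i} = card ?S"
    using card_image[OF inj_on_subset[OF inj subset_UNIV], of "{a. word_step c w a \<le> i}"] by simp
  also have "\<dots> = sum_list (take (Suc i) c)"
  proof -
    have "sum_list (take (Suc i) c) \<le> sum_list c"
      using append_take_drop_id[of "Suc i" c] by (metis le_add1 sum_list_append)
    then show ?thesis using distinct_card[OF distinct_take[OF word_onD(1)[OF w]]] word_onD(3)[OF w] by simp
  qed
  finally show "card {a :: 'm + 'm. word_step c w a \<le> i} = sum_list (take (Suc i) c)" .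
qed

lemma nth_concat_pairs:
  "k < length xs \<Longrightarrow> concat (map (\<lambda>x. [f x, g x]) xs) ! (2 * k) = f (xs ! k) \<and>
    concat (map (\<lambda>x. [f x, g x]) xs) ! Suc (2 * k) = g (xs ! k)"
proof (induction xs arbitrary: k)
  case (Cons x xs)
  then show ?case by (cases k) auto
qed simp

lemma sorted_list_nth_position:
  "sorted_list_of_set (UNIV :: 'm::{finite,linorder} set) ! position i = i"
    "position i < length (sorted_list_of_set (UNIV :: 'm set))"
proof -
  let ?xs = "sorted_list_of_set (UNIV :: 'm set)"
  have s: "sorted_wrt (<) ?xs" "set ?xs = UNIV" by simp_all
  obtain j where j: "j < length ?xs" "?xs ! j = i" using s(2) by (metis UNIV_I in_set_conv_nth)
  have "{k. k < i} = set (take j ?xs)"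
  proof (intro equalityI subsetI)
    fix k assume "k \<in> {k. k < i}"
    moreover obtain l where l: "l < length ?xs" "?xs ! l = k" using s(2) by (metis UNIV_I in_set_conv_nth)
    ultimately have "l < j" using j s(1) by (metis (no_types) linorder_neqE_nat mem_Collect_eq not_less_iff_gr_or_eq sorted_wrt_nth_less)
    then show "k \<in> set (take j ?xs)" using l by (auto simp: in_set_conv_nth)
  next
    fix k assume "k \<in> set (take j ?xs)"
    then obtain l where "l < j" "?xs ! l = k" by (auto simp: in_set_conv_nth)
    then show "k \<in> {k. k < i}" using sorted_wrt_nth_less[OF s(1), of l j] j by simp
  qed
  then have "position i = j" unfolding position_def using j(1) by (simp add: distinct_card)
  then show "?xs ! position i = i" "position i < length ?xs" using j by simp_all
qed

lemma u_vec_letter: "u_vec (Suc (letter a)) = (case a of Inl i \<Rightarrow> 1 | Inr i \<Rightarrow> - 1) *s axis (a :: 'm::{finite,linorder} + 'm) 1"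
proof (cases a)
  case (Inl i)
  then show ?thesis unfolding u_vec_def u_basis_def
    using nth_concat_pairs[OF sorted_list_nth_position(2)[of i], of "\<lambda>i. axis (Inl i) 1" "\<lambda>i. jmap (axis (Inl i) 1)"]
    by (simp add: letter_def sorted_list_nth_position(1))
next
  case (Inr i)
  have "jmap (axis (Inl i) 1) = - 1 *s axis (Inr i) 1"
    unfolding jmap_axis by (simp add: tau_def swap_def)
  then show ?thesis using Inr unfolding u_vec_def u_basis_def
    using nth_concat_pairs[OF sorted_list_nth_position(2)[of i], of "\<lambda>i. axis (Inl i) 1" "\<lambda>i. jmap (axis (Inl i) 1)"]
    by (simp add: letter_def sorted_list_nth_position(1))
qed

lemma span_u_vec:
  fixes S :: "nat set"
  assumes "S \<subseteq> {1..CARD('m + 'm)}"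
  shows "vec.span (u_vec ` S) = coord_space {a :: 'm::{finite,linorder} + 'm. Suc (letter a) \<in> S}"
proof
  show "vec.span (u_vec ` S) \<subseteq> coord_space {a :: 'm + 'm. Suc (letter a) \<in> S}"
  proof (rule vec.span_minimal[OF _ coord_space_subspace], rule image_subsetI)
    fix k assume k: "k \<in> S"
    then have "k \<in> (\<lambda>a :: 'm + 'm. Suc (letter a)) ` UNIV" unfolding letter_range using assms by blast
    then obtain a :: "'m + 'm" where a: "k = Suc (letter a)" by blast
    have "axis a 1 \<in> coord_space {a :: 'm + 'm. Suc (letter a) \<in> S}"
      using k a by (simp add: axis_in_coord_space)
    then show "u_vec k \<in> coord_space {a :: 'm + 'm. Suc (letter a) \<in> S}"
      unfolding a u_vec_letter by (rule vec.subspace_scale[OF coord_space_subspace])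
  qed
  show "coord_space {a :: 'm + 'm. Suc (letter a) \<in> S} \<subseteq> vec.span (u_vec ` S)"
  proof
    fix v :: "complex^('m + 'm)" assume v: "v \<in> coord_space {a. Suc (letter a) \<in> S}"
    have "v $ a *s axis a 1 \<in> vec.span (u_vec ` S)" for a
    proof (cases "Suc (letter a) \<in> S")
      case True
      let ?s = "(case a of Inl i \<Rightarrow> 1 | Inr i \<Rightarrow> - 1) :: complex"
      have "(v $ a * ?s) *s (u_vec (Suc (letter a)) :: complex^('m + 'm)) \<in> vec.span (u_vec ` S)"
        using True by (intro vec.span_scale vec.span_base imageI)
      moreover have "(v $ a * ?s) *s u_vec (Suc (letter a)) = v $ a *s axis a 1"
        unfolding u_vec_letter by (cases a) simp_all
      ultimately show ?thesis by (simp only:)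
    next
      case False
      then have "v $ a = 0" using v by (simp add: coord_space_def)
      then show ?thesis by (simp add: vec.span_zero)
    qed
    then have "(\<Sum>a\<in>UNIV. v $ a *s axis a 1) \<in> vec.span (u_vec ` S)" by (intro vec.span_sum)
    moreover have "(\<Sum>a\<in>UNIV. v $ a *s axis a 1) = v"
      by (simp add: vec_eq_iff axis_def if_distrib sum.delta cong: if_cong)
    ultimately show "v \<in> vec.span (u_vec ` S)" by simp
  qed
qed

lemma perm_flag_nth: "i < length w \<Longrightarrow> perm_flag w ! i = vec.span (u_vec ` set (take (Suc i) w))"
  unfolding perm_flag_def by (simp del: upt_Suc)

lemma proj_perm_flag:
  assumes w: "word_on c w" and c: "sum_list c = CARD('m + 'm)"
  shows "proj_flag c (perm_flag w) = coord_flag (length c) (word_step c w :: 'm::{finite,linorder} + 'm \<Rightarrow> nat)"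
proof (rule nth_equalityI)
  show "length (proj_flag c (perm_flag w)) = length (coord_flag (length c) (word_step c w :: 'm + 'm \<Rightarrow> nat))"
    by (simp add: proj_flag_def)
  fix i assume "i < length (proj_flag c (perm_flag w))"
  then have i: "i < length c" by (simp add: proj_flag_def)
  let ?s = "sum_list (take (Suc i) c)"
  have "1 \<le> c ! 0" "c ! 0 \<le> ?s"
    using w i unfolding word_on_def by (cases c; auto)+
  then have s1: "1 \<le> ?s" by linarith
  have "?s \<le> sum_list c"
    using append_take_drop_id[of "Suc i" c] by (metis le_add1 sum_list_append)
  then have "?s - 1 < length w" using s1 word_onD(3)[OF w] by simp
  then have "proj_flag c (perm_flag w) ! i = vec.span (u_vec ` set (take ?s w))"
    using i s1 by (simp add: proj_flag_def perm_flag_nth del: take_Suc)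
  also have "\<dots> = coord_space {a :: 'm + 'm. Suc (letter a) \<in> set (take ?s w)}"
    by (rule span_u_vec) (use word_onD(2)[OF w] c in \<open>auto dest: in_set_takeD\<close>)
  also have "\<dots> = coord_flag (length c) (word_step c w) ! i"
    unfolding coord_flag_nth[OF i] word_step_le_iff[OF w c] ..
  finally show "proj_flag c (perm_flag w) ! i = coord_flag (length c) (word_step c w :: 'm + 'm \<Rightarrow> nat) ! i" .
qed

lemma B_I_eq: "B_I = (borel_group letter :: (complex^('m::{finite,linorder} + 'm)^('m + 'm)) set)"
proof -
  let ?n = "2 * CARD('m)"
  have "perm_flag [1..<Suc ?n] = coord_flag CARD('m + 'm) (letter :: 'm + 'm \<Rightarrow> nat)"
  proof (rule nth_equalityI)
    show "length (perm_flag [1..<Suc ?n] :: ('m + 'm) flag) = length (coord_flag CARD('m + 'm) (letter :: 'm + 'm \<Rightarrow> nat))"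
      by (simp add: perm_flag_def)
    fix i assume "i < length (perm_flag [1..<Suc ?n] :: ('m + 'm) flag)"
    then have i: "i < ?n" by (simp add: perm_flag_def)
    have "take (Suc i) [1..<Suc ?n] = [1..<Suc (Suc i)]" using i by (simp add: take_upt del: upt_Suc)
    then have "perm_flag [1..<Suc ?n] ! i = vec.span (u_vec ` {1..<Suc (Suc i)})"
      using i by (simp add: perm_flag_nth del: upt_Suc take_Suc)
    also have "\<dots> = coord_space {a :: 'm + 'm. Suc (letter a) \<in> {1..<Suc (Suc i)}}"
      by (rule span_u_vec) (use i in auto)
    also have "\<dots> = coord_flag CARD('m + 'm) letter ! i"
      using i by (simp add: coord_flag_nth less_Suc_eq_le)
    finally show "perm_flag [1..<Suc ?n] ! i = coord_flag CARD('m + 'm) (letter :: 'm + 'm \<Rightarrow> nat) ! i" .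
  qed
  then show ?thesis unfolding B_I_def borel_group_def by simp
qed

lemma schubert_eq:
  assumes w: "word_on c w" and c: "sum_list c = CARD('m + 'm)"
  shows "schubert c w = flag_topology c closure_of
    orbit (borel_group letter) (coord_flag (length c) (word_step c w :: 'm::{finite,linorder} + 'm \<Rightarrow> nat))"
  unfolding schubert_def B_I_eq proj_perm_flag[OF w c] ..

text \<open>The step function records only the set of letters in each block, and a minimal
  representative lists each block in increasing order.\<close>

lemma word_step_inj:
  assumes w: "word_on c w" and w': "word_on c w'" and c: "sum_list c = CARD('m + 'm)"
    and eq: "word_step c w = (word_step c w' :: 'm::{finite,linorder} + 'm \<Rightarrow> nat)"
  shows "w = w'"
proof -
  have wb: "word_block c w k = word_block c w' k" if k: "k \<in> {1..sum_list c}" for k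
  proof -
    have "k \<in> (\<lambda>a :: 'm + 'm. Suc (letter a)) ` UNIV" unfolding letter_range using k c by simp
    then obtain a :: "'m + 'm" where "k = Suc (letter a)" by blast
    then show ?thesis using fun_cong[OF eq, of a] by (simp add: word_step_def)
  qed
  have "blocks c w = blocks c w'"
  proof (rule nth_equalityI)
    fix i assume "i < length (blocks c w)"
    then have i: "i < length c" by simp
    have "set (blocks c w ! i) = set (blocks c w' ! i)"
    proof (rule set_eqI)
      fix k
      show "k \<in> set (blocks c w ! i) \<longleftrightarrow> k \<in> set (blocks c w' ! i)"
      proof (cases "k \<in> {1..sum_list c}")
        case True
        then show ?thesis using in_block_iff[OF w i True] in_block_iff[OF w' i True] wb[OF True] by simp
      next
        case False
        then show ?thesis using block_subset[OF w i] block_subset[OF w' i] by blast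
      qed
    qed
    then show "blocks c w ! i = blocks c w' ! i"
      using word_onD(4)[OF w i] word_onD(4)[OF w' i] by (intro strict_sorted_equal)
  qed simp
  then have "concat (blocks c w) = concat (blocks c w')" by (rule arg_cong)
  then have "take (sum_list c) w = take (sum_list c) w'" unfolding concat_blocks .
  then show ?thesis using word_onD(3)[OF w] word_onD(3)[OF w'] by simp
qed

lemma schubert_inj:
  assumes w: "word_on c w" and w': "word_on c w'" and c: "sum_list c = CARD('m + 'm)"
    and eq: "schubert c w = (schubert c w' :: ('m::{finite,linorder} + 'm) flag set)"
  shows "w = w'"
proof (rule word_step_inj[OF w w' c])
  show "word_step c w = (word_step c w' :: 'm + 'm \<Rightarrow> nat)"
    by (rule closure_borel_orbit_inj[OF numbering_letter word_step_fits[OF w c] word_step_fits[OF w' c]])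
      (use eq schubert_eq[OF w c] schubert_eq[OF w' c] in simp)
qed

section \<open>The pairing condition\<close>

lemma sym_dims_nth_rev: "j < length (sym_dims ds e) \<Longrightarrow> sym_dims ds e ! (length (sym_dims ds e) - 1 - j) = sym_dims ds e ! j"
proof -
  assume j: "j < length (sym_dims ds e)"
  have "rev (sym_dims ds e) = sym_dims ds e" by (simp add: sym_dims_def)
  then show ?thesis using rev_nth[OF j] by simp
qed

lemma sym_dims_nth: "j < length ds \<Longrightarrow> sym_dims ds e ! j = ds ! j"
  by (simp add: sym_dims_def nth_append)

lemma pairing_iff_blocks:
  assumes w: "word_on (sym_dims ds e) w"
  shows "generalized_strictly_pairing ds e w \<longleftrightarrow>
    (\<forall>j<length ds. (\<forall>k\<in>set (blocks (sym_dims ds e) w ! j). odd k) \<and>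
      blocks (sym_dims ds e) w ! (length (sym_dims ds e) - 1 - j) = map Suc (blocks (sym_dims ds e) w ! j))"
proof -
  let ?c = "sym_dims ds e"
  let ?bs = "blocks ?c w"
  have "(\<forall>i<ds ! j. odd (?bs ! j ! i) \<and> rev ?bs ! j ! i = ?bs ! j ! i + 1) \<longleftrightarrow>
      (\<forall>k\<in>set (?bs ! j). odd k) \<and> ?bs ! (length ?c - 1 - j) = map Suc (?bs ! j)" if j: "j < length ds" for j
  proof -
    have jr: "j < length ?c" "length ?c - 1 - j < length ?c" using j by (auto simp: length_sym_dims)
    have len: "length (?bs ! j) = ds ! j" "length (?bs ! (length ?c - 1 - j)) = ds ! j"
      using word_onD(5)[OF w] jr sym_dims_nth[OF j] sym_dims_nth_rev[OF jr(1)] by simp_all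
    have "rev ?bs ! j = ?bs ! (length ?c - 1 - j)" using jr by (simp add: rev_nth)
    then show ?thesis using len by (auto simp: all_set_conv_all_nth list_eq_iff_nth_eq)
  qed
  then show ?thesis unfolding generalized_strictly_pairing_def Let_def by blast
qed

lemma paired_word_step_iff:
  assumes c: "sum_list c = CARD('m + 'm)"
  shows "paired r (word_step c w :: 'm::{finite,linorder} + 'm \<Rightarrow> nat) \<longleftrightarrow>
    (\<forall>k. odd k \<and> k \<le> sum_list c \<longrightarrow> word_block c w k + word_block c w (Suc k) + 1 = r \<and> word_block c w k \<le> word_block c w (Suc k))"
proof
  assume p: "paired r (word_step c w :: 'm + 'm \<Rightarrow> nat)"
  show "\<forall>k. odd k \<and> k \<le> sum_list c \<longrightarrow> word_block c w k + word_block c w (Suc k) + 1 = r \<and> word_block c w k \<le> word_block c w (Suc k)"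
  proof (intro allI impI)
    fix k assume k: "odd k \<and> k \<le> sum_list c"
    then obtain j where j: "k = Suc (2 * j)" by (metis oddE Suc_eq_plus1)
    then have "j < CARD('m)" using k c by simp
    then obtain i :: 'm where "j = position i" by (rule position_surj)
    then have "k = Suc (letter (Inl i))" "Suc k = Suc (letter (Inr i))" using j by (simp_all add: letter_def)
    then show "word_block c w k + word_block c w (Suc k) + 1 = r \<and> word_block c w k \<le> word_block c w (Suc k)"
      using p unfolding paired_def word_step_def by metis
  qed
next
  assume R: "\<forall>k. odd k \<and> k \<le> sum_list c \<longrightarrow> word_block c w k + word_block c w (Suc k) + 1 = r \<and> word_block c w k \<le> word_block c w (Suc k)"
  show "paired r (word_step c w :: 'm + 'm \<Rightarrow> nat)"
    unfolding paired_def word_step_def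
  proof
    fix i :: 'm
    have "odd (Suc (letter (Inl i)))" "Suc (letter (Inl i)) \<le> sum_list c" "letter (Inr i) = Suc (letter (Inl i))"
      using letter_bound[of "Inl i"] c by (simp_all add: letter_def)
    then show "word_block c w (Suc (letter (Inl i))) + word_block c w (Suc (letter (Inr i))) + 1 = r \<and>
        word_block c w (Suc (letter (Inl i))) \<le> word_block c w (Suc (letter (Inr i)))"
      using R by simp
  qed
qed

text \<open>The pairing condition is silent about the middle block. There the pairs are forced: once
  the outer blocks are matched, an odd letter lies in the middle exactly when its successor does.
  Conversely, sorted blocks of equal length match letter by letter as soon as successors land in the
  opposite block.\<close>

lemma paired_iff_pairing:
  assumes w: "word_on (sym_dims ds e) w" and c: "sum_list (sym_dims ds e) = CARD('m + 'm)"
  shows "paired (length (sym_dims ds e)) (word_step (sym_dims ds e) w :: 'm::{finite,linorder} + 'm \<Rightarrow> nat) \<longleftrightarrow>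
    generalized_strictly_pairing ds e w"
  unfolding paired_word_step_iff[OF c] pairing_iff_blocks[OF w]
proof
  let ?c = "sym_dims ds e"
  let ?r = "length ?c" and ?s = "length ds" and ?n = "sum_list ?c"
  let ?bs = "blocks ?c w"
  let ?b = "word_block ?c w"
  have n2: "even ?n" using c by simp
  have r: "2 * ?s \<le> ?r" "?r \<le> 2 * ?s + 1" by (simp_all add: length_sym_dims)
  show "\<forall>j<?s. (\<forall>k\<in>set (?bs ! j). odd k) \<and> ?bs ! (?r - 1 - j) = map Suc (?bs ! j)"
    if L: "\<forall>k. odd k \<and> k \<le> ?n \<longrightarrow> ?b k + ?b (Suc k) + 1 = ?r \<and> ?b k \<le> ?b (Suc k)"
  proof (intro allI impI)
    fix j assume j: "j < ?s"
    have jr: "j < ?r" "?r - 1 - j < ?r" using j r by auto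
    have mem: "odd k \<and> Suc k \<in> set (?bs ! (?r - 1 - j))" if k: "k \<in> set (?bs ! j)" for k
    proof -
      have kn: "k \<in> {1..?n}" using block_subset[OF w jr(1)] k by blast
      have bk: "?b k = j" using in_block_iff[OF w jr(1) kn] k by simp
      \<comment> \<open>An even \<open>k\<close> would be the larger half of its pair, so
        \<open>k - 1\<close> would lie in the opposite, later block, against the required
        order.\<close>
      have odd: "odd k"
      proof (rule ccontr)
        assume "\<not> odd k"
        then have "odd (k - 1)" "k - 1 \<le> ?n" "Suc (k - 1) = k" using kn by auto
        then have "?b (k - 1) + ?b k + 1 = ?r" "?b (k - 1) \<le> ?b k" using L by metis+
        then show False using bk j r by linarith
      qed
      then have "k \<noteq> ?n" using n2 by auto
      then have kn': "Suc k \<in> {1..?n}" using kn by simp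
      have "?b k + ?b (Suc k) + 1 = ?r" using L odd kn by simp
      then have "?b (Suc k) = ?r - 1 - j" using bk by linarith
      then show ?thesis using odd in_block_iff[OF w jr(2) kn'] by simp
    qed
    have lens: "length (?bs ! j) = length (?bs ! (?r - 1 - j))"
      using word_onD(5)[OF w] jr sym_dims_nth_rev[OF jr(1)] by simp
    have srt: "sorted_wrt (<) (?bs ! j)" "sorted_wrt (<) (?bs ! (?r - 1 - j))" using word_onD(4)[OF w] jr by auto
    have srt': "sorted_wrt (<) (map Suc (?bs ! j))" using srt(1) by (simp add: sorted_wrt_map)
    have "set (map Suc (?bs ! j)) = set (?bs ! (?r - 1 - j))"
    proof (rule card_subset_eq)
      show "set (map Suc (?bs ! j)) \<subseteq> set (?bs ! (?r - 1 - j))" using mem by auto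
      have "card (set (map Suc (?bs ! j))) = length (map Suc (?bs ! j))"
        using srt' by (intro distinct_card) (simp only: strict_sorted_iff)
      moreover have "card (set (?bs ! (?r - 1 - j))) = length (?bs ! (?r - 1 - j))"
        using srt(2) by (intro distinct_card) (simp only: strict_sorted_iff)
      ultimately show "card (set (map Suc (?bs ! j))) = card (set (?bs ! (?r - 1 - j)))" using lens by simp
    qed simp
    then have "map Suc (?bs ! j) = ?bs ! (?r - 1 - j)" by (rule strict_sorted_equal[OF srt(2) srt'])
    then show "(\<forall>k\<in>set (?bs ! j). odd k) \<and> ?bs ! (?r - 1 - j) = map Suc (?bs ! j)" using mem by auto
  qed
  assume R: "\<forall>j<?s. (\<forall>k\<in>set (?bs ! j). odd k) \<and> ?bs ! (?r - 1 - j) = map Suc (?bs ! j)"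
  have first: "odd k \<and> ?b (Suc k) = ?r - 1 - j" if k: "k \<in> {1..?n}" "?b k = j" "j < ?s" for k j
  proof -
    have jr: "j < ?r" "?r - 1 - j < ?r" using that r by auto
    have "k \<in> set (?bs ! j)" using in_block_iff[OF w jr(1) k(1)] k(2) by simp
    then have o: "odd k" "Suc k \<in> set (?bs ! (?r - 1 - j))" using R k(3) by auto
    then show ?thesis using in_block_iff[OF w jr(2)] block_subset[OF w jr(2)] by blast
  qed
  have last: "\<exists>k'. k = Suc k' \<and> k' \<in> {1..?n} \<and> odd k' \<and> ?b k' = j" if k: "k \<in> {1..?n}" "?b k = ?r - 1 - j" "j < ?s" for k j
  proof -
    have jr: "j < ?r" "?r - 1 - j < ?r" using that r by auto
    have "k \<in> set (?bs ! (?r - 1 - j))" using in_block_iff[OF w jr(2) k(1)] k(2) by simp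
    then obtain k' where k': "k' \<in> set (?bs ! j)" "k = Suc k'" using R k(3) by auto
    then have "k' \<in> {1..?n}" using block_subset[OF w jr(1)] by blast
    then show ?thesis using k' R k(3) in_block_iff[OF w jr(1)] by blast
  qed
  show "\<forall>k. odd k \<and> k \<le> ?n \<longrightarrow> ?b k + ?b (Suc k) + 1 = ?r \<and> ?b k \<le> ?b (Suc k)"
  proof (intro allI impI)
    fix k assume k: "odd k \<and> k \<le> ?n"
    have kn: "k \<in> {1..?n}" using k by (auto intro: Suc_leI odd_pos)
    have "k \<noteq> ?n" using k n2 by auto
    then have kn': "Suc k \<in> {1..?n}" using k by simp
    have lt: "?b k < ?r" "?b (Suc k) < ?r" using word_block_le_iff(2)[OF w] kn kn' by auto
    show "?b k + ?b (Suc k) + 1 = ?r \<and> ?b k \<le> ?b (Suc k)"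
    proof (cases "?b k < ?s")
      case True
      then show ?thesis using first[OF kn refl True] lt r by linarith
    next
      case False
      \<comment> \<open>The last blocks contain only successors of odd letters, so an odd letter
        outside the first blocks is in the middle.\<close>
      have nb: "?b k \<noteq> ?r - 1 - j" if j: "j < ?s" for j
      proof
        assume bk: "?b k = ?r - 1 - j"
        obtain k' where "k = Suc k'" "odd k'" using last[OF kn bk j] by blast
        then show False using k by simp
      qed
      have "\<not> ?r - 1 - ?b k < ?s" using nb[of "?r - 1 - ?b k"] lt by auto
      then have mid: "?b k = ?s" "?r = 2 * ?s + 1" using False lt r by linarith+
      have "\<not> ?b (Suc k) < ?s" using first[OF kn' refl] k by auto
      moreover have nb': "?b (Suc k) \<noteq> ?r - 1 - j" if j: "j < ?s" for j
      proof
        assume bk: "?b (Suc k) = ?r - 1 - j"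
        have "?b k = j" using last[OF kn' bk j] by auto
        then show False using j mid by simp
      qed
      have "\<not> ?r - 1 - ?b (Suc k) < ?s" using nb'[of "?r - 1 - ?b (Suc k)"] lt by auto
      ultimately have "?b (Suc k) = ?s" using mid lt by linarith
      then show ?thesis using mid by simp
    qed
  qed
qed

lemma schubert_mem_iff:
  fixes D C :: "('m::{finite,linorder} + 'm) flag set"
  assumes w: "word_on (sym_dims ds e) w" and c: "sum_list (sym_dims ds e) = 2 * CARD('m)"
    and D: "is_open_orbit (sym_dims ds e) D" and C: "is_base_cycle (sym_dims ds e) D C"
  shows "schubert (sym_dims ds e) w \<in> schubert_set (sym_dims ds e) C \<longleftrightarrow> generalized_strictly_pairing ds e w"
proof -
  let ?c = "sym_dims ds e"
  have c': "sum_list ?c = CARD('m + 'm)" using c by simp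
  let ?S = "schubert ?c w :: ('m + 'm) flag set"
  have "w \<in> minimal_reps ?c" using w by (simp add: word_on_def)
  then have "?S \<in> schubert_set ?c C \<longleftrightarrow>
      cdim ?c ?S + cdim ?c C = cdim ?c (flag_manifold ?c :: ('m + 'm) flag set) \<and> ?S \<inter> C \<noteq> {}"
    unfolding schubert_set_def by blast
  also have "\<dots> \<longleftrightarrow> paired (length ?c) (word_step ?c w :: 'm + 'm \<Rightarrow> nat)"
    unfolding schubert_eq[OF w c']
    by (rule cell_closure_iff_paired[OF word_step_fits[OF w c'] exists_balanced[OF c] D C])
  also have "\<dots> \<longleftrightarrow> generalized_strictly_pairing ds e w" by (rule paired_iff_pairing[OF w c'])
  finally show ?thesis .
qed

section \<open>The canonical rearrangement\<close>

lemma split_consecutive_pairs: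
  assumes "sorted_wrt (<) b" "0 \<notin> set b" "\<And>k. odd k \<Longrightarrow> k \<in> set b \<longleftrightarrow> Suc k \<in> set b"
  shows "\<exists>ks. b = concat (map (\<lambda>k. [k, Suc k]) ks) \<and> (\<forall>k\<in>set ks. odd k)"
  using assms
proof (induction "length b" arbitrary: b rule: less_induct)
  case less
  show ?case
  proof (cases b)
    case Nil
    then show ?thesis by (intro exI[of _ "[]"]) simp
  next
    case (Cons x b')
    have gt: "\<forall>y\<in>set b'. x < y" using less.prems(1) Cons by simp
    have oddx: "odd x"
    proof (rule ccontr)
      assume ev: "\<not> odd x"
      moreover have "x \<noteq> 0" using less.prems(2) Cons by auto
      ultimately have "odd (x - 1)" "Suc (x - 1) \<in> set b" using Cons by auto
      then have "x - 1 \<in> set b" using less.prems(3) by blast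
      then show False using gt Cons \<open>x \<noteq> 0\<close> by auto
    qed
    then have "Suc x \<in> set b'" using less.prems(3)[of x] Cons by auto
    then obtain y b'' where b': "b' = y # b''" by (cases b') auto
    have "y \<le> Suc x" using \<open>Suc x \<in> set b'\<close> less.prems(1) Cons b' by auto
    then have y: "y = Suc x" using gt b' by auto
    have gt': "\<forall>z\<in>set b''. Suc x < z" using less.prems(1) Cons b' y by simp
    have "\<exists>ks. b'' = concat (map (\<lambda>k. [k, Suc k]) ks) \<and> (\<forall>k\<in>set ks. odd k)"
    proof (rule less.hyps)
      show "length b'' < length b" using Cons b' by simp
      show "sorted_wrt (<) b''" using less.prems(1) Cons b' by simp
      show "0 \<notin> set b''" using less.prems(2) Cons b' by simp
      fix k :: nat assume k: "odd k"
      have "k \<in> set b \<longleftrightarrow> Suc k \<in> set b" using less.prems(3) k by blast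
      then show "k \<in> set b'' \<longleftrightarrow> Suc k \<in> set b''"
        using k oddx gt' unfolding Cons b' y by (auto dest: odd_pos)
    qed
    then obtain ks where "b'' = concat (map (\<lambda>k. [k, Suc k]) ks)" "\<forall>k\<in>set ks. odd k" by blast
    then show ?thesis using Cons b' y oddx by (intro exI[of _ "x # ks"]) simp
  qed
qed

lemma nths_pairs:
  "nths (concat (map (\<lambda>k. [f k, g k]) ks)) {i. even i} = map f ks"
  "nths (concat (map (\<lambda>k. [f k, g k]) ks)) {i. odd i} = map g ks"
  by (induction ks) (simp_all add: nths_Cons)

text \<open>Reversing each partner block makes the tail, read backwards, the successors of the first
  blocks. A middle block closed under the pairs consists of consecutive pairs, so its alternate
  letters separate into odd ones and their successors. The equation for \<open>blocks ds X\<close>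
  recovers the outer blocks from the rearranged word.\<close>

lemma canonical_rearrangement_form:
  assumes w: "word_on (sym_dims ds e) w" and c: "sum_list (sym_dims ds e) = 2 * m"
    and p: "generalized_strictly_pairing ds e w"
    and mid: "\<And>k. odd k \<Longrightarrow> e \<noteq> 0 \<Longrightarrow> k \<in> set (blocks (sym_dims ds e) w ! length ds) \<longleftrightarrow> Suc k \<in> set (blocks (sym_dims ds e) w ! length ds)"
  shows "\<exists>X. canonical_rearrangement ds e w = X @ rev (map Suc X) \<and> (\<forall>k\<in>set X. odd k) \<and>
    take (length ds) (blocks (sym_dims ds e) w) = blocks ds X \<and> mset (canonical_rearrangement ds e w) = mset w"
proof -
  let ?c = "sym_dims ds e"
  let ?bs = "blocks ?c w"
  let ?r = "length ?c" and ?s = "length ds"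
  let ?Y = "concat (take ?s ?bs)" and ?L = "drop (?r - ?s) ?bs"
  have r: "2 * ?s \<le> ?r" by (simp add: length_sym_dims)
  have P: "\<And>j. j < ?s \<Longrightarrow> (\<forall>k\<in>set (?bs ! j). odd k) \<and> ?bs ! (?r - 1 - j) = map Suc (?bs ! j)"
    using p unfolding pairing_iff_blocks[OF w] by blast
  have "rev ?L = map (map Suc) (take ?s ?bs)"
  proof (rule nth_equalityI)
    show "length (rev ?L) = length (map (map Suc) (take ?s ?bs))" using r by simp
    fix j assume "j < length (rev ?L)"
    then have j: "j < ?s" using r by simp
    have "rev ?L ! j = ?L ! (?s - Suc j)" using j r by (simp add: rev_nth)
    also have "\<dots> = ?bs ! (?r - 1 - j)" using j r by simp
    finally show "rev ?L ! j = map (map Suc) (take ?s ?bs) ! j" using P[OF j] j r by simp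
  qed
  moreover have "rev (concat (map rev L)) = concat (rev L)" for L :: "nat list list"
    by (simp add: rev_concat rev_map o_def)
  ultimately have "rev (concat (map rev ?L)) = map Suc ?Y" by (simp only: map_concat)
  then have tail: "concat (map rev ?L) = rev (map Suc ?Y)" by (metis rev_rev_ident)
  have oddY: "odd k" if k: "k \<in> set ?Y" for k
  proof -
    obtain b where b: "b \<in> set (take ?s ?bs)" "k \<in> set b" using k by auto
    then obtain j where "j < ?s" "b = ?bs ! j" using r by (auto simp: in_set_conv_nth)
    then show ?thesis using P b(2) by blast
  qed
  have lenY: "map length (take ?s ?bs) = ds"
  proof (rule nth_equalityI)
    show "length (map length (take ?s ?bs)) = length ds" using r by simp
    fix j assume "j < length (map length (take ?s ?bs))"
    then have j: "j < ?s" by simp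
    then show "map length (take ?s ?bs) ! j = ds ! j"
      using word_onD(5)[OF w, of j] sym_dims_nth[OF j] r by simp
  qed
  have blocks_concat: "blocks (map length bs) (concat bs @ zs) = bs" for bs and zs :: "nat list"
    by (induction bs) auto
  have bsplit: "?bs = take ?s ?bs @ (if e = 0 then [] else [?bs ! ?s]) @ ?L"
  proof (cases "e = 0")
    case True
    then have "?r - ?s = ?s" by (simp add: length_sym_dims)
    then show ?thesis using True by simp
  next
    case False
    then have "?r - ?s = Suc ?s" "?s < length ?bs" by (simp_all add: length_sym_dims)
    then show ?thesis using False by (simp add: Cons_nth_drop_Suc)
  qed
  have "mset w = mset (concat ?bs)" unfolding concat_blocks using word_onD(3)[OF w] by simp
  also have "\<dots> = mset ?Y + (if e = 0 then {#} else mset (?bs ! ?s)) + mset (concat ?L)"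
    by (subst bsplit) simp
  also have "mset (concat ?L) = mset (concat (map rev ?L))"
    by (simp add: mset_concat o_def)
  finally have msw: "mset w = mset ?Y + (if e = 0 then {#} else mset (?bs ! ?s)) + mset (rev (map Suc ?Y))"
    unfolding tail .
  define M where "M = (if e = 0 then [] else rearrange_middle (?bs ! ?s))"
  have "\<exists>ks. M = ks @ rev (map Suc ks) \<and> (\<forall>k\<in>set ks. odd k) \<and> mset M = (if e = 0 then {#} else mset (?bs ! ?s))"
  proof (cases "e = 0")
    case True
    then show ?thesis by (intro exI[of _ "[]"]) (simp add: M_def)
  next
    case False
    then have sr: "?s < ?r" by (simp add: length_sym_dims)
    have "\<exists>ks. ?bs ! ?s = concat (map (\<lambda>k. [k, Suc k]) ks) \<and> (\<forall>k\<in>set ks. odd k)"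
    proof (rule split_consecutive_pairs)
      show "sorted_wrt (<) (?bs ! ?s)" by (rule word_onD(4)[OF w sr])
      show "0 \<notin> set (?bs ! ?s)" using block_subset[OF w sr] by auto
    qed (rule mid[OF _ False])
    then obtain ks where ks: "?bs ! ?s = concat (map (\<lambda>k. [k, Suc k]) ks)" "\<forall>k\<in>set ks. odd k" by blast
    have M: "M = ks @ rev (map Suc ks)"
      using False nths_pairs[of "\<lambda>k. k" Suc ks] by (simp add: M_def rearrange_middle_def ks(1))
    have "mset (concat (map (\<lambda>k. [k, Suc k]) ks)) = mset ks + mset (map Suc ks)"
      by (induction ks) simp_all
    then show ?thesis using M ks False by (intro exI[of _ ks]) simp
  qed
  then obtain ks where ks: "M = ks @ rev (map Suc ks)" "\<forall>k\<in>set ks. odd k"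
    "mset M = (if e = 0 then {#} else mset (?bs ! ?s))" by blast
  have "canonical_rearrangement ds e w = ?Y @ M @ concat (map rev ?L)"
    by (simp add: canonical_rearrangement_def Let_def M_def)
  then have form: "canonical_rearrangement ds e w = ?Y @ M @ rev (map Suc ?Y)" unfolding tail .
  show ?thesis
  proof (intro exI[of _ "?Y @ ks"] conjI)
    show "canonical_rearrangement ds e w = (?Y @ ks) @ rev (map Suc (?Y @ ks))"
      unfolding form ks(1) by simp
    show "\<forall>k\<in>set (?Y @ ks). odd k" using oddY ks(2) by auto
    show "take ?s ?bs = blocks ds (?Y @ ks)" using blocks_concat[of "take ?s ?bs" ks] unfolding lenY by simp
    show "mset (canonical_rearrangement ds e w) = mset w" unfolding form msw by (simp add: ks(3))
  qed
qed

lemma sym_dims_complete: "complete_dims (2 * m) = sym_dims (replicate m 1) 0"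
  by (simp add: complete_dims_def sym_dims_def replicate_add[symmetric] mult_2)

lemma blocks_replicate: "length w = n \<Longrightarrow> blocks (replicate n 1) w = map (\<lambda>x. [x]) w"
proof (induction n arbitrary: w)
  case (Suc n)
  then show ?case by (cases w) simp_all
qed simp

lemma canonical_rearrangement_complete:
  assumes X: "v = X @ rev (map Suc X)" "\<forall>k\<in>set X. odd k" and m: "length v = 2 * m" "0 < m"
    and v: "distinct v" "set v = {1..2 * m}"
  shows "word_on (complete_dims (2 * m)) v" "generalized_strictly_pairing (replicate m 1) 0 v"
proof -
  have bl: "blocks (complete_dims (2 * m)) v = map (\<lambda>x. [x]) v"
    unfolding complete_dims_def by (rule blocks_replicate[OF m(1)])
  have "\<forall>b\<in>set (blocks (complete_dims (2 * m)) v). sorted_wrt (<) b" unfolding bl by auto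
  moreover have "v \<in> permutations_of_set {1..sum_list (complete_dims (2 * m))}"
    using v by (simp add: complete_dims_def permutations_of_set_def sum_list_replicate)
  moreover have "complete_dims (2 * m) \<noteq> []" "\<forall>d\<in>set (complete_dims (2 * m)). 1 \<le> d"
    using m(2) by (simp_all add: complete_dims_def)
  ultimately show "word_on (complete_dims (2 * m)) v"
    unfolding word_on_def minimal_reps_def by blast
  have lX: "length X = m" using X(1) m(1) by simp
  show "generalized_strictly_pairing (replicate m 1) 0 v"
    unfolding generalized_strictly_pairing_def sym_dims_complete[symmetric] bl Let_def
  proof (intro allI impI)
    fix j i :: nat assume j: "j < length (replicate m (1 :: nat))" and i: "i < replicate m 1 ! j"
    have jm: "j < m" "i = 0" using i j by auto
    have 1: "v ! j = X ! j" using X(1) lX jm by (simp add: nth_append)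
    have 2: "rev v ! j = Suc (X ! j)" using X(1) lX jm by (simp add: nth_append)
    have "rev (map (\<lambda>x. [x]) v) ! j = [rev v ! j]"
      unfolding rev_map using jm m(1) by simp
    then show "odd (map (\<lambda>x. [x]) v ! j ! i) \<and> rev (map (\<lambda>x. [x]) v) ! j ! i = map (\<lambda>x. [x]) v ! j ! i + 1"
      using jm m(1) 1 2 X(2) lX by simp
  qed
qed

theorem theorem29:
  fixes ds :: "nat list" and e :: nat and c ch :: "nat list"
    and D C\<^sub>0 Dh Ch\<^sub>0 :: "('m::{finite,linorder} + 'm) flag set"
  assumes "\<forall>d\<in>set ds. 1 \<le> d"
    and "c = sym_dims ds e"
    and "sum_list c = 2 * CARD('m)"
    and "ch = complete_dims (2 * CARD('m))"
    and "is_open_orbit c D" and "is_base_cycle c D C\<^sub>0"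
    and "is_open_orbit ch Dh" and "is_base_cycle ch Dh Ch\<^sub>0"
  shows "(\<forall>w\<in>minimal_reps c.
            generalized_strictly_pairing ds e w \<longleftrightarrow> schubert c w \<in> schubert_set c C\<^sub>0) \<and>
         (\<exists>f \<in> schubert_set c C\<^sub>0 \<rightarrow> schubert_set ch Ch\<^sub>0.
            (\<forall>w\<in>minimal_reps c. schubert c w \<in> schubert_set c C\<^sub>0 \<longrightarrow>
               f (schubert c w) = schubert ch (canonical_rearrangement ds e w)) \<and>
            inj_on f (schubert_set c C\<^sub>0))"
proof -
  let ?m = "CARD('m)"
  let ?S = "\<lambda>w. schubert c w :: ('m + 'm) flag set"
  let ?hat = "canonical_rearrangement ds e"
  have cm: "sum_list c = CARD('m + 'm)" using assms(3) by simp
  have "c \<noteq> []" using assms(3) by auto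
  moreover have "\<forall>d\<in>set c. 1 \<le> d" using assms(1) by (auto simp: assms(2) sym_dims_def)
  ultimately have won: "word_on c w" if "w \<in> minimal_reps c" for w
    using that by (simp add: word_on_def)
  have iff: "?S w \<in> schubert_set c C\<^sub>0 \<longleftrightarrow> generalized_strictly_pairing ds e w" if "w \<in> minimal_reps c" for w
    using schubert_mem_iff[of ds e w D C\<^sub>0] won[OF that] assms(3,5,6) unfolding assms(2) by blast
  have ch1: "ch = sym_dims (replicate ?m 1) 0" unfolding assms(4) by (rule sym_dims_complete)
  have ch2: "sum_list ch = 2 * ?m" "sum_list ch = CARD('m + 'm)"
    by (simp_all add: assms(4) complete_dims_def sum_list_replicate)
  have form: "\<exists>X. ?hat w = X @ rev (map Suc X) \<and> (\<forall>k\<in>set X. odd k) \<and>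
      take (length ds) (blocks c w) = blocks ds X \<and> mset (?hat w) = mset w"
    if w: "w \<in> minimal_reps c" and p: "generalized_strictly_pairing ds e w" for w
    unfolding assms(2)
  proof (rule canonical_rearrangement_form[OF won[OF w, unfolded assms(2)] assms(3)[unfolded assms(2)] p])
    fix k :: nat assume k: "odd k" and e: "e \<noteq> 0"
    let ?s = "length ds"
    have r: "length c = 2 * ?s + 1" "?s < length c" using e by (simp_all add: assms(2) length_sym_dims)
    have "paired (length c) (word_step c w :: 'm + 'm \<Rightarrow> nat)"
      unfolding assms(2) by (rule paired_iff_pairing[OF won[OF w, unfolded assms(2)] cm[unfolded assms(2)], THEN iffD2, OF p])
    then have L: "word_block c w k + word_block c w (Suc k) + 1 = length c" if "k \<le> sum_list c"
      using that k unfolding paired_word_step_iff[OF cm] by blast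
    have k1: "k \<in> {1..sum_list c} \<longleftrightarrow> Suc k \<in> {1..sum_list c}"
      using k assms(3) by (auto simp: le_Suc_eq Suc_le_eq order_le_less dest: odd_pos)
    have blk: "k' \<in> set (blocks c w ! ?s) \<longleftrightarrow> k' \<in> {1..sum_list c} \<and> word_block c w k' = ?s" for k'
      using block_subset[OF won[OF w] r(2)] in_block_iff[OF won[OF w] r(2)] by blast
    show "k \<in> set (blocks (sym_dims ds e) w ! ?s) \<longleftrightarrow> Suc k \<in> set (blocks (sym_dims ds e) w ! ?s)"
      unfolding assms(2)[symmetric] blk using k1 L r(1) by auto
  qed
  have hat: "word_on ch (?hat w) \<and> schubert ch (?hat w) \<in> schubert_set ch Ch\<^sub>0"
    if w: "w \<in> minimal_reps c" and p: "generalized_strictly_pairing ds e w" for w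
  proof -
    obtain X where X: "?hat w = X @ rev (map Suc X)" "\<forall>k\<in>set X. odd k" "mset (?hat w) = mset w"
      using form[OF w p] by blast
    note wd = word_onD(1-3)[OF won[OF w]]
    have len: "length (?hat w) = 2 * ?m" using arg_cong[OF X(3), of size] wd(3) assms(3) by simp
    have set: "set (?hat w) = {1..2 * ?m}" using mset_eq_setD[OF X(3)] wd(2) assms(3) by simp
    have dist: "distinct (?hat w)" using mset_eq_imp_distinct_iff[OF X(3)] wd(1) by simp
    note comp = canonical_rearrangement_complete[OF X(1,2) len zero_less_card_finite dist set]
    have "word_on ch (?hat w)" using comp(1) unfolding assms(4) .
    moreover have "schubert ch (?hat w) \<in> schubert_set ch Ch\<^sub>0"
      unfolding ch1
      by (rule schubert_mem_iff[THEN iffD2, OF _ _ _ _ comp(2)])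
        (use comp(1) ch2(1) assms(7,8) in \<open>simp_all only: assms(4) sym_dims_complete\<close>)
    ultimately show ?thesis by blast
  qed
  \<comment> \<open>The first half of the rearranged word determines the first blocks, the pairing
    then the last ones, and the middle block consists of the letters left over.\<close>
  have hat_inj: "w = w'" if w: "w \<in> minimal_reps c" "generalized_strictly_pairing ds e w"
    and w': "w' \<in> minimal_reps c" "generalized_strictly_pairing ds e w'" and eq: "?hat w = ?hat w'" for w w'
  proof -
    let ?s = "length ds"
    obtain X where X: "?hat w = X @ rev (map Suc X)" "take ?s (blocks c w) = blocks ds X" using form[OF w] by blast
    obtain X' where X': "?hat w' = X' @ rev (map Suc X')" "take ?s (blocks c w') = blocks ds X'" using form[OF w'] by blast
    have "length (?hat w) = length (?hat w')" using eq by simp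
    then have "length X = length X'" unfolding X(1) X'(1) by simp
    then have "X = X'" using eq unfolding X(1) X'(1) by simp
    then have bl: "blocks c w ! j = blocks c w' ! j" if "j < ?s" for j
      using X(2) X'(2) that by (metis nth_take)
    have r: "2 * ?s \<le> length c" "length c \<le> 2 * ?s + 1" by (simp_all add: assms(2) length_sym_dims)
    have pw: "paired (length c) (word_step c v :: 'm + 'm \<Rightarrow> nat)"
      if "v \<in> minimal_reps c" "generalized_strictly_pairing ds e v" for v
      unfolding assms(2)
      by (rule paired_iff_pairing[OF won[OF that(1), unfolded assms(2)] cm[unfolded assms(2)], THEN iffD2, OF that(2)])
    note P = pw[OF w, unfolded paired_word_step_iff[OF cm], rule_format]
      and P' = pw[OF w', unfolded paired_word_step_iff[OF cm], rule_format]
    have lt: "word_block c w k = word_block c w' k" if k: "k \<in> {1..sum_list c}" and j: "word_block c w k < ?s \<or> word_block c w' k < ?s" for k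
    proof -
      have "k \<in> set (blocks c w ! j) \<longleftrightarrow> word_block c w k = j" "k \<in> set (blocks c w' ! j) \<longleftrightarrow> word_block c w' k = j" if "j < ?s" for j
        using in_block_iff[OF won[OF w(1)] _ k] in_block_iff[OF won[OF w'(1)] _ k] that r by simp_all
      then show ?thesis using j bl by metis
    qed
    have odd: "word_block c w k = word_block c w' k" if k: "odd k \<and> k \<le> sum_list c" for k
    proof (cases "word_block c w k < ?s \<or> word_block c w' k < ?s")
      case True
      have "k \<in> {1..sum_list c}" using k by (auto intro: Suc_leI odd_pos)
      then show ?thesis using lt True by blast
    next
      case False
      \<comment> \<open>An odd letter never lies beyond the middle, so outside the first blocks it
        is in the middle block for both words.\<close>
      have "2 * word_block c w k + 1 \<le> length c" "2 * word_block c w' k + 1 \<le> length c" using P[OF k] P'[OF k] by linarith+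
      then show ?thesis using False r by linarith
    qed
    have all: "word_block c w k = word_block c w' k" if k: "k \<in> {1..sum_list c}" for k
    proof (cases "odd k")
      case True
      then show ?thesis using odd k by simp
    next
      case False
      then have k': "odd (k - 1) \<and> k - 1 \<le> sum_list c" "Suc (k - 1) = k" using k by auto
      show ?thesis using odd[OF k'(1)] P[OF k'(1)] P'[OF k'(1)] unfolding k'(2) by linarith
    qed
    have "word_step c w = (word_step c w' :: 'm + 'm \<Rightarrow> nat)"
      unfolding word_step_def using all Suc_letter_mem[OF cm] by (intro ext) blast
    then show "w = w'" by (rule word_step_inj[OF won[OF w(1)] won[OF w'(1)] cm])
  qed
  \<comment> \<open>The lifting map is a function of the variety, so a word is chosen for each;
    \<open>schubert_inj\<close> shows that there is only one to choose.\<close>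
  define word where "word S = (SOME w. w \<in> minimal_reps c \<and> S = ?S w)" for S
  have word: "word (?S w) = w" if w: "w \<in> minimal_reps c" for w
  proof -
    have "word (?S w) \<in> minimal_reps c \<and> ?S w = ?S (word (?S w))"
      unfolding word_def by (rule someI[of _ w]) (simp add: w)
    then have "w = word (?S w)" by (intro schubert_inj[OF won[OF w] won cm]) simp_all
    then show ?thesis by (rule sym)
  qed
  define f where "f S = (schubert ch (?hat (word S)) :: ('m + 'm) flag set)" for S
  have f: "f (?S w) = schubert ch (?hat w)" if "w \<in> minimal_reps c" for w
    unfolding f_def word[OF that] ..
  have mem: "\<exists>w. w \<in> minimal_reps c \<and> generalized_strictly_pairing ds e w \<and> S = ?S w" if S: "S \<in> schubert_set c C\<^sub>0" for S
  proof -
    obtain w where "w \<in> minimal_reps c" "S = ?S w" using S unfolding schubert_set_def by blast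
    then show ?thesis using iff S by blast
  qed
  have "f \<in> schubert_set c C\<^sub>0 \<rightarrow> schubert_set ch Ch\<^sub>0"
  proof
    fix S assume "S \<in> schubert_set c C\<^sub>0"
    then obtain w where w: "w \<in> minimal_reps c" "generalized_strictly_pairing ds e w" "S = ?S w" using mem by blast
    then show "f S \<in> schubert_set ch Ch\<^sub>0" using hat[OF w(1,2)] f[OF w(1)] by simp
  qed
  moreover have "inj_on f (schubert_set c C\<^sub>0)"
  proof (rule inj_onI)
    fix S S' assume S: "S \<in> schubert_set c C\<^sub>0" "S' \<in> schubert_set c C\<^sub>0" and eq: "f S = f S'"
    obtain w where w: "w \<in> minimal_reps c" "generalized_strictly_pairing ds e w" "S = ?S w" using mem[OF S(1)] by blast
    obtain w' where w': "w' \<in> minimal_reps c" "generalized_strictly_pairing ds e w'" "S' = ?S w'" using mem[OF S(2)] by blast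
    have "schubert ch (?hat w) = (schubert ch (?hat w') :: ('m + 'm) flag set)"
      using eq f[OF w(1)] f[OF w'(1)] w(3) w'(3) by simp
    then have "?hat w = ?hat w'"
      using hat[OF w(1,2)] hat[OF w'(1,2)] by (intro schubert_inj[OF _ _ ch2(2)]) blast+
    then show "S = S'" using hat_inj[OF w(1,2) w'(1,2)] w(3) w'(3) by simp
  qed
  ultimately show ?thesis using iff f by blast
qed

end
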